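(* For every $n\ge1$, $$Z_n^{20V}=CT_{x_1,\dots,x_n}\left\{\frac{\prod_{1\le i<j\le n}(x_i-x_j)(1+x_i+x_j-x_ix_j)}{\prod_{i=1}^n x_i^{2i-1}(1-x_i)^n}\right\},$$ where $CT_{x_1,\dots,x_n}$ denotes the constant coefficient of the Laurent series expansion around $x_i=0$ for all $i$.
   Context: 20V model with DWBC3 on the quadrangle $\mathcal Q_n$: let $V=\{(x,y)\in\mathbb Z^2:1\le x\le n,\ 1\le y\le 2n-1,\ x+y\ge n+1\}$. Each $p\in V$ has incoming edges from $p-(1,0)$, $p+(0,1)$, $p+(-1,1)$ and outgoing edges to $p+(1,0)$, $p-(0,1)$, $p+(1,-1)$. Edges between vertices of $V$ are internal; the others are boundary edges, fixed as: the edge from $(0,y)$ to $(1,y)$ occupied for each $(1,y)\in V$; the edge from $p$ to $p-(0,1)$ occupied whenever $p\in V$, $p-(0,1)\notin V$; all other boundary edges empty. A configuration assigns occupied/empty to internal edges so that at each vertex the numbers of occupied incoming and outgoing edges agree. $Z_n^{20V}$ is the number of configurations.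
   Formalization: The factor (x_i − x_j) is replaced by (x_j − x_i), changing the right side by (−1)^{n(n−1)/2}: as printed the formula gives −4 at n = 2, whereas Z_2^{20V} = 4; the two agree for n ≡ 0, 1 mod 4. *)

theory Defs
  imports Complex_Main "HOL-Library.Poly_Mapping" "HOL-Library.Product_Plus"
begin

section \<open>The 20V model on the quadrangle with DWBC3\<close>

definition quadrangle :: "nat \<Rightarrow> (int \<times> int) set" where
  "quadrangle n = {(x, y). 1 \<le> x \<and> x \<le> int n \<and> 1 \<le> y \<and> y \<le> 2 * int n - 1 \<and> x + y \<ge> int n + 1}"

text \<open>An edge is the pair (source, target) of lattice points; the edge set consists of all
  lattice edges with at least one endpoint in the quadrangle.\<close>

definition edges20V :: "nat \<Rightarrow> ((int \<times> int) \<times> (int \<times> int)) set" where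
  "edges20V n = {(p, q). q \<in> {p + (1, 0), p - (0, 1), p + (1, -1)} \<and>
                         (p \<in> quadrangle n \<or> q \<in> quadrangle n)}"

definition internal_edges20V :: "nat \<Rightarrow> ((int \<times> int) \<times> (int \<times> int)) set" where
  "internal_edges20V n = {(p, q) \<in> edges20V n. p \<in> quadrangle n \<and> q \<in> quadrangle n}"

text \<open>The occupied boundary edges; all other boundary edges are empty.\<close>

definition dwbc3 :: "nat \<Rightarrow> ((int \<times> int) \<times> (int \<times> int)) set" where
  "dwbc3 n = {((0, y), (1, y)) | y. (1, y) \<in> quadrangle n} \<union>
             {(p, p - (0, 1)) | p. p \<in> quadrangle n \<and> p - (0, 1) \<notin> quadrangle n}"

text \<open>A configuration is represented by the set of its occupied internal edges.\<close>

definition configs20V :: "nat \<Rightarrow> ((int \<times> int) \<times> (int \<times> int)) set set" where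
  "configs20V n = {S. S \<subseteq> internal_edges20V n \<and>
     (\<forall>v \<in> quadrangle n. card {u. (u, v) \<in> S \<union> dwbc3 n} = card {w. (v, w) \<in> S \<union> dwbc3 n})}"

definition Z20V :: "nat \<Rightarrow> nat" where
  "Z20V n = card (configs20V n)"

lemma dwbc3_boundary: "dwbc3 n \<subseteq> edges20V n - internal_edges20V n"
  by (auto simp: dwbc3_def edges20V_def internal_edges20V_def quadrangle_def)

lemma finite_quadrangle: "finite (quadrangle n)"
  by (rule finite_subset[of _ "{1..int n} \<times> {1..2 * int n - 1}"]) (auto simp: quadrangle_def)

lemma finite_configs20V: "finite (configs20V n)"
proof (rule finite_subset)
  show "configs20V n \<subseteq> Pow (quadrangle n \<times> quadrangle n)"
    by (auto simp: configs20V_def internal_edges20V_def)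
qed (simp add: finite_quadrangle)


section \<open>Formal Laurent series in several variables\<close>

text \<open>The variables are indexed by the naturals, and each monomial involves finitely many of
  them. As for one-variable formal Laurent series, the exponents are bounded from below, here
  by a fixed exponent vector.\<close>

definition bdd_by :: "(nat \<Rightarrow>\<^sub>0 int) \<Rightarrow> ((nat \<Rightarrow>\<^sub>0 int) \<Rightarrow> 'a::zero) \<Rightarrow> bool" where
  "bdd_by m f \<longleftrightarrow>
     (\<forall>k. f k \<noteq> 0 \<longrightarrow> (\<forall>i. Poly_Mapping.lookup m i \<le> Poly_Mapping.lookup k i))"

typedef (overloaded) 'a mls = "{f :: (nat \<Rightarrow>\<^sub>0 int) \<Rightarrow> 'a::zero. \<exists>m. bdd_by m f}"
  morphisms mls_coeff Abs_mls
  by (rule exI[of _ "\<lambda>_. 0"]) (simp add: bdd_by_def)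

setup_lifting type_definition_mls

lemma mls_eqI: "(\<And>k. mls_coeff f k = mls_coeff g k) \<Longrightarrow> f = g"
  by (metis mls_coeff_inject ext)

definition ebox :: "(nat \<Rightarrow>\<^sub>0 int) \<Rightarrow> (nat \<Rightarrow>\<^sub>0 int) \<Rightarrow> (nat \<Rightarrow>\<^sub>0 int) set" where
  "ebox l u = {k. \<forall>i. Poly_Mapping.lookup l i \<le> Poly_Mapping.lookup k i \<and> Poly_Mapping.lookup k i \<le> Poly_Mapping.lookup u i}"

lemma finite_ebox: "finite (ebox l u)"
proof -
  define K where "K = Poly_Mapping.keys l \<union> Poly_Mapping.keys u"
  define B where "B = (\<Union>i\<in>K. {Poly_Mapping.lookup l i..Poly_Mapping.lookup u i})"
  have "Poly_Mapping.lookup ` ebox l u \<subseteq> {f. \<forall>i. (i \<in> K \<longrightarrow> f i \<in> B) \<and> (i \<notin> K \<longrightarrow> f i = 0)}"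
  proof safe
    fix k i assume k: "k \<in> ebox l u"
    show "Poly_Mapping.lookup k i \<in> B" if "i \<in> K"
      using k that by (auto simp: ebox_def B_def)
    show "Poly_Mapping.lookup k i = 0" if "i \<notin> K"
    proof -
      have "Poly_Mapping.lookup l i = 0" "Poly_Mapping.lookup u i = 0"
        using that by (auto simp: K_def in_keys_iff)
      then show ?thesis using k by (auto simp: ebox_def dest!: spec[of _ i])
    qed
  qed
  moreover have "finite {f. \<forall>i. (i \<in> K \<longrightarrow> f i \<in> B) \<and> (i \<notin> K \<longrightarrow> f i = (0::int))}"
    by (rule finite_set_of_finite_funs) (auto simp: K_def B_def)
  ultimately have "finite (Poly_Mapping.lookup ` ebox l u)" by (rule finite_subset)
  then show ?thesis
    by (rule finite_imageD) (auto simp: inj_on_def intro: poly_mapping_eqI)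
qed

definition conv :: "((nat \<Rightarrow>\<^sub>0 int) \<Rightarrow> 'a::comm_ring_1) \<Rightarrow> ((nat \<Rightarrow>\<^sub>0 int) \<Rightarrow> 'a) \<Rightarrow> (nat \<Rightarrow>\<^sub>0 int) \<Rightarrow> 'a"
  where "conv f g k = (\<Sum>a | f a \<noteq> 0 \<and> g (k - a) \<noteq> 0. f a * g (k - a))"

lemma conv_support:
  assumes "bdd_by m f" "bdd_by m' g" "f a \<noteq> 0" "g (k - a) \<noteq> 0"
  shows "a \<in> ebox m (k - m')"
proof -
  have "Poly_Mapping.lookup m i \<le> Poly_Mapping.lookup a i" "Poly_Mapping.lookup m' i \<le> Poly_Mapping.lookup k i - Poly_Mapping.lookup a i" for i
    using assms by (auto simp: bdd_by_def lookup_minus)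
  then show ?thesis by (simp add: ebox_def lookup_minus algebra_simps)
qed

lemma conv_eq_sum:
  assumes "finite A" "\<And>a. f a \<noteq> 0 \<Longrightarrow> g (k - a) \<noteq> 0 \<Longrightarrow> a \<in> A"
  shows "conv f g k = (\<Sum>a\<in>A. f a * g (k - a))"
  unfolding conv_def using assms
  by (intro sum.mono_neutral_left) auto

lemma conv_eq_box:
  assumes "bdd_by m f" "bdd_by m' g"
  shows "conv f g k = (\<Sum>a\<in>ebox m (k - m'). f a * g (k - a))"
proof (rule conv_eq_sum[OF finite_ebox])
  fix a assume "f a \<noteq> 0" "g (k - a) \<noteq> 0"
  then show "a \<in> ebox m (k - m')" by (rule conv_support[OF assms])
qed

lemma bdd_by_conv:
  assumes "bdd_by m f" "bdd_by m' g"
  shows "bdd_by (m + m') (conv f g)"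
  unfolding bdd_by_def
proof (intro allI impI)
  fix k i assume "conv f g k \<noteq> 0"
  then obtain a where "f a \<noteq> 0" "g (k - a) \<noteq> 0"
    unfolding conv_def by (elim sum.not_neutral_contains_not_neutral) auto
  then have "Poly_Mapping.lookup m i \<le> Poly_Mapping.lookup a i" "Poly_Mapping.lookup m' i \<le> Poly_Mapping.lookup (k - a) i"
    using assms by (auto simp: bdd_by_def)
  then show "Poly_Mapping.lookup (m + m') i \<le> Poly_Mapping.lookup k i"
    by (simp add: lookup_add lookup_minus)
qed

lemma conv_comm: "conv f g k = conv g f k"
  unfolding conv_def
  by (rule sum.reindex_bij_witness[of _ "\<lambda>a. k - a" "\<lambda>a. k - a"]) (auto simp: mult.commute)

lemma conv_assoc:
  assumes f: "bdd_by m1 f" and g: "bdd_by m2 g" and h: "bdd_by m3 h"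
  shows "conv (conv f g) h k = conv f (conv g h) k"
proof -
  define D where "D = ebox (m1 + m2) (k - m3)"
  define A where "A = ebox m1 (k - (m2 + m3))"
  have fin: "finite D" "finite A" by (simp_all add: D_def A_def finite_ebox)
  have "conv (conv f g) h k = (\<Sum>d\<in>D. conv f g d * h (k - d))"
    unfolding D_def by (rule conv_eq_box[OF bdd_by_conv[OF f g] h])
  also have "\<dots> = (\<Sum>d\<in>D. \<Sum>a\<in>A. f a * (g (d - a) * h (k - d)))"
  proof (rule sum.cong[OF refl])
    fix d assume d: "d \<in> D"
    have "conv f g d = (\<Sum>a\<in>A. f a * g (d - a))"
    proof (rule conv_eq_sum[OF fin(2)])
      fix a assume "f a \<noteq> 0" "g (d - a) \<noteq> 0"
      then have "a \<in> ebox m1 (d - m2)" by (rule conv_support[OF f g])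
      with d show "a \<in> A"
        by (auto simp: A_def D_def ebox_def lookup_minus lookup_add) (smt (verit))
    qed
    then show "conv f g d * h (k - d) = (\<Sum>a\<in>A. f a * (g (d - a) * h (k - d)))"
      by (simp add: sum_distrib_right mult.assoc)
  qed
  also have "\<dots> = (\<Sum>a\<in>A. \<Sum>d\<in>D. f a * (g (d - a) * h (k - d)))"
    by (rule sum.swap)
  also have "\<dots> = (\<Sum>a\<in>A. f a * conv g h (k - a))"
  proof (rule sum.cong[OF refl])
    fix a
    show "(\<Sum>d\<in>D. f a * (g (d - a) * h (k - d))) = f a * conv g h (k - a)"
    proof (cases "f a = 0")
      case False
      have "conv g h (k - a) = (\<Sum>b\<in>(\<lambda>d. d - a) ` D. g b * h (k - a - b))"
      proof (rule conv_eq_sum)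
        fix b assume b: "g b \<noteq> 0" "h (k - a - b) \<noteq> 0"
        have "Poly_Mapping.lookup m1 i \<le> Poly_Mapping.lookup a i" "Poly_Mapping.lookup m2 i \<le> Poly_Mapping.lookup b i"
             "Poly_Mapping.lookup m3 i \<le> Poly_Mapping.lookup k i - Poly_Mapping.lookup a i - Poly_Mapping.lookup b i" for i
          using False b f g h by (auto simp: bdd_by_def lookup_minus)
        then have "a + b \<in> D"
          by (auto simp: D_def ebox_def lookup_minus lookup_add add_mono) (smt (verit))
        then show "b \<in> (\<lambda>d. d - a) ` D"
          by (intro image_eqI[of _ _ "a + b"]) auto
      qed (use fin in auto)
      also have "\<dots> = (\<Sum>d\<in>D. g (d - a) * h (k - d))"
        by (subst sum.reindex) (auto simp: inj_on_def)
      finally show ?thesis by (simp add: sum_distrib_left)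
    qed simp
  qed
  also have "\<dots> = conv f (conv g h) k"
    unfolding A_def by (rule conv_eq_box[OF f bdd_by_conv[OF g h], symmetric])
  finally show ?thesis .
qed

lemma conv_distrib:
  assumes f: "bdd_by m1 f" and g: "bdd_by m2 g" and h: "bdd_by m3 h"
  shows "conv (\<lambda>k. f k + g k) h k = conv f h k + conv g h k"
proof -
  define A where "A = ebox m1 (k - m3) \<union> ebox m2 (k - m3)"
  have fin: "finite A" by (simp add: A_def finite_ebox)
  have "conv f h k = (\<Sum>a\<in>A. f a * h (k - a))"
    by (rule conv_eq_sum[OF fin]) (use conv_support[OF f h] in \<open>simp add: A_def\<close>)
  moreover have "conv g h k = (\<Sum>a\<in>A. g a * h (k - a))"
    by (rule conv_eq_sum[OF fin]) (use conv_support[OF g h] in \<open>simp add: A_def\<close>)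
  moreover have "conv (\<lambda>k. f k + g k) h k = (\<Sum>a\<in>A. (f a + g a) * h (k - a))"
  proof (rule conv_eq_sum[OF fin])
    fix a assume "f a + g a \<noteq> 0" "h (k - a) \<noteq> 0"
    moreover from this have "f a \<noteq> 0 \<or> g a \<noteq> 0" by auto
    ultimately show "a \<in> A"
      using conv_support[OF f h, of a k] conv_support[OF g h, of a k] unfolding A_def by blast
  qed
  ultimately show ?thesis by (simp add: sum.distrib distrib_right)
qed

lemma bdd_by_plus:
  fixes f g :: "(nat \<Rightarrow>\<^sub>0 int) \<Rightarrow> 'a::comm_ring_1"
  assumes "bdd_by m f" "bdd_by m' g"
  shows "\<exists>l. bdd_by l (\<lambda>k. f k + g k)"
proof -
  define l where "l = Abs_poly_mapping (\<lambda>i. min (Poly_Mapping.lookup m i) (Poly_Mapping.lookup m' i))"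
  have "finite {i. min (Poly_Mapping.lookup m i) (Poly_Mapping.lookup m' i) \<noteq> 0}"
    by (rule finite_subset[of _ "Poly_Mapping.keys m \<union> Poly_Mapping.keys m'"])
      (auto simp: in_keys_iff min_def split: if_splits)
  then have l: "Poly_Mapping.lookup l i = min (Poly_Mapping.lookup m i) (Poly_Mapping.lookup m' i)" for i
    unfolding l_def by (subst Abs_poly_mapping_inverse) auto
  have "min (Poly_Mapping.lookup m i) (Poly_Mapping.lookup m' i) \<le> Poly_Mapping.lookup k i"
    if "f k + g k \<noteq> 0" for k i
  proof -
    have "f k \<noteq> 0 \<or> g k \<noteq> 0" using that by auto
    then show ?thesis using assms by (auto simp: bdd_by_def min_le_iff_disj)
  qed
  then show ?thesis unfolding bdd_by_def l[symmetric] by blast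
qed

lemma ex_bdd_by_plus:
  fixes f g :: "(nat \<Rightarrow>\<^sub>0 int) \<Rightarrow> 'a::comm_ring_1"
  shows "\<exists>m. bdd_by m f \<Longrightarrow> \<exists>m. bdd_by m g \<Longrightarrow> \<exists>m. bdd_by m (\<lambda>k. f k + g k)"
  by (elim exE) (rule bdd_by_plus)

lemma ex_bdd_by_conv:
  "\<exists>m. bdd_by m f \<Longrightarrow> \<exists>m. bdd_by m g \<Longrightarrow> \<exists>m. bdd_by m (conv f g)"
  by (elim exE) (rule exI, rule bdd_by_conv)

lemma bdd_by_mls_coeff: "\<exists>m. bdd_by m (mls_coeff f)"
  using mls_coeff[of f] by simp

instantiation mls :: (comm_ring_1) comm_ring_1
begin

lift_definition zero_mls :: "'a mls" is "\<lambda>_. 0"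
  by (simp add: bdd_by_def)

lift_definition one_mls :: "'a mls" is "\<lambda>k. if k = 0 then 1 else 0"
  by (rule exI[of _ 0]) (simp add: bdd_by_def)

lift_definition uminus_mls :: "'a mls \<Rightarrow> 'a mls" is "\<lambda>f k. - f k"
  by (simp add: bdd_by_def)

lift_definition plus_mls :: "'a mls \<Rightarrow> 'a mls \<Rightarrow> 'a mls" is "\<lambda>f g k. f k + g k"
  by (rule ex_bdd_by_plus)

definition minus_mls :: "'a mls \<Rightarrow> 'a mls \<Rightarrow> 'a mls" where
  "minus_mls f g = f + - g"

lift_definition times_mls :: "'a mls \<Rightarrow> 'a mls \<Rightarrow> 'a mls" is conv
  by (rule ex_bdd_by_conv)

instance
proof
  fix f g h :: "'a mls"
  obtain m1 where f: "bdd_by m1 (mls_coeff f)" using bdd_by_mls_coeff[of f] by (rule exE)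
  obtain m2 where g: "bdd_by m2 (mls_coeff g)" using bdd_by_mls_coeff[of g] by (rule exE)
  obtain m3 where h: "bdd_by m3 (mls_coeff h)" using bdd_by_mls_coeff[of h] by (rule exE)
  note b = f g h
  show "f * g * h = f * (g * h)"
    by (rule mls_eqI) (simp add: times_mls.rep_eq conv_assoc[OF b])
  show "f * g = g * f"
    by (rule mls_eqI) (simp add: times_mls.rep_eq conv_comm)
  show "(f + g) * h = f * h + g * h"
    by (rule mls_eqI) (simp add: times_mls.rep_eq plus_mls.rep_eq conv_distrib[OF b])
  show "1 * f = f"
  proof (rule mls_eqI)
    fix k
    have "mls_coeff (1 * f) k = (\<Sum>a\<in>{0}. mls_coeff 1 a * mls_coeff f (k - a))"
      unfolding times_mls.rep_eq by (rule conv_eq_sum) (auto simp: one_mls.rep_eq split: if_splits)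
    then show "mls_coeff (1 * f) k = mls_coeff f k" by (simp add: one_mls.rep_eq)
  qed
  show "f + g + h = f + (g + h)"
    by (rule mls_eqI) (simp add: plus_mls.rep_eq add.assoc)
  show "f + g = g + f"
    by (rule mls_eqI) (simp add: plus_mls.rep_eq add.commute)
  show "0 + f = f"
    by (rule mls_eqI) (simp add: plus_mls.rep_eq zero_mls.rep_eq)
  show "- f + f = 0"
    by (rule mls_eqI) (simp add: plus_mls.rep_eq zero_mls.rep_eq uminus_mls.rep_eq)
  show "f - g = f + - g" by (simp add: minus_mls_def)
  have "mls_coeff (0::'a mls) 0 \<noteq> mls_coeff 1 0"
    by (simp add: zero_mls.rep_eq one_mls.rep_eq)
  then show "(0::'a mls) \<noteq> 1" by metis
qed

end

text \<open>Division is by units of the ring; the quotient by a non-unit is 0.\<close>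

instantiation mls :: (comm_ring_1) inverse
begin

definition inverse_mls :: "'a mls \<Rightarrow> 'a mls" where
  "inverse_mls f = (if f dvd 1 then (THE g. f * g = 1) else 0)"

definition divide_mls :: "'a mls \<Rightarrow> 'a mls \<Rightarrow> 'a mls" where
  "divide_mls f g = f * inverse g"

instance ..

end

lemma mls_inverse_unique:
  fixes f g :: "'a::comm_ring_1 mls"
  assumes "f * g = 1"
  shows "inverse f = g"
proof -
  have "(THE g. f * g = 1) = g"
  proof (rule the_equality)
    show "f * g = 1" by (rule assms)
  next
    fix h assume "f * h = 1"
    have "h = (f * g) * h" by (simp add: assms)
    also have "\<dots> = (f * h) * g" by (simp only: mult.commute mult.left_commute)
    finally show "h = g" by (simp add: \<open>f * h = 1\<close>)
  qed
  moreover have "f dvd 1" by (rule dvdI[OF assms[symmetric]])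
  ultimately show ?thesis by (simp add: inverse_mls_def)
qed

lift_definition mls_X :: "nat \<Rightarrow> 'a::comm_ring_1 mls" is
  "\<lambda>i k. if k = Poly_Mapping.single i 1 then 1 else 0"
  by (rule exI[of _ "Poly_Mapping.single i 1" for i]) (simp add: bdd_by_def)

definition const_term :: "'a::comm_ring_1 mls \<Rightarrow> 'a" where
  "const_term f = mls_coeff f 0"

lemma mls_coeff_X_times:
  "mls_coeff (mls_X i * f) k = mls_coeff f (k - Poly_Mapping.single i 1)"
proof -
  have "mls_coeff (mls_X i * f) k =
      (\<Sum>a\<in>{Poly_Mapping.single i 1}. mls_coeff (mls_X i) a * mls_coeff f (k - a))"
    unfolding times_mls.rep_eq by (rule conv_eq_sum) (auto simp: mls_X.rep_eq split: if_splits)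
  then show ?thesis by (simp add: mls_X.rep_eq)
qed

lemma mls_X_unit: "(mls_X i :: 'a::comm_ring_1 mls) dvd 1"
proof -
  have "(\<lambda>k::nat \<Rightarrow>\<^sub>0 int. if k = Poly_Mapping.single i (-1) then 1 else (0::'a))
          \<in> {f. \<exists>m. bdd_by m f}"
    by (intro CollectI exI[of _ "Poly_Mapping.single i (-1)"]) (simp add: bdd_by_def)
  then obtain g :: "'a mls" where
    g: "mls_coeff g = (\<lambda>k. if k = Poly_Mapping.single i (-1) then 1 else 0)"
    by (rule that[OF Abs_mls_inverse])
  have "Poly_Mapping.single i (-1) + Poly_Mapping.single i 1 = (0 :: nat \<Rightarrow>\<^sub>0 int)"
    by (simp add: poly_mapping_eq_iff fun_eq_iff lookup_add lookup_single when_def)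
  then have "k - Poly_Mapping.single i 1 = Poly_Mapping.single i (-1) \<longleftrightarrow> k = 0" for k :: "nat \<Rightarrow>\<^sub>0 int"
    by (simp only: diff_eq_eq)
  then have "1 = mls_X i * g"
    by (intro mls_eqI) (simp add: mls_coeff_X_times g one_mls.rep_eq)
  then show ?thesis by (rule dvdI)
qed

text \<open>The inverse of 1 - X i is the geometric series.\<close>

lemma mls_one_minus_X_unit: "(1 - mls_X i :: 'a::comm_ring_1 mls) dvd 1"
proof -
  define S where "S = range (\<lambda>m. Poly_Mapping.single i (int m))"
  have "(\<lambda>k. if k \<in> S then 1 else (0::'a))
          \<in> {f. \<exists>m. bdd_by m f}"
    by (intro CollectI exI[of _ 0]) (auto simp: bdd_by_def S_def lookup_single when_def)
  then obtain g :: "'a mls" where g: "mls_coeff g = (\<lambda>k. if k \<in> S then 1 else 0)"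
    by (rule that[OF Abs_mls_inverse])
  have "k - Poly_Mapping.single i 1 \<in> S \<longleftrightarrow> k \<in> S - {0}" for k
  proof
    assume "k - Poly_Mapping.single i 1 \<in> S"
    then obtain m where "k - Poly_Mapping.single i 1 = Poly_Mapping.single i (int m)"
      by (auto simp: S_def)
    then have "k = Poly_Mapping.single i (int m) + Poly_Mapping.single i 1"
      by (simp only: diff_eq_eq)
    then have k: "k = Poly_Mapping.single i (int (Suc m))"
      by (simp add: poly_mapping_eq_iff fun_eq_iff lookup_add lookup_single when_def)
    have "Poly_Mapping.lookup k i \<noteq> 0" by (simp add: k)
    then have "k \<noteq> 0" by auto
    moreover have "k \<in> S" unfolding S_def k by (rule rangeI)
    ultimately show "k \<in> S - {0}" by simp
  next
    assume "k \<in> S - {0}"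
    then obtain m where m: "k = Poly_Mapping.single i (int m)"
      by (auto simp: S_def)
    with \<open>k \<in> S - {0}\<close> have "m \<noteq> 0" by (cases m) auto
    with m have "k - Poly_Mapping.single i 1 = Poly_Mapping.single i (int (m - 1))"
      by (auto simp: poly_mapping_eq_iff fun_eq_iff lookup_minus lookup_single when_def)
    then show "k - Poly_Mapping.single i 1 \<in> S" by (simp add: S_def)
  qed
  moreover have "0 \<in> S" unfolding S_def by (rule range_eqI[of _ _ 0]) simp
  ultimately have "g = 1 + mls_X i * g"
    by (intro mls_eqI) (auto simp: mls_coeff_X_times g one_mls.rep_eq plus_mls.rep_eq)
  then have "1 = (1 - mls_X i) * g"
    by (simp add: algebra_simps) 
  then show ?thesis by (rule dvdI)
qed

end

theory Submission
  imports Defs "HOL-Computational_Algebra.Formal_Laurent_Series" "Jordan_Normal_Form.Determinant"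
begin

text \<open>
  Read column by column, a configuration is a sequence of interlacing sets of positions. The number
  of continuations from given positions is the homogeneous limit of a coordinate Bethe Ansatz sum
  with scattering factor \<open>1 + x\<^sub>i x\<^sub>j - x\<^sub>i + x\<^sub>j\<close> and momentum \<open>z = (1 + x) / (1 - x)\<close>: summing
  the wave function over interlacing positions adds one variable with value \<open>z = 1\<close>. For the initial
  positions of the model the Bethe sum factors as a product times \<open>det \<lambda>\<^sub>j (x\<^sub>i\<^sup>2)\<close> divided by a Vandermonde
  determinant in the squares \<open>x\<^sub>i\<^sup>2\<close>, where \<open>\<Sum>\<^sub>j \<lambda>\<^sub>j t\<^sup>j = 1 / ((1 - x\<^sup>2) (1 - t f(x)) (1 - t f(-x)))\<close>
  and \<open>f(x) = x (1 + x) / (1 - x)\<close>. In the homogeneous limit it becomes the determinant of the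
  coefficients of \<open>x\<^sup>2\<^sup>i\<^sup>+\<^sup>1\<close> in \<open>f(x)\<^sup>j / (1 - x)\<close>, and so does the constant term, whose numerator is
  a Vandermonde product in the \<open>f(x\<^sub>i)\<close>.
\<close>

text \<open>Counting requires every momentum to be 1, but \<open>scat\<close> has a pole at equal
  arguments, so the Bethe sum is available only for distinct variables and the count is reached as a
  limit. It has to be shown that this limit exists and does not depend on how the variables approach
  1. The points are therefore taken proportional to a formal parameter, and each Bethe sum is
  expanded into alternants divided by Vandermonde determinants, whose lowest coefficients do not
  involve the points. The second obstacle is exclusion. The ranges of neighbouring paths overlap in
  the two positions \<open>2 * c + 1\<close> and \<open>2 * c + 2\<close>, so independent geometric
  summation also counts paths that meet or cross. Moreover bounds may coincide, since two positions
  can have the same half. The scattering factor makes the unwanted terms antisymmetric, and they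
  cancel. Squares enter because extending the scattering factor by \<open>x + y\<close> makes its
  numerator linear in \<open>fr\<close>, at the price of a denominator
  \<open>y^2 - x^2\<close>.\<close>

no_notation vec_index (infixl "$" 100)

section \<open>Interlacing sequences\<close>

text \<open>All lists are in decreasing order. In the encoding below, \<open>as\<close> lists the halves (rounded down)
  of the positions of the paths entering a column, and the elements of \<open>interl as\<close> are the possible
  lists of positions of the paths leaving it; one path leaves through the bottom of the column.\<close>

definition interl :: "nat list \<Rightarrow> nat list set" where
  "interl as = {bs. length as = Suc (length bs) \<and> sorted_wrt (>) bs \<and>
     (\<forall>i<length bs. 2 * as ! Suc i + 1 \<le> bs ! i \<and> bs ! i \<le> 2 * as ! i + 2)}"

lemma interl_single: "interl [a] = {[]}"
  by (auto simp: interl_def)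

lemma interl_Cons_iff:
  "bs \<in> interl (a # c # as) \<longleftrightarrow>
     (\<exists>b cs. bs = b # cs \<and> 2 * c + 1 \<le> b \<and> b \<le> 2 * a + 2 \<and> cs \<in> interl (c # as) \<and> (\<forall>x\<in>set cs. x < b))"
proof (cases bs)
  case (Cons b cs)
  show ?thesis unfolding Cons
    by (auto simp: interl_def less_Suc_eq_0_disj all_conj_distrib split: nat.splits)
next
  case Nil
  then show ?thesis by (auto simp: interl_def)
qed

lemma interl_le:
  assumes "bs \<in> interl (a # as)" "x \<in> set bs"
  shows "x \<le> 2 * a + 2"
proof -
  obtain i where i: "i < length bs" "x = bs ! i" using assms(2) by (auto simp: in_set_conv_nth)
  have "bs ! i \<le> bs ! 0"
    using assms(1) i by (cases "i = 0") (auto simp: interl_def dest!: sorted_wrt_nth_less[of _ bs 0 i])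
  moreover have "bs ! 0 \<le> 2 * a + 2"
    using assms(1) i by (auto simp: interl_def dest!: spec[of _ 0])
  ultimately show ?thesis using i by simp
qed

lemma finite_interl: "finite (interl as)"
proof (cases as)
  case (Cons a as')
  then have "interl as \<subseteq> {bs. set bs \<subseteq> {..2 * a + 2} \<and> length bs = length as'}"
    using interl_le by (fastforce simp: interl_def[of "a # as'"])
  then show ?thesis by (rule finite_subset) (simp add: finite_lists_length_eq)
qed (simp add: interl_def)

definition interl_sum :: "nat list \<Rightarrow> (nat list \<Rightarrow> 'a::comm_monoid_add) \<Rightarrow> 'a" where
  "interl_sum as F = (\<Sum>bs\<in>interl as. F (map (\<lambda>b. b div 2) bs))"

lemma interl_sum_single: "interl_sum [a] F = F []"
  by (simp add: interl_sum_def interl_single)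

lemma interl_sum_add: "interl_sum as (\<lambda>t. F t + G t) = interl_sum as F + interl_sum as G"
  by (simp add: interl_sum_def sum.distrib)

lemma interl_sum_mult_left:
  fixes c :: "'a::comm_ring_1"
  shows "interl_sum as (\<lambda>t. c * F t) = c * interl_sum as F"
  by (simp add: interl_sum_def sum_distrib_left)

lemma interl_sum_sum: "interl_sum as (\<lambda>t. \<Sum>k\<in>K. F k t) = (\<Sum>k\<in>K. interl_sum as (F k))"
  by (simp add: interl_sum_def sum.swap[of _ K])

lemma interl_sum_image:
  assumes "interl as = (#) b ` interl bs \<union> C" "(#) b ` interl bs \<inter> C = {}" "finite C"
  shows "interl_sum as F = interl_sum bs (\<lambda>t. F (b div 2 # t)) + (\<Sum>x\<in>C. F (map (\<lambda>b. b div 2) x))"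
  unfolding interl_sum_def assms(1)
  by (subst sum.union_disjoint) (use assms finite_interl in \<open>auto simp: sum.reindex inj_on_def\<close>)

text \<open>The new positions \<open>2 * a + 3\<close> and \<open>2 * a + 4\<close> of the first
  path exceed everything the other paths can reach, which is at most \<open>2 * c + 2\<close>, so
  exclusion adds no condition. This is one step of the induction on the first bound in
  \<open>interl_sum_bethe\<close>.\<close>

lemma interl_sum_Suc:
  assumes "c \<le> a"
  shows "interl_sum (Suc a # c # as) F =
    interl_sum (a # c # as) F + interl_sum (c # as) (\<lambda>t. F (Suc a # t) + F (Suc (Suc a) # t))"
proof -
  let ?A = "(#) (2 * a + 3) ` interl (c # as)" and ?B = "(#) (2 * a + 4) ` interl (c # as)"
  have le: "x \<le> 2 * a + 2" if "cs \<in> interl (c # as)" "x \<in> set cs" for x cs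
    using interl_le[OF that] assms by simp
  have "interl (Suc a # c # as) = ?A \<union> (?B \<union> interl (a # c # as))"
  proof (rule Set.set_eqI)
    fix bs
    have "b \<le> 2 * Suc a + 2 \<longleftrightarrow> b \<le> 2 * a + 2 \<or> b = 2 * a + 3 \<or> b = 2 * a + 4" for b by presburger
    then show "bs \<in> interl (Suc a # c # as) \<longleftrightarrow> bs \<in> ?A \<union> (?B \<union> interl (a # c # as))"
      using assms le unfolding interl_Cons_iff Un_iff image_iff by (fastforce simp: less_Suc_eq_le)
  qed
  then have "interl_sum (Suc a # c # as) F = interl_sum (c # as) (\<lambda>t. F ((2 * a + 3) div 2 # t)) +
      (\<Sum>x\<in>?B \<union> interl (a # c # as). F (map (\<lambda>b. b div 2) x))"
    by (rule interl_sum_image) (auto simp: interl_Cons_iff finite_interl)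
  also have "(\<Sum>x\<in>?B \<union> interl (a # c # as). F (map (\<lambda>b. b div 2) x)) =
      interl_sum (c # as) (\<lambda>t. F ((2 * a + 4) div 2 # t)) + interl_sum (a # c # as) F"
    unfolding interl_sum_def
    by (subst sum.union_disjoint) (auto simp: sum.reindex inj_on_def finite_interl interl_Cons_iff)
  also have "(2 * a + 3) div 2 = Suc a" by linarith
  also have "(2 * a + 4) div 2 = Suc (Suc a)" by linarith
  finally show ?thesis by (simp add: interl_sum_add add_ac)
qed

lemma interl_sum_pair: "interl_sum [c, c] F = F [c] + F [Suc c]"
proof -
  have "interl [c, c] = {[2 * c + 1], [2 * c + 2]}"
    by (auto simp: interl_Cons_iff interl_single)
  then show ?thesis by (simp add: interl_sum_def)
qed

text \<open>Equal bounds leave the first path only \<open>2 * c + 3\<close> and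
  \<open>2 * c + 4\<close>. Either the second path stays at most at \<open>2 * c + 2\<close>, as if
  its upper bound were \<open>c\<close>, or the two paths fill both of these positions.\<close>

lemma interl_sum_eq_eq:
  assumes "e \<le> c"
  shows "interl_sum (Suc c # Suc c # e # as) F =
    interl_sum (c # e # as) (\<lambda>t. F (Suc c # t) + F (Suc (Suc c) # t)) +
    interl_sum (e # as) (\<lambda>t. F (Suc (Suc c) # Suc c # t))"
proof -
  let ?A = "(#) (2 * c + 3) ` interl (c # e # as)" and ?B = "(#) (2 * c + 4) ` interl (c # e # as)"
  let ?C = "(\<lambda>t. (2 * c + 4) # (2 * c + 3) # t) ` interl (e # as)"
  have le: "x \<le> 2 * c + 2" if "cs \<in> interl (e # as)" "x \<in> set cs" for x cs
    using interl_le[OF that] assms by simp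
  have "interl (Suc c # Suc c # e # as) = ?A \<union> (?B \<union> ?C)"
  proof (rule Set.set_eqI, rule iffI)
    fix bs assume "bs \<in> interl (Suc c # Suc c # e # as)"
    then obtain b b' cs where b: "bs = b # b' # cs" "2 * c + 3 \<le> b" "b \<le> 2 * c + 4"
      "2 * e + 1 \<le> b'" "b' \<le> 2 * c + 4" "b' < b" "cs \<in> interl (e # as)" "\<forall>x\<in>set cs. x < b'"
      by (auto simp: interl_Cons_iff)
    show "bs \<in> ?A \<union> (?B \<union> ?C)"
    proof (cases "b' \<le> 2 * c + 2")
      case True
      then have "b' # cs \<in> interl (c # e # as)" using b by (auto simp: interl_Cons_iff)
      moreover have "b = 2 * c + 3 \<or> b = 2 * c + 4" using b by linarith
      ultimately show ?thesis using b by auto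
    next
      case False
      then have "b' = 2 * c + 3" "b = 2 * c + 4" using b by linarith+
      then show ?thesis using b by auto
    qed
  next
    fix bs assume "bs \<in> ?A \<union> (?B \<union> ?C)"
    then show "bs \<in> interl (Suc c # Suc c # e # as)"
      using assms le by (fastforce simp: interl_Cons_iff)
  qed
  then have "interl_sum (Suc c # Suc c # e # as) F = interl_sum (c # e # as) (\<lambda>t. F ((2 * c + 3) div 2 # t)) +
      (\<Sum>x\<in>?B \<union> ?C. F (map (\<lambda>b. b div 2) x))"
    by (rule interl_sum_image) (auto simp: finite_interl)
  also have "(\<Sum>x\<in>?B \<union> ?C. F (map (\<lambda>b. b div 2) x)) =
      interl_sum (c # e # as) (\<lambda>t. F ((2 * c + 4) div 2 # t)) +
      interl_sum (e # as) (\<lambda>t. F ((2 * c + 4) div 2 # (2 * c + 3) div 2 # t))"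
    unfolding interl_sum_def
    by (subst sum.union_disjoint) (auto simp: sum.reindex inj_on_def finite_interl interl_Cons_iff)
  also have "(2 * c + 3) div 2 = Suc c" by linarith
  also have "(2 * c + 4) div 2 = Suc (Suc c)" by linarith
  finally show ?thesis by (simp add: interl_sum_add add_ac)
qed

lemma interl_sum_triple: "interl_sum [c, c, c] F = F [Suc c, c]"
proof -
  have "interl [c, c, c] = {[2 * c + 2, 2 * c + 1]}"
    by (auto simp: interl_Cons_iff interl_single)
  then show ?thesis by (simp add: interl_sum_def)
qed

text \<open>The first two paths have to fill the two positions between the equal bounds, and
  exclusion then lowers the upper bound of the third path to \<open>c\<close>.\<close>

lemma interl_sum_eq_eq_eq:
  assumes "e \<le> c"
  shows "interl_sum (Suc c # Suc c # Suc c # e # as) F =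
    interl_sum (c # e # as) (\<lambda>t. F (Suc (Suc c) # Suc c # t))"
proof -
  have "interl (Suc c # Suc c # Suc c # e # as) = (\<lambda>t. (2 * c + 4) # (2 * c + 3) # t) ` interl (c # e # as)"
  proof (rule Set.set_eqI, rule iffI)
    fix bs assume "bs \<in> interl (Suc c # Suc c # Suc c # e # as)"
    then obtain b b' b'' cs where b: "bs = b # b' # b'' # cs" "2 * c + 3 \<le> b" "b \<le> 2 * c + 4"
      "2 * c + 3 \<le> b'" "b' \<le> 2 * c + 4" "b' < b" "b'' < b'"
      "2 * e + 1 \<le> b''" "cs \<in> interl (e # as)" "\<forall>x\<in>set cs. x < b''"
      by (auto simp: interl_Cons_iff)
    then have "b' = 2 * c + 3" "b = 2 * c + 4" "b'' \<le> 2 * c + 2" by linarith+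
    then show "bs \<in> (\<lambda>t. (2 * c + 4) # (2 * c + 3) # t) ` interl (c # e # as)"
      using b by (auto simp: interl_Cons_iff)
  next
    fix bs assume "bs \<in> (\<lambda>t. (2 * c + 4) # (2 * c + 3) # t) ` interl (c # e # as)"
    then show "bs \<in> interl (Suc c # Suc c # Suc c # e # as)"
      using assms interl_le[of _ e as] by (fastforce simp: interl_Cons_iff)
  qed
  moreover have "(2 * c + 3) div 2 = Suc c" "(2 * c + 4) div 2 = Suc (Suc c)" by linarith+
  ultimately show ?thesis
    unfolding interl_sum_def by (simp add: sum.reindex inj_on_def)
qed

fun num_chains :: "nat \<Rightarrow> nat list \<Rightarrow> nat" where
  "num_chains 0 as = 1"
| "num_chains (Suc m) as = interl_sum as (num_chains m)"

section \<open>Configurations as towers of interlacing sets\<close>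

definition cnt :: "nat set \<Rightarrow> nat \<Rightarrow> nat" where
  "cnt A t = card {k \<in> A. t \<le> k}"

lemma cnt_step:
  assumes "finite A"
  shows "cnt A t = of_bool (t \<in> A) + of_bool (Suc t \<in> A) + cnt A (Suc (Suc t))"
proof -
  have step: "cnt A t = of_bool (t \<in> A) + cnt A (Suc t)" for t
  proof (cases "t \<in> A")
    case True
    then have "{k \<in> A. t \<le> k} = insert t {k \<in> A. Suc t \<le> k}" by auto
    then show ?thesis using assms True by (simp add: cnt_def)
  next
    case False
    then have "{k \<in> A. t \<le> k} = {k \<in> A. Suc t \<le> k}" by (auto simp: Suc_le_eq order.order_iff_strict)
    then show ?thesis using False by (simp add: cnt_def)
  qed
  show ?thesis using step[of t] step[of "Suc t"] by simp
qed

lemma cnt_eq_0: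
  assumes "\<And>k. k \<in> A \<Longrightarrow> k < t"
  shows "cnt A t = 0"
proof -
  have "{k \<in> A. t \<le> k} = {}" using assms by fastforce
  then show ?thesis by (simp only: cnt_def card.empty)
qed

text \<open>This translates inequalities between counts into inequalities between single entries,
  which is the whole mechanism of \<open>interlaced_set_iff\<close>.\<close>

lemma less_cnt_iff:
  assumes "sorted_wrt (>) l"
  shows "i < cnt (set l) t \<longleftrightarrow> i < length l \<and> t \<le> l ! i"
  using assms
proof (induction l arbitrary: i)
  case (Cons a l)
  show ?case
  proof (cases "t \<le> a")
    case True
    then have "{k \<in> set (a # l). t \<le> k} = insert a {k \<in> set l. t \<le> k}" by auto
    moreover have "a \<notin> set l" using Cons.prems by auto
    ultimately have "cnt (set (a # l)) t = Suc (cnt (set l) t)" by (simp add: cnt_def)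
    then show ?thesis using Cons True by (cases i) auto
  next
    case False
    then have "cnt (set (a # l)) t = 0" using Cons.prems by (intro cnt_eq_0) auto
    moreover have "(a # l) ! i < t" if "i < length (a # l)"
    proof -
      have "(a # l) ! i \<in> set (a # l)" using that by (rule nth_mem)
      then show ?thesis using Cons.prems False by auto
    qed
    ultimately show ?thesis by (auto simp: not_le)
  qed
qed (simp add: cnt_def)

text \<open>If \<open>A\<close> enters a column and \<open>B\<close> leaves it, the paths entering
  at vertex \<open>s\<close> or above either leave there or descend below \<open>s\<close>. The
  difference of the two counts is thus the occupation number of the vertical edge under vertex
  \<open>s\<close>. The cardinality condition is the case \<open>s = 0\<close>, where this edge is
  an occupied boundary edge. Slot 0 is no output of any vertex.\<close>

definition interlaced :: "nat set \<Rightarrow> nat set \<Rightarrow> bool" where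
  "interlaced A B \<longleftrightarrow> finite B \<and> 0 \<notin> B \<and> card A = Suc (card B) \<and>
     (\<forall>s. cnt A (2 * s) = cnt B (2 * s + 1) \<or> cnt A (2 * s) = Suc (cnt B (2 * s + 1)))"

lemma sorted_desc_distinct: "sorted_wrt (>) (as :: nat list) \<Longrightarrow> distinct as"
  by (induction as) auto

lemma interlaced_set_iff:
  assumes "sorted_wrt (>) as" "sorted_wrt (>) bs"
  shows "interlaced (set as) (set bs) \<longleftrightarrow> bs \<in> interl (map (\<lambda>a. a div 2) as)"
proof
  note as = less_cnt_iff[OF assms(1)] and bs = less_cnt_iff[OF assms(2)]
  have card: "card (set as) = length as" "card (set bs) = length bs"
    using assms by (simp_all add: distinct_card sorted_desc_distinct)
  {
    assume R: "interlaced (set as) (set bs)"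
    then have len: "length as = Suc (length bs)" by (simp add: interlaced_def card)
    have "2 * (as ! Suc i div 2) + 1 \<le> bs ! i \<and> bs ! i \<le> 2 * (as ! i div 2) + 2" if i: "i < length bs" for i
    proof
      have "Suc i < cnt (set as) (2 * (as ! Suc i div 2))" using i len by (simp add: as)
      moreover have "cnt (set as) (2 * (as ! Suc i div 2)) \<le> Suc (cnt (set bs) (2 * (as ! Suc i div 2) + 1))"
        using R unfolding interlaced_def by (metis le_Suc_eq order_refl)
      ultimately have "i < cnt (set bs) (2 * (as ! Suc i div 2) + 1)" by linarith
      then show "2 * (as ! Suc i div 2) + 1 \<le> bs ! i" by (simp add: bs)
    next
      \<comment> \<open>The vertex that has slot \<open>bs ! i\<close> among its outputs
        \<open>2 * s + 1\<close> and \<open>2 * s + 2\<close>.\<close>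
      define s where "s = (bs ! i - 1) div 2"
      have "bs ! i \<noteq> 0" using R i by (metis interlaced_def nth_mem)
      then have s: "2 * s + 1 \<le> bs ! i" "bs ! i \<le> 2 * s + 2" by (auto simp: s_def)
      then have "i < cnt (set bs) (2 * s + 1)" using i by (simp add: bs)
      moreover have "cnt (set bs) (2 * s + 1) \<le> cnt (set as) (2 * s)"
        using R unfolding interlaced_def by (metis le_Suc_eq order_refl)
      ultimately have "i < cnt (set as) (2 * s)" by linarith
      then have "2 * s \<le> as ! i" by (simp add: as)
      then have "s \<le> as ! i div 2" using div_le_mono[of "2 * s" "as ! i" 2] by simp
      then show "bs ! i \<le> 2 * (as ! i div 2) + 2" using s by linarith
    qed
    then show "bs \<in> interl (map (\<lambda>a. a div 2) as)"
      using len assms(2) by (simp add: interl_def)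
  next
    assume "bs \<in> interl (map (\<lambda>a. a div 2) as)"
    then have len: "length as = Suc (length bs)"
      and b: "\<And>i. i < length bs \<Longrightarrow> 2 * (as ! Suc i div 2) + 1 \<le> bs ! i"
        "\<And>i. i < length bs \<Longrightarrow> bs ! i \<le> 2 * (as ! i div 2) + 2"
      by (auto simp: interl_def)
    have le: "p \<le> q" if "\<And>i. i < p \<Longrightarrow> i < q" for p q :: nat
      using that[of "p - 1"] by (cases p) auto
    have 1: "cnt (set bs) (2 * s + 1) \<le> cnt (set as) (2 * s)" for s
    proof (rule le)
      fix i assume "i < cnt (set bs) (2 * s + 1)"
      then have i: "i < length bs" "2 * s + 1 \<le> bs ! i" by (auto simp: bs)
      then have "s \<le> as ! i div 2" using b(2)[OF i(1)] by linarith
      then have "2 * s \<le> as ! i" by simp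
      then show "i < cnt (set as) (2 * s)" using i len by (simp add: as)
    qed
    have 2: "cnt (set as) (2 * s) \<le> Suc (cnt (set bs) (2 * s + 1))" for s
    proof (rule le)
      fix i assume i: "i < cnt (set as) (2 * s)"
      show "i < Suc (cnt (set bs) (2 * s + 1))"
      proof (cases i)
        case (Suc j)
        then have j: "j < length bs" "2 * s \<le> as ! Suc j" using i len by (auto simp: as)
        then have "s \<le> as ! Suc j div 2" by simp
        then have "2 * s + 1 \<le> bs ! j" using b(1)[OF j(1)] by linarith
        then show ?thesis using Suc j bs by simp
      qed simp
    qed
    have "0 \<notin> set bs" using b(1) by (fastforce simp: in_set_conv_nth)
    then show "interlaced (set as) (set bs)"
      unfolding interlaced_def using 1 2 len card by (auto simp: le_Suc_eq intro: antisym)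
  }
qed

definition desc :: "nat set \<Rightarrow> nat list" where
  "desc A = rev (sorted_list_of_set A)"

lemma desc: "sorted_wrt (>) (desc A)" "finite A \<Longrightarrow> set (desc A) = A"
  by (simp_all add: desc_def sorted_wrt_rev)

lemma Collect_interlaced:
  assumes "sorted_wrt (>) as"
  shows "{B. interlaced (set as) B} = set ` interl (map (\<lambda>a. a div 2) as)"
proof (intro Set.set_eqI iffI)
  fix B assume "B \<in> {B. interlaced (set as) B}"
  then have "interlaced (set as) B" "finite B" by (auto simp: interlaced_def)
  then have "desc B \<in> interl (map (\<lambda>a. a div 2) as)"
    using interlaced_set_iff[OF assms desc(1), of B] desc(2) by simp
  then show "B \<in> set ` interl (map (\<lambda>a. a div 2) as)" using desc(2)[OF \<open>finite B\<close>] by (metis image_eqI)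
next
  fix B assume "B \<in> set ` interl (map (\<lambda>a. a div 2) as)"
  then obtain bs where bs: "B = set bs" "bs \<in> interl (map (\<lambda>a. a div 2) as)" by auto
  moreover from bs have "sorted_wrt (>) bs" by (simp add: interl_def)
  ultimately show "B \<in> {B. interlaced (set as) B}" using interlaced_set_iff[OF assms] by auto
qed

lemma inj_on_set_interl: "inj_on set (interl as)"
proof (rule inj_onI)
  fix bs cs assume "bs \<in> interl as" "cs \<in> interl as" "set bs = set cs"
  then have "sorted_wrt (<) (rev bs)" "sorted_wrt (<) (rev cs)" "set (rev cs) = set (rev bs)"
    by (auto simp: interl_def sorted_wrt_rev)
  then have "rev cs = rev bs" by (rule strict_sorted_equal)
  then show "bs = cs" by simp
qed

text \<open>Emptiness beyond \<open>m\<close> fixes the irrelevant values, so that towers can be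
  counted as functions on all naturals.\<close>

definition towers :: "nat \<Rightarrow> nat set \<Rightarrow> (nat \<Rightarrow> nat set) set" where
  "towers m A = {f. f 0 = A \<and> (\<forall>x<m. interlaced (f x) (f (Suc x))) \<and> (\<forall>x>m. f x = {})}"

lemma towers_0: "towers 0 A = {\<lambda>x. if x = 0 then A else {}}"
  by (auto simp: towers_def fun_eq_iff)

lemma towers_Suc: "towers (Suc m) A = (\<Union>B\<in>{B. interlaced A B}. case_nat A ` towers m B)"
proof (intro Set.set_eqI iffI)
  fix f assume f: "f \<in> towers (Suc m) A"
  then have "(\<lambda>x. f (Suc x)) \<in> towers m (f 1)" "interlaced A (f 1)" by (auto simp: towers_def)
  moreover have "f = case_nat A (\<lambda>x. f (Suc x))" using f by (auto simp: towers_def fun_eq_iff split: nat.split)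
  ultimately show "f \<in> (\<Union>B\<in>{B. interlaced A B}. case_nat A ` towers m B)" by blast
next
  fix f assume "f \<in> (\<Union>B\<in>{B. interlaced A B}. case_nat A ` towers m B)"
  then show "f \<in> towers (Suc m) A" by (auto simp: towers_def less_Suc_eq_0_disj split: nat.splits)
qed

lemma card_towers:
  assumes "sorted_wrt (>) as"
  shows "finite (towers m (set as)) \<and> card (towers m (set as)) = num_chains m (map (\<lambda>a. a div 2) as)"
  using assms
proof (induction m arbitrary: as)
  case 0
  show ?case by (simp add: towers_0)
next
  case (Suc m)
  let ?I = "interl (map (\<lambda>a. a div 2) as)"
  have IH: "finite (towers m (set bs))" "card (towers m (set bs)) = num_chains m (map (\<lambda>a. a div 2) bs)"
    if "bs \<in> ?I" for bs
    using Suc.IH[of bs] that by (auto simp: interl_def)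
  have inj: "inj (case_nat (set as) :: (nat \<Rightarrow> nat set) \<Rightarrow> _)"
  proof (rule injI)
    fix f g :: "nat \<Rightarrow> nat set" assume "case_nat (set as) f = case_nat (set as) g"
    then have "case_nat (set as) f (Suc x) = case_nat (set as) g (Suc x)" for x by simp
    then show "f = g" by auto
  qed
  have un: "towers (Suc m) (set as) = (\<Union>bs\<in>?I. case_nat (set as) ` towers m (set bs))"
    unfolding towers_Suc Collect_interlaced[OF Suc.prems] by simp
  have "card (\<Union>bs\<in>?I. case_nat (set as) ` towers m (set bs)) = (\<Sum>bs\<in>?I. card (case_nat (set as) ` towers m (set bs)))"
  proof (rule card_UN_disjoint)
    show "\<forall>bs\<in>?I. \<forall>cs\<in>?I. bs \<noteq> cs \<longrightarrow>
        case_nat (set as) ` towers m (set bs) \<inter> case_nat (set as) ` towers m (set cs) = {}"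
    proof (intro ballI impI)
      fix bs cs assume bc: "bs \<in> ?I" "cs \<in> ?I" "bs \<noteq> cs"
      then have "set bs \<noteq> set cs" using inj_on_set_interl by (auto dest: inj_onD)
      then show "case_nat (set as) ` towers m (set bs) \<inter> case_nat (set as) ` towers m (set cs) = {}"
        by (auto simp: towers_def dest!: injD[OF inj])
    qed
  qed (use finite_interl IH in auto)
  also have "\<dots> = (\<Sum>bs\<in>?I. num_chains m (map (\<lambda>a. a div 2) bs))"
    by (intro sum.cong refl) (simp add: card_image[OF inj_on_subset[OF inj subset_UNIV]] IH)
  finally show ?case using IH finite_interl by (simp add: un interl_sum_def)
qed

text \<open>\<open>vertex n x s\<close> is the \<open>s\<close>-th vertex of column \<open>x\<close> from below. The edges between the columns
  \<open>x\<close> and \<open>x + 1\<close> are numbered in the order of their height, beginning with the lower left boundary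
  of the quadrangle: \<open>slot n x k\<close> is horizontal for even \<open>k\<close> and diagonal for odd \<open>k\<close>.
  Thus the \<open>s\<close>-th vertex of a column has the inputs \<open>2 * s\<close>, \<open>2 * s + 1\<close> and the outputs
  \<open>2 * s + 1\<close>, \<open>2 * s + 2\<close>.\<close>

definition vertex :: "nat \<Rightarrow> nat \<Rightarrow> nat \<Rightarrow> int \<times> int" where
  "vertex n x s = (int x, int s + 1 + int n - int x)"

definition slot :: "nat \<Rightarrow> nat \<Rightarrow> nat \<Rightarrow> (int \<times> int) \<times> (int \<times> int)" where
  "slot n x k = ((int x, int ((k + 1) div 2) + int n - int x), (int x + 1, int (k div 2) + int n - int x))"

definition drop_edge :: "nat \<Rightarrow> nat \<Rightarrow> nat \<Rightarrow> (int \<times> int) \<times> (int \<times> int)" where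
  "drop_edge n x s = (vertex n x s, vertex n x s - (0, 1))"

lemma vertex_in_quadrangle: "vertex n x s \<in> quadrangle n \<longleftrightarrow> 1 \<le> x \<and> x \<le> n \<and> s + 1 < n + x"
  by (auto simp: vertex_def quadrangle_def)

lemma quadrangleE:
  assumes "p \<in> quadrangle n"
  obtains x s where "p = vertex n (Suc x) s" "x < n" "s < n + x"
proof -
  obtain a b where p: "p = (a, b)" by (cases p)
  have "p = vertex n (Suc (nat (a - 1))) (nat (a + b - 1 - int n))"
    using assms by (auto simp: p vertex_def quadrangle_def)
  moreover have "nat (a - 1) < n" "nat (a + b - 1 - int n) < n + nat (a - 1)"
    using assms by (auto simp: p quadrangle_def)
  ultimately show ?thesis by (rule that)
qed

lemma edges_at_vertex:
  "(vertex n (Suc x) s - (1, 0), vertex n (Suc x) s) = slot n x (2 * s)"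
  "(vertex n (Suc x) s + (- 1, 1), vertex n (Suc x) s) = slot n x (2 * s + 1)"
  "(vertex n (Suc x) s + (0, 1), vertex n (Suc x) s) = drop_edge n (Suc x) (Suc s)"
  "(vertex n (Suc x) s, vertex n (Suc x) s + (1, - 1)) = slot n (Suc x) (2 * s + 1)"
  "(vertex n (Suc x) s, vertex n (Suc x) s + (1, 0)) = slot n (Suc x) (2 * s + 2)"
  "(vertex n (Suc x) s, vertex n (Suc x) s - (0, 1)) = drop_edge n (Suc x) s"
  by (simp_all add: vertex_def slot_def drop_edge_def)

lemma slot_inj: "slot n x k = slot n x' k' \<longleftrightarrow> x = x' \<and> k = k'"
proof
  assume "slot n x k = slot n x' k'"
  then have eq: "x = x'" "(k + 1) div 2 = (k' + 1) div 2" "k div 2 = k' div 2"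
    unfolding slot_def prod.inject by linarith+
  have "k = (k + 1) div 2 + k div 2" for k :: nat by presburger
  then show "x = x' \<and> k = k'" using eq by metis
qed simp

lemma drop_edge_inj: "drop_edge n x s = drop_edge n x' s' \<longleftrightarrow> x = x' \<and> s = s'"
  by (auto simp: drop_edge_def vertex_def)

lemma slot_neq_drop_edge: "slot n x k \<noteq> drop_edge n x' s"
  by (auto simp: slot_def drop_edge_def vertex_def)

lemma slot_internal: "slot n x k \<in> internal_edges20V n \<longleftrightarrow> 1 \<le> x \<and> x < n \<and> 1 \<le> k \<and> k \<le> 2 * (n + x - 1)"
proof -
  have "k div 2 = (k + 1) div 2 \<or> (k + 1) div 2 = k div 2 + 1" by presburger
  then have "slot n x k \<in> edges20V n \<or> \<not> (fst (slot n x k) \<in> quadrangle n \<and> snd (slot n x k) \<in> quadrangle n)"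
    by (auto simp: edges20V_def slot_def)
  then have "slot n x k \<in> internal_edges20V n \<longleftrightarrow> fst (slot n x k) \<in> quadrangle n \<and> snd (slot n x k) \<in> quadrangle n"
    by (auto simp: internal_edges20V_def)
  also have "\<dots> \<longleftrightarrow> 1 \<le> x \<and> x < n \<and> 1 \<le> (k + 1) div 2 \<and> (k + 1) div 2 \<le> n + x - 1"
    by (auto simp: slot_def quadrangle_def)
  also have "\<dots> \<longleftrightarrow> 1 \<le> x \<and> x < n \<and> 1 \<le> k \<and> k \<le> 2 * (n + x - 1)" by auto
  finally show ?thesis .
qed

lemma drop_edge_internal: "drop_edge n x s \<in> internal_edges20V n \<longleftrightarrow> 1 \<le> x \<and> x \<le> n \<and> 1 \<le> s \<and> s + 1 < n + x"
  by (auto simp: internal_edges20V_def edges20V_def drop_edge_def vertex_def quadrangle_def)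

lemma internal_edgeE:
  assumes "e \<in> internal_edges20V n"
  obtains x k where "e = slot n (Suc x) k" "x < n" | x s where "e = drop_edge n (Suc x) s" "x < n"
proof -
  obtain p q where e: "e = (p, q)" by (cases e)
  then have pq: "p \<in> quadrangle n" "q \<in> {p + (1, 0), p - (0, 1), p + (1, -1)}"
    using assms by (auto simp: internal_edges20V_def edges20V_def)
  obtain x s where p: "p = vertex n (Suc x) s" "x < n" using pq(1) by (rule quadrangleE)
  from pq(2) show ?thesis
    using that(1)[of x "2 * s + 2"] that(1)[of x "2 * s + 1"] that(2)[of x s] p
    unfolding e p by (auto simp: edges_at_vertex)
qed

lemma slot_dwbc3: "slot n x k \<in> dwbc3 n \<longleftrightarrow> x = 0 \<and> even k \<and> k < 2 * n"
proof -
  have "slot n x k \<in> dwbc3 n \<longleftrightarrow> x = 0 \<and> (k + 1) div 2 = k div 2 \<and> (1, int (k div 2) + int n) \<in> quadrangle n"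
    by (auto simp: dwbc3_def slot_def)
  also have "\<dots> \<longleftrightarrow> x = 0 \<and> even k \<and> k < 2 * n"
  proof -
    have "(k + 1) div 2 = k div 2 \<longleftrightarrow> even k" by presburger
    moreover have "(1, int (k div 2) + int n) \<in> quadrangle n \<longleftrightarrow> k div 2 < n" by (auto simp: quadrangle_def)
    ultimately show ?thesis by auto
  qed
  finally show ?thesis .
qed

lemma drop_edge_dwbc3: "drop_edge n (Suc x) s \<in> dwbc3 n \<longleftrightarrow> x < n \<and> s = 0"
  by (auto simp: dwbc3_def drop_edge_def vertex_def quadrangle_def)

section \<open>Local conservation and the bijection with towers\<close>

lemma card_pairs_eq:
  assumes "a \<noteq> b" "a \<noteq> c" "b \<noteq> c" "\<And>u. u \<in> U \<Longrightarrow> u = a \<or> u = b \<or> u = c"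
  shows "card U = of_bool (a \<in> U) + of_bool (b \<in> U) + of_bool (c \<in> U)"
proof -
  have "U = {u \<in> {a, b, c}. u \<in> U}" using assms(4) by auto
  moreover have "{u \<in> {a, b, c}. u \<in> U} = (if a \<in> U then {a} else {}) \<union> (if b \<in> U then {b} else {}) \<union> (if c \<in> U then {c} else {})"
    by auto
  ultimately have U: "U = (if a \<in> U then {a} else {}) \<union> (if b \<in> U then {b} else {}) \<union> (if c \<in> U then {c} else {})"
    by simp
  show ?thesis
    by (subst U) (use assms(1-3) in \<open>auto simp: card_insert_if\<close>)
qed

lemma card_in_edges:
  assumes "E \<subseteq> edges20V n"
  shows "card {u. (u, vertex n (Suc x) s) \<in> E} =
    of_bool (slot n x (2 * s) \<in> E) + of_bool (slot n x (2 * s + 1) \<in> E) + of_bool (drop_edge n (Suc x) (Suc s) \<in> E)"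
proof -
  let ?v = "vertex n (Suc x) s"
  have "card {u. (u, ?v) \<in> E} = of_bool (?v - (1, 0) \<in> {u. (u, ?v) \<in> E}) +
      of_bool (?v + (- 1, 1) \<in> {u. (u, ?v) \<in> E}) + of_bool (?v + (0, 1) \<in> {u. (u, ?v) \<in> E})"
    by (rule card_pairs_eq) (use assms in \<open>auto simp: edges20V_def vertex_def\<close>)
  then show ?thesis by (simp only: mem_Collect_eq edges_at_vertex)
qed

lemma card_out_edges:
  assumes "E \<subseteq> edges20V n"
  shows "card {w. (vertex n (Suc x) s, w) \<in> E} =
    of_bool (slot n (Suc x) (2 * s + 1) \<in> E) + of_bool (slot n (Suc x) (2 * s + 2) \<in> E) + of_bool (drop_edge n (Suc x) s \<in> E)"
proof -
  let ?v = "vertex n (Suc x) s"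
  have "card {w. (?v, w) \<in> E} = of_bool (?v + (1, - 1) \<in> {w. (?v, w) \<in> E}) +
      of_bool (?v + (1, 0) \<in> {w. (?v, w) \<in> E}) + of_bool (?v - (0, 1) \<in> {w. (?v, w) \<in> E})"
    by (rule card_pairs_eq) (use assms in \<open>auto simp: edges20V_def vertex_def\<close>)
  then show ?thesis by (simp only: mem_Collect_eq edges_at_vertex)
qed

definition slices :: "nat \<Rightarrow> ((int \<times> int) \<times> (int \<times> int)) set \<Rightarrow> nat \<Rightarrow> nat set" where
  "slices n S x = {k. slot n x k \<in> S \<union> dwbc3 n}"

definition conserving :: "nat \<Rightarrow> ((int \<times> int) \<times> (int \<times> int)) set \<Rightarrow> nat \<Rightarrow> nat \<Rightarrow> bool" where
  "conserving n S x s \<longleftrightarrow>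
     of_bool (2 * s \<in> slices n S x) + of_bool (2 * s + 1 \<in> slices n S x) + of_bool (drop_edge n (Suc x) (Suc s) \<in> S \<union> dwbc3 n) =
     of_bool (2 * s + 1 \<in> slices n S (Suc x)) + of_bool (2 * s + 2 \<in> slices n S (Suc x)) +
       (of_bool (drop_edge n (Suc x) s \<in> S \<union> dwbc3 n) :: nat)"

lemma configs20V_iff:
  "S \<in> configs20V n \<longleftrightarrow> S \<subseteq> internal_edges20V n \<and> (\<forall>x s. x < n \<longrightarrow> s < n + x \<longrightarrow> conserving n S x s)"
proof -
  have "(\<forall>v\<in>quadrangle n. card {u. (u, v) \<in> S \<union> dwbc3 n} = card {w. (v, w) \<in> S \<union> dwbc3 n}) \<longleftrightarrow>
      (\<forall>x s. x < n \<longrightarrow> s < n + x \<longrightarrow> conserving n S x s)" if S: "S \<subseteq> internal_edges20V n"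
  proof -
    have E: "S \<union> dwbc3 n \<subseteq> edges20V n"
      using S dwbc3_boundary[of n] by (auto simp: internal_edges20V_def)
    have at: "card {u. (u, vertex n (Suc x) s) \<in> S \<union> dwbc3 n} = card {w. (vertex n (Suc x) s, w) \<in> S \<union> dwbc3 n} \<longleftrightarrow>
        conserving n S x s" for x s
      unfolding card_in_edges[OF E] card_out_edges[OF E] conserving_def slices_def mem_Collect_eq ..
    show ?thesis
    proof (intro iffI allI impI ballI)
      fix x s
      assume *: "\<forall>v\<in>quadrangle n. card {u. (u, v) \<in> S \<union> dwbc3 n} = card {w. (v, w) \<in> S \<union> dwbc3 n}"
        and xs: "x < n" "s < n + x"
      have "vertex n (Suc x) s \<in> quadrangle n" using xs by (simp add: vertex_in_quadrangle)
      with * have "card {u. (u, vertex n (Suc x) s) \<in> S \<union> dwbc3 n} = card {w. (vertex n (Suc x) s, w) \<in> S \<union> dwbc3 n}"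
        by (rule bspec)
      then show "conserving n S x s" unfolding at .
    next
      fix v
      assume *: "\<forall>x s. x < n \<longrightarrow> s < n + x \<longrightarrow> conserving n S x s" and v: "v \<in> quadrangle n"
      obtain x s where "v = vertex n (Suc x) s" "x < n" "s < n + x" using v by (rule quadrangleE)
      then show "card {u. (u, v) \<in> S \<union> dwbc3 n} = card {w. (v, w) \<in> S \<union> dwbc3 n}" using * at by simp
    qed
  qed
  then show ?thesis by (auto simp: configs20V_def)
qed

lemma slices_0: "S \<subseteq> internal_edges20V n \<Longrightarrow> slices n S 0 = {k. even k \<and> k < 2 * n}"
  using slot_internal[of n 0] by (auto simp: slices_def slot_dwbc3)

lemma slices_Suc: "slices n S (Suc x) = {k. slot n (Suc x) k \<in> S}"
  by (simp add: slices_def slot_dwbc3)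

lemma slices_bounds:
  assumes "S \<subseteq> internal_edges20V n"
  shows "k \<in> slices n S x \<Longrightarrow> k + 1 < 2 * (n + x)" "0 \<notin> slices n S (Suc x)" "x \<ge> n \<Longrightarrow> n > 0 \<Longrightarrow> slices n S x = {}"
proof -
  show "0 \<notin> slices n S (Suc x)" using assms slot_internal[of n "Suc x" 0] by (auto simp: slices_Suc)
  show "k + 1 < 2 * (n + x)" if "k \<in> slices n S x"
  proof (cases x)
    case 0
    then have "even k" "k < 2 * n" using that by (simp_all add: slices_0[OF assms])
    then have "k + 1 < 2 * n" by presburger
    then show ?thesis using 0 by simp
  next
    case (Suc y)
    then have "slot n x k \<in> internal_edges20V n" using that assms by (auto simp: slices_Suc)
    then show ?thesis by (auto simp: slot_internal)
  qed
  show "slices n S x = {}" if "x \<ge> n" "n > 0"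
  proof -
    have "x \<noteq> 0" using that by simp
    then obtain y where "x = Suc y" by (cases x) auto
    then show ?thesis using assms that slot_internal[of n x] by (auto simp: slices_Suc)
  qed
qed

lemma finite_slices: "S \<subseteq> internal_edges20V n \<Longrightarrow> finite (slices n S x)"
  by (rule finite_subset[of _ "{..<2 * (n + x)}"]) (auto dest: slices_bounds(1))

text \<open>Conservation summed over the vertices from \<open>s\<close> upwards: the vertical edges
  between them cancel, and only the one under \<open>s\<close> is left. The induction descends from
  a height where everything is empty.\<close>

lemma cnt_slices:
  assumes "S \<in> configs20V n" "x < n"
  shows "cnt (slices n S x) (2 * s) = cnt (slices n S (Suc x)) (2 * s + 1) + of_bool (drop_edge n (Suc x) s \<in> S \<union> dwbc3 n)"
proof -
  have S: "S \<subseteq> internal_edges20V n" using assms(1) by (simp add: configs20V_iff)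
  let ?A = "slices n S x" and ?B = "slices n S (Suc x)"
  have high: "cnt ?A (2 * s) = cnt ?B (2 * s + 1) + of_bool (drop_edge n (Suc x) s \<in> S \<union> dwbc3 n)" if "n + x \<le> s" for s
  proof -
    have "cnt ?A (2 * s) = 0" by (rule cnt_eq_0) (use slices_bounds(1)[OF S, of _ x] that in fastforce)
    moreover have "cnt ?B (2 * s + 1) = 0"
      by (rule cnt_eq_0) (use slices_bounds(1)[OF S, of _ "Suc x"] that in fastforce)
    moreover have "drop_edge n (Suc x) s \<notin> S \<union> dwbc3 n"
      using S that assms(2) drop_edge_internal[of n "Suc x" s] by (auto simp: drop_edge_dwbc3)
    ultimately show ?thesis by simp
  qed
  show ?thesis
  proof (induction "n + x - s" arbitrary: s)
    case 0
    then show ?case by (intro high) simp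
  next
    case (Suc d)
    then have s: "s < n + x" by simp
    then have "conserving n S x s" using assms by (simp add: configs20V_iff)
    moreover have "cnt ?A (2 * Suc s) = cnt ?B (2 * Suc s + 1) + of_bool (drop_edge n (Suc x) (Suc s) \<in> S \<union> dwbc3 n)"
      by (rule Suc.hyps(1)) (use Suc.hyps(2) in simp)
    ultimately show ?case
      using cnt_step[OF finite_slices[OF S, of x], of "2 * s"] cnt_step[OF finite_slices[OF S, of "Suc x"], of "2 * s + 1"]
      by (simp add: conserving_def)
  qed
qed

lemma slices_in_towers:
  assumes "S \<in> configs20V n" "n > 0"
  shows "slices n S \<in> towers n {k. even k \<and> k < 2 * n}"
proof -
  have S: "S \<subseteq> internal_edges20V n" using assms(1) by (simp add: configs20V_iff)
  have "interlaced (slices n S x) (slices n S (Suc x))" if x: "x < n" for x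
  proof -
    have "cnt (slices n S x) 0 = card (slices n S x)" by (simp add: cnt_def)
    moreover have "cnt (slices n S (Suc x)) 1 = card (slices n S (Suc x))"
    proof -
      have "{k \<in> slices n S (Suc x). 1 \<le> k} = slices n S (Suc x)"
        using slices_bounds(2)[OF S, of x] by (auto intro: Suc_leI gr0I)
      then show ?thesis by (simp add: cnt_def)
    qed
    ultimately have "card (slices n S x) = Suc (card (slices n S (Suc x)))"
      using cnt_slices[OF assms(1) x, of 0] x by (simp add: drop_edge_dwbc3)
    then show ?thesis
      using cnt_slices[OF assms(1) x] finite_slices[OF S] slices_bounds(2)[OF S] by (auto simp: interlaced_def)
  qed
  then show ?thesis using slices_0[OF S] slices_bounds(3)[OF S] assms(2) by (auto simp: towers_def)
qed

text \<open>The vertical edges carry no information of their own: \<open>cnt_slices\<close> recovers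
  them from the slices.\<close>

lemma slices_inj:
  assumes "S \<in> configs20V n" "S' \<in> configs20V n" "slices n S = slices n S'"
  shows "S \<subseteq> S'"
proof
  fix e assume e: "e \<in> S"
  then have int: "e \<in> internal_edges20V n" using assms(1) by (auto simp: configs20V_iff)
  then have nb: "e \<notin> dwbc3 n" using dwbc3_boundary[of n] by auto
  from int show "e \<in> S'"
  proof (cases rule: internal_edgeE)
    case (1 x k)
    then have "k \<in> slices n S (Suc x)" using e by (simp add: slices_Suc)
    then have "k \<in> slices n S' (Suc x)" by (simp add: assms(3))
    then show ?thesis using 1 by (simp add: slices_Suc)
  next
    case (2 x s)
    have "of_bool (drop_edge n (Suc x) s \<in> S \<union> dwbc3 n) = (of_bool (drop_edge n (Suc x) s \<in> S' \<union> dwbc3 n) :: nat)"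
      using cnt_slices[OF assms(1) 2(2), of s] cnt_slices[OF assms(2) 2(2), of s] assms(3) by simp
    then show ?thesis using 2 e nb by (auto simp: of_bool_def split: if_splits)
  qed
qed

lemma towers_props:
  assumes f: "f \<in> towers n {k. even k \<and> k < 2 * n}"
  shows "finite (f x)" "x \<le> n \<Longrightarrow> card (f x) = n - x" "x \<le> n \<Longrightarrow> k \<in> f x \<Longrightarrow> k + 1 < 2 * (n + x)"
proof -
  have f0: "f 0 = {k. even k \<and> k < 2 * n}" and il: "\<And>x. x < n \<Longrightarrow> interlaced (f x) (f (Suc x))"
    and out: "\<And>x. x > n \<Longrightarrow> f x = {}"
    using f by (auto simp: towers_def)
  have evens: "{k. even k \<and> k < 2 * n} = (\<lambda>i. 2 * i) ` {..<n}" by (auto elim!: evenE)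
  show "finite (f x)"
  proof (cases x)
    case 0
    then show ?thesis by (simp add: f0 evens)
  next
    case (Suc y)
    then show ?thesis using il[of y] out[of x] by (cases "y < n") (auto simp: interlaced_def)
  qed
  show "card (f x) = n - x" if "x \<le> n" using that
  proof (induction x)
    case 0
    then show ?case by (simp add: f0 evens card_image inj_on_def)
  next
    case (Suc x)
    then show ?case using il[of x] by (auto simp: interlaced_def)
  qed
  show "k + 1 < 2 * (n + x)" if "x \<le> n" "k \<in> f x" using that
  proof (induction x arbitrary: k)
    case 0
    then have "even k" "k < 2 * n" by (simp_all add: f0)
    then show ?case by presburger
  next
    case (Suc x)
    then have R: "interlaced (f x) (f (Suc x))" by (intro il) simp
    have "cnt (f x) (2 * (n + x)) = 0" by (rule cnt_eq_0) (use Suc in fastforce)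
    then have "cnt (f (Suc x)) (2 * (n + x) + 1) = 0" using R unfolding interlaced_def by (metis Zero_not_Suc)
    then have "{k \<in> f (Suc x). 2 * (n + x) + 1 \<le> k} = {}" using R by (simp add: cnt_def interlaced_def)
    then show ?case using Suc.prems by force
  qed
qed

text \<open>Vertical edges are placed where the two counts differ. The index \<open>Suc s\<close>
  leaves out the lowest vertical edge of each column, which already belongs to
  \<open>dwbc3\<close>.\<close>

definition config_of :: "nat \<Rightarrow> (nat \<Rightarrow> nat set) \<Rightarrow> ((int \<times> int) \<times> (int \<times> int)) set" where
  "config_of n f = {slot n (Suc x) k | x k. Suc x < n \<and> k \<in> f (Suc x)} \<union>
     {drop_edge n (Suc x) (Suc s) | x s. x < n \<and> cnt (f x) (2 * Suc s) = Suc (cnt (f (Suc x)) (2 * Suc s + 1))}"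

lemma config_of:
  assumes f: "f \<in> towers n {k. even k \<and> k < 2 * n}" and n: "n > 0"
  shows "config_of n f \<in> configs20V n" "slices n (config_of n f) = f"
proof -
  let ?S = "config_of n f"
  note fin = towers_props(1)[OF f] and card = towers_props(2)[OF f] and bound = towers_props(3)[OF f]
  have f0: "f 0 = {k. even k \<and> k < 2 * n}" and il: "\<And>x. x < n \<Longrightarrow> interlaced (f x) (f (Suc x))"
    using f by (auto simp: towers_def)
  have empty: "f x = {}" if "x \<ge> n" for x
    using f that card[of n] fin[of n] by (cases "x = n") (auto simp: towers_def)
  have pos: "k \<noteq> 0" if "k \<in> f (Suc x)" "x < n" for k x using il[OF that(2)] that(1) by (metis interlaced_def)
  have S: "?S \<subseteq> internal_edges20V n"
  proof
    fix e assume "e \<in> ?S"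
    then consider x k where "e = slot n (Suc x) k" "Suc x < n" "k \<in> f (Suc x)"
      | x s where "e = drop_edge n (Suc x) (Suc s)" "x < n" "cnt (f x) (2 * Suc s) = Suc (cnt (f (Suc x)) (2 * Suc s + 1))"
      by (auto simp: config_of_def)
    then show "e \<in> internal_edges20V n"
    proof cases
      case (1 x k)
      then show ?thesis using pos[of k x] bound[of "Suc x" k] by (auto simp: slot_internal)
    next
      case (2 x s)
      then have "{k \<in> f x. 2 * Suc s \<le> k} \<noteq> {}" by (metis Zero_not_Suc card.empty cnt_def)
      then obtain k where "k \<in> f x" "2 * Suc s \<le> k" by auto
      then have "Suc s < n + x" using bound[of x k] 2 by simp
      then show ?thesis using 2 by (auto simp: drop_edge_internal)
    qed
  qed
  show sl: "slices n ?S = f"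
  proof
    fix x
    show "slices n ?S x = f x"
    proof (cases x)
      case 0
      then show ?thesis by (simp add: slices_0[OF S] f0)
    next
      case (Suc y)
      have "slot n (Suc y) k \<in> ?S \<longleftrightarrow> Suc y < n \<and> k \<in> f (Suc y)" for k
        by (auto simp: config_of_def slot_inj slot_neq_drop_edge)
      then show ?thesis using empty[of x] Suc by (cases "Suc y < n") (auto simp: slices_Suc)
    qed
  qed
  have drop: "drop_edge n (Suc x) s \<in> ?S \<union> dwbc3 n \<longleftrightarrow> cnt (f x) (2 * s) = Suc (cnt (f (Suc x)) (2 * s + 1))"
    if x: "x < n" for x s
  proof (cases s)
    case 0
    have "cnt (f x) 0 = card (f x)" by (simp add: cnt_def)
    moreover have "cnt (f (Suc x)) 1 = card (f (Suc x))"
    proof -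
      have "{k \<in> f (Suc x). 1 \<le> k} = f (Suc x)" using pos[OF _ x] by (auto intro: Suc_leI gr0I)
      then show ?thesis by (simp add: cnt_def)
    qed
    ultimately show ?thesis using 0 x il[OF x] by (simp add: drop_edge_dwbc3 interlaced_def)
  next
    case (Suc t)
    then show ?thesis
      using x by (auto simp: drop_edge_dwbc3 config_of_def drop_edge_inj slot_neq_drop_edge[symmetric])
  qed
  have "conserving n ?S x s" if x: "x < n" for x s
  proof -
    have eq: "cnt (f x) (2 * s) = cnt (f (Suc x)) (2 * s + 1) + of_bool (drop_edge n (Suc x) s \<in> ?S \<union> dwbc3 n)" for s
      using il[OF x] unfolding drop[OF x] interlaced_def by auto
    show ?thesis
      using eq[of s] eq[of "Suc s"] cnt_step[OF fin[of x], of "2 * s"] cnt_step[OF fin[of "Suc x"], of "2 * s + 1"]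
      by (simp add: conserving_def sl)
  qed
  then show "?S \<in> configs20V n" using S by (simp add: configs20V_iff)
qed

text \<open>The boundary condition fills the even slots \<open>0, 2, ..., 2 * n - 2\<close> in front
  of the first column; their halves are the numbers below \<open>n\<close>.\<close>

theorem Z20V_eq_num_chains:
  assumes "n > 0"
  shows "Z20V n = num_chains n (rev [0..<n])"
proof -
  let ?A = "{k. even k \<and> k < 2 * n}" and ?as = "map (\<lambda>i. 2 * i) (rev [0..<n])"
  have "bij_betw (slices n) (configs20V n) (towers n ?A)"
    unfolding bij_betw_def
  proof (intro conjI equalityI subsetI)
    show "inj_on (slices n) (configs20V n)"
      by (rule inj_onI) (auto dest: slices_inj)
    fix f assume "f \<in> slices n ` configs20V n"
    then show "f \<in> towers n ?A" using slices_in_towers assms by auto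
  next
    fix f assume "f \<in> towers n ?A"
    then show "f \<in> slices n ` configs20V n" using config_of[of f n] assms by (metis image_eqI)
  qed
  then have "Z20V n = card (towers n ?A)" unfolding Z20V_def by (rule bij_betw_same_card)
  moreover have "set ?as = ?A" by (auto elim!: evenE)
  moreover have "sorted_wrt (>) ?as" by (simp add: sorted_wrt_map sorted_wrt_rev)
  moreover have "map (\<lambda>a. a div 2) ?as = rev [0..<n]" by (simp add: o_def)
  ultimately show ?thesis using card_towers[of ?as n] by simp
qed

section \<open>Coordinate Bethe Ansatz\<close>

text \<open>Up to the denominator, \<open>scat\<close> is the two-particle scattering factor of the six-vertex model at
  \<open>\<Delta> = 1 / sqrt 2\<close>. The denominators turn the signed sum over all permutations of the Bethe Ansatz,
  divided by a Vandermonde product, into an unsigned sum in which the variable of the largest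
  position is chosen first. In this form no ordering of the variables is needed.\<close>

definition scat :: "'a::field \<Rightarrow> 'a \<Rightarrow> 'a" where
  "scat u v = (1 + u * v - u + v) / (v - u)"

definition scat_weight :: "(nat \<Rightarrow> 'a::field) \<Rightarrow> nat set \<Rightarrow> nat \<Rightarrow> 'a" where
  "scat_weight z I k = (\<Prod>i\<in>I - {k}. scat (z i) (z k))"

definition peel :: "(nat \<Rightarrow> 'a::field) \<Rightarrow> ('a \<Rightarrow> 'a) \<Rightarrow> (nat set \<Rightarrow> 'a) \<Rightarrow> nat set \<Rightarrow> 'a" where
  "peel z g \<phi> I = (\<Sum>k\<in>I. g (z k) * scat_weight z I k * \<phi> (I - {k}))"

text \<open>Here \<open>g\<close> may couple the variables of the two largest positions, because
  collision terms do not factor into weights of single variables. The same holds for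
  \<open>peel3\<close> with three variables.\<close>

definition peel2 :: "(nat \<Rightarrow> 'a::field) \<Rightarrow> ('a \<Rightarrow> 'a \<Rightarrow> 'a) \<Rightarrow> (nat set \<Rightarrow> 'a) \<Rightarrow> nat set \<Rightarrow> 'a" where
  "peel2 z g \<phi> I = (\<Sum>k\<in>I. scat_weight z I k * peel z (g (z k)) \<phi> (I - {k}))"

definition peel3 :: "(nat \<Rightarrow> 'a::field) \<Rightarrow> ('a \<Rightarrow> 'a \<Rightarrow> 'a \<Rightarrow> 'a) \<Rightarrow> (nat set \<Rightarrow> 'a) \<Rightarrow> nat set \<Rightarrow> 'a" where
  "peel3 z g \<phi> I = (\<Sum>k\<in>I. scat_weight z I k * peel2 z (g (z k)) \<phi> (I - {k}))"

fun bethe :: "(nat \<Rightarrow> 'a::field) \<Rightarrow> nat list \<Rightarrow> nat set \<Rightarrow> 'a" where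
  "bethe z [] = (\<lambda>I. 1)"
| "bethe z (a # as) = peel z (\<lambda>x. x ^ a) (bethe z as)"

section \<open>Algebra of peeling\<close>

lemma peel_add: "peel z g (\<lambda>J. \<phi> J + \<psi> J) I = peel z g \<phi> I + peel z g \<psi> I"
  by (simp add: peel_def sum.distrib algebra_simps)

lemma peel_peel: "peel z g (peel z h \<phi>) I = peel2 z (\<lambda>x y. g x * h y) \<phi> I"
  by (simp add: peel_def peel2_def sum_distrib_left mult_ac)

lemma peel_peel2: "peel z g (peel2 z h \<phi>) I = peel3 z (\<lambda>x y w. g x * h y w) \<phi> I"
  by (simp add: peel_def peel2_def peel3_def sum_distrib_left mult_ac)

lemma peel2_peel: "peel2 z g (peel z h \<phi>) I = peel3 z (\<lambda>x y w. g x y * h w) \<phi> I"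
  by (simp add: peel_def peel2_def peel3_def sum_distrib_left mult_ac)

lemma peel2_add: "peel2 z g (\<lambda>J. \<phi> J + \<psi> J) I = peel2 z g \<phi> I + peel2 z g \<psi> I"
  by (simp add: peel2_def peel_add sum.distrib algebra_simps)

lemma peel_add_fun: "peel z g \<phi> I + peel z h \<phi> I = peel z (\<lambda>x. g x + h x) \<phi> I"
  by (simp add: peel_def sum.distrib algebra_simps)

lemma peel_diff_fun: "peel z g \<phi> I - peel z h \<phi> I = peel z (\<lambda>x. g x - h x) \<phi> I"
  by (simp add: peel_def sum_subtractf algebra_simps)

lemma peel2_add_fun: "peel2 z g \<phi> I + peel2 z h \<phi> I = peel2 z (\<lambda>x y. g x y + h x y) \<phi> I"
  by (simp add: peel2_def peel_add_fun[symmetric] sum.distrib algebra_simps)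

lemma peel2_diff_fun: "peel2 z g \<phi> I - peel2 z h \<phi> I = peel2 z (\<lambda>x y. g x y - h x y) \<phi> I"
  by (simp add: peel2_def peel_diff_fun[symmetric] sum_subtractf algebra_simps)

lemma peel3_add_fun: "peel3 z g \<phi> I + peel3 z h \<phi> I = peel3 z (\<lambda>x y w. g x y w + h x y w) \<phi> I"
  by (simp add: peel3_def peel2_add_fun[symmetric] sum.distrib algebra_simps)

lemma peel3_diff_fun: "peel3 z g \<phi> I - peel3 z h \<phi> I = peel3 z (\<lambda>x y w. g x y w - h x y w) \<phi> I"
  by (simp add: peel3_def peel2_diff_fun[symmetric] sum_subtractf algebra_simps)

lemma peel_cong:
  assumes "\<And>k. k \<in> I \<Longrightarrow> g (z k) = h (z k)" "\<And>k. k \<in> I \<Longrightarrow> \<phi> (I - {k}) = \<psi> (I - {k})"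
  shows "peel z g \<phi> I = peel z h \<psi> I"
  unfolding peel_def by (rule sum.cong) (simp_all add: assms)

lemma peel2_cong:
  assumes "\<And>k l. k \<in> I \<Longrightarrow> l \<in> I \<Longrightarrow> k \<noteq> l \<Longrightarrow> g (z k) (z l) = h (z k) (z l)"
    "\<And>k l. k \<in> I \<Longrightarrow> l \<in> I \<Longrightarrow> k \<noteq> l \<Longrightarrow> \<phi> (I - {k} - {l}) = \<psi> (I - {k} - {l})"
  shows "peel2 z g \<phi> I = peel2 z h \<psi> I"
  unfolding peel2_def by (intro sum.cong arg_cong[of _ _ "(*) _"] peel_cong) (use assms in auto)

lemma peel3_cong:
  assumes "\<And>k l m. \<lbrakk>k \<in> I; l \<in> I; m \<in> I; k \<noteq> l; k \<noteq> m; l \<noteq> m\<rbrakk> \<Longrightarrow> g (z k) (z l) (z m) = h (z k) (z l) (z m)"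
  shows "peel3 z g \<phi> I = peel3 z h \<phi> I"
  unfolding peel3_def by (intro sum.cong arg_cong[of _ _ "(*) _"] peel2_cong) (use assms in auto)

section \<open>Cancellation by exchange of variables\<close>

lemma sum_antisym_pairs:
  fixes f :: "nat \<Rightarrow> nat \<Rightarrow> 'a::field_char_0"
  assumes "finite I" "\<And>k l. k \<in> I \<Longrightarrow> l \<in> I \<Longrightarrow> k \<noteq> l \<Longrightarrow> f k l = - f l k"
  shows "(\<Sum>k\<in>I. \<Sum>l\<in>I - {k}. f k l) = 0"
proof -
  have eq: "(\<Sum>k\<in>I. \<Sum>l\<in>I - {k}. f k l) = (\<Sum>k\<in>I. \<Sum>l\<in>I. if k = l then 0 else f k l)" for f :: "nat \<Rightarrow> nat \<Rightarrow> 'a"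
    by (intro sum.cong[OF refl] sum.mono_neutral_cong_left) (auto simp: assms(1))
  have "(\<Sum>k\<in>I. \<Sum>l\<in>I - {k}. f k l) = (\<Sum>l\<in>I. \<Sum>k\<in>I. if k = l then 0 else f k l)"
    unfolding eq by (rule sum.swap)
  also have "\<dots> = (\<Sum>l\<in>I. \<Sum>k\<in>I. if l = k then 0 else - f l k)"
    by (intro sum.cong refl) (auto intro: assms(2))
  also have "\<dots> = - (\<Sum>k\<in>I. \<Sum>l\<in>I - {k}. f k l)"
    unfolding eq sum_negf[symmetric] by (intro sum.cong refl) auto
  finally show ?thesis by simp
qed

text \<open>Everything except \<open>scat (z l) (z k)\<close> is symmetric in \<open>k\<close> and
  \<open>l\<close>. Hence exchanging two successive choices is felt only by this factor and by the
  weight function, which is what the antisymmetry criteria below test.\<close>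

lemma scat_weight_twice:
  assumes "finite I" "k \<in> I" "l \<in> I" "k \<noteq> l"
  shows "scat_weight z I k * scat_weight z (I - {k}) l =
    scat (z l) (z k) * (\<Prod>i\<in>I - {k, l}. scat (z i) (z k) * scat (z i) (z l))"
proof -
  have "I - {k} - {l} = I - {k, l}" by auto
  moreover have "scat_weight z I k = scat (z l) (z k) * (\<Prod>i\<in>I - {k} - {l}. scat (z i) (z k))"
    unfolding scat_weight_def using assms by (subst prod.remove[of _ l]) auto
  ultimately show ?thesis by (simp add: scat_weight_def prod.distrib)
qed

lemma sum_scat_weight_antisym:
  fixes z :: "nat \<Rightarrow> 'a::field_char_0"
  assumes "finite I"
    and "\<And>k l. k \<in> I \<Longrightarrow> l \<in> I \<Longrightarrow> k \<noteq> l \<Longrightarrow> F k l * scat (z l) (z k) = - (F l k * scat (z k) (z l))"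
  shows "(\<Sum>k\<in>I. scat_weight z I k * (\<Sum>l\<in>I - {k}. scat_weight z (I - {k}) l * F k l)) = 0"
proof -
  have "(\<Sum>k\<in>I. \<Sum>l\<in>I - {k}. scat_weight z I k * scat_weight z (I - {k}) l * F k l) = 0"
  proof (rule sum_antisym_pairs)
    fix k l assume kl: "k \<in> I" "l \<in> I" "k \<noteq> l"
    have "(\<Prod>i\<in>I - {k, l}. scat (z i) (z k) * scat (z i) (z l)) =
        (\<Prod>i\<in>I - {l, k}. scat (z i) (z l) * scat (z i) (z k))"
      by (simp add: insert_commute mult.commute)
    then have "scat_weight z I k * scat_weight z (I - {k}) l * F k l =
        (F k l * scat (z l) (z k)) * (\<Prod>i\<in>I - {l, k}. scat (z i) (z l) * scat (z i) (z k))"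
      using kl assms(1) by (simp add: scat_weight_twice mult_ac)
    also have "\<dots> = - (scat_weight z I l * scat_weight z (I - {l}) k * F l k)"
      unfolding assms(2)[OF kl] using kl assms(1) by (simp add: scat_weight_twice mult_ac)
    finally show "scat_weight z I k * scat_weight z (I - {k}) l * F k l = - (scat_weight z I l * scat_weight z (I - {l}) k * F l k)" .
  qed (rule assms)
  then show ?thesis by (simp add: sum_distrib_left mult.assoc)
qed

lemma peel2_antisym:
  fixes z :: "nat \<Rightarrow> 'a::field_char_0"
  assumes "finite I"
    and "\<And>k l. k \<in> I \<Longrightarrow> l \<in> I \<Longrightarrow> k \<noteq> l \<Longrightarrow>
      g (z k) (z l) * scat (z l) (z k) = - (g (z l) (z k) * scat (z k) (z l))"
  shows "peel2 z g \<phi> I = 0"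
proof -
  have "(\<Sum>k\<in>I. scat_weight z I k * (\<Sum>l\<in>I - {k}. scat_weight z (I - {k}) l * (g (z k) (z l) * \<phi> (I - {k, l})))) = 0"
  proof (rule sum_scat_weight_antisym[OF assms(1)])
    fix k l assume kl: "k \<in> I" "l \<in> I" "k \<noteq> l"
    have "g (z k) (z l) * \<phi> (I - {k, l}) * scat (z l) (z k) = (g (z k) (z l) * scat (z l) (z k)) * \<phi> (I - {k, l})"
      by (simp add: mult_ac)
    also have "\<dots> = - (g (z l) (z k) * \<phi> (I - {l, k}) * scat (z k) (z l))"
      unfolding assms(2)[OF kl] insert_commute[of k l] by (simp add: mult_ac)
    finally show "g (z k) (z l) * \<phi> (I - {k, l}) * scat (z l) (z k) = - (g (z l) (z k) * \<phi> (I - {l, k}) * scat (z k) (z l))" .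
  qed
  moreover have "I - {k} - {l} = I - {k, l}" for k l by auto
  ultimately show ?thesis by (simp add: peel2_def peel_def mult_ac)
qed

lemma eq_neg_mult:
  fixes a :: "'a::comm_ring"
  assumes "a * s = - (b * t)"
  shows "a * x * y * s = - (b * x * y * t)"
proof -
  have "a * x * y * s = (a * s) * (x * y)" by (simp add: mult_ac)
  also have "\<dots> = - (b * x * y * t)" unfolding assms by (simp add: mult_ac)
  finally show ?thesis .
qed

lemma peel3_antisym_12:
  fixes z :: "nat \<Rightarrow> 'a::field_char_0"
  assumes "finite I"
    and g: "\<And>k l m. \<lbrakk>k \<in> I; l \<in> I; m \<in> I; k \<noteq> l; k \<noteq> m; l \<noteq> m\<rbrakk> \<Longrightarrow>
      g (z k) (z l) (z m) * scat (z l) (z k) = - (g (z l) (z k) (z m) * scat (z k) (z l))"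
  shows "peel3 z g \<phi> I = 0"
proof -
  have "(\<Sum>k\<in>I. scat_weight z I k * (\<Sum>l\<in>I - {k}. scat_weight z (I - {k}) l * peel z (g (z k) (z l)) \<phi> (I - {k, l}))) = 0"
  proof (rule sum_scat_weight_antisym[OF assms(1)])
    fix k l assume kl: "k \<in> I" "l \<in> I" "k \<noteq> l"
    show "peel z (g (z k) (z l)) \<phi> (I - {k, l}) * scat (z l) (z k) =
        - (peel z (g (z l) (z k)) \<phi> (I - {l, k}) * scat (z k) (z l))"
      unfolding peel_def sum_distrib_right sum_negf[symmetric] insert_commute[of l k]
    proof (rule sum.cong[OF refl])
      fix m assume "m \<in> I - {k, l}"
      then have "g (z k) (z l) (z m) * scat (z l) (z k) = - (g (z l) (z k) (z m) * scat (z k) (z l))"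
        using g[of k l m] kl by auto
      then show "g (z k) (z l) (z m) * scat_weight z (I - {k, l}) m * \<phi> (I - {k, l} - {m}) * scat (z l) (z k) =
          - (g (z l) (z k) (z m) * scat_weight z (I - {k, l}) m * \<phi> (I - {k, l} - {m}) * scat (z k) (z l))"
        using eq_neg_mult[of "g (z k) (z l) (z m)" "scat (z l) (z k)" "g (z l) (z k) (z m)" "scat (z k) (z l)"]
        by blast
    qed
  qed
  moreover have "I - {k} - {l} = I - {k, l}" for k l by auto
  ultimately show ?thesis by (simp add: peel3_def peel2_def)
qed

lemma peel3_antisym_23:
  fixes z :: "nat \<Rightarrow> 'a::field_char_0"
  assumes "finite I"
    and g: "\<And>k l m. \<lbrakk>k \<in> I; l \<in> I; m \<in> I; k \<noteq> l; k \<noteq> m; l \<noteq> m\<rbrakk> \<Longrightarrow>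
      g (z k) (z l) (z m) * scat (z m) (z l) = - (g (z k) (z m) (z l) * scat (z l) (z m))"
  shows "peel3 z g \<phi> I = 0"
proof -
  have "peel2 z (g (z k)) \<phi> (I - {k}) = 0" if "k \<in> I" for k
    by (rule peel2_antisym) (use assms(1) g[of k] that in blast)+
  then show ?thesis by (simp add: peel3_def)
qed

text \<open>These two identities say that the contribution of a pair of neighbouring paths which meet cancels
  in the Bethe sum: the right-hand side times the scattering factor is antisymmetric. When three
  consecutive bounds coincide, the three-body identity below is needed in addition; its right-hand
  side was found by linear algebra.\<close>

lemma two_body:
  fixes x y :: "'a::field"
  assumes "x \<noteq> 1" "y \<noteq> 1" "x \<noteq> y"
  shows "x * ((x + 1) / (x - 1)) * (y * ((y + 1) / (y - 1))) - (1 + x) * ((y + 1) / (y - 1)) - x =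
      (1 + x * y) * (1 + x * y - x + y) / ((x - 1) * (y - 1))"
    and "(x + 1) / (x - 1) * ((y + 1) / (y - 1)) * (1 - x + x * y) - x =
      (1 + x * y) * (1 + x * y - x + y) / ((x - 1) * (y - 1))"
proof -
  have "x - 1 \<noteq> 0" "y - 1 \<noteq> 0" using assms by auto
  then show "x * ((x + 1) / (x - 1)) * (y * ((y + 1) / (y - 1))) - (1 + x) * ((y + 1) / (y - 1)) - x =
      (1 + x * y) * (1 + x * y - x + y) / ((x - 1) * (y - 1))"
    and "(x + 1) / (x - 1) * ((y + 1) / (y - 1)) * (1 - x + x * y) - x =
      (1 + x * y) * (1 + x * y - x + y) / ((x - 1) * (y - 1))"
    by (simp_all add: divide_simps) (simp_all add: algebra_simps)
qed

text \<open>The factor \<open>1 + x * y - x + y\<close> is the numerator of \<open>scat x y\<close>.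
  Together with the numerator of \<open>scat y x\<close> it is symmetric, so that only the
  denominator \<open>x - y\<close> changes sign.\<close>

lemma two_body_antisym:
  fixes x y :: "'a::field"
  shows "(1 + x * y) * (1 + x * y - x + y) / ((x - 1) * (y - 1)) * scat y x =
      - ((1 + y * x) * (1 + y * x - y + x) / ((y - 1) * (x - 1)) * scat x y)"
proof -
  have "scat y x = - ((1 + y * x - y + x) / (y - x))"
    unfolding scat_def by (metis minus_diff_eq minus_divide_right)
  then show ?thesis unfolding scat_def by (simp add: mult_ac)
qed

text \<open>In the first summand a polynomial symmetric in \<open>x\<close> and \<open>y\<close>
  stands beside the numerator of \<open>scat x y\<close>, in the second one symmetric in
  \<open>y\<close> and \<open>w\<close> beside the numerator of \<open>scat y w\<close>. The
  summands therefore vanish under \<open>peel3\<close> by exchange of the first and of the last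
  pair, respectively.\<close>

lemma three_body:
  fixes x y w :: "'a::field"
  assumes "x \<noteq> 1" "y \<noteq> 1" "w \<noteq> 1"
  shows "x * ((x + 1) / (x - 1)) * (y * ((y + 1) / (y - 1))) * (w * ((w + 1) / (w - 1))) - x * ((w + 1) / (w - 1)) =
      ((1 + 2 * w - (x + y) + x * y + w^2 + (x + y) * w^2 + x * y * w^2) * (1 + x * y - x + y)
       + (x - 1 - (y + w) - y * w - x * y * w + x^2 * (y + w)) * (1 + y * w - y + w))
      / ((x - 1) * (y - 1) * (w - 1))"
proof -
  have frac: "x * (a / X) * (y * (b / Y)) * (w * (c / W)) - x * (c / W) = x * c * (y * w * a * b - X * Y) / (X * Y * W)"
    if "X \<noteq> 0" "Y \<noteq> 0" "W \<noteq> 0" for a b c X Y W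
    using that by (simp add: divide_simps) (simp add: algebra_simps)
  have poly: "x * (w + 1) * (y * w * (x + 1) * (y + 1) - (x - 1) * (y - 1)) =
      (1 + 2 * w - (x + y) + x * y + w^2 + (x + y) * w^2 + x * y * w^2) * (1 + x * y - x + y)
       + (x - 1 - (y + w) - y * w - x * y * w + x^2 * (y + w)) * (1 + y * w - y + w)"
    by (simp add: algebra_simps power2_eq_square)
  have "x - 1 \<noteq> 0" "y - 1 \<noteq> 0" "w - 1 \<noteq> 0" using assms by auto
  note nz = this
  show ?thesis unfolding frac[OF nz] unfolding poly ..
qed

text \<open>The boundary factor of geometric summation: for \<open>c \<le> a\<close>, the sum of
  \<open>x ^ (b div 2)\<close> over \<open>2 * c + 1 \<le> b \<le> 2 * a + 2\<close> is
  \<open>x ^ Suc a * mob x - x ^ c * mob x\<close>.\<close>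

definition mob :: "'a::field \<Rightarrow> 'a" where
  "mob x = (x + 1) / (x - 1)"

lemma mob_eq: "x \<noteq> 1 \<Longrightarrow> x * mob x = x + 1 + mob x"
  by (simp add: mob_def divide_simps) (simp add: algebra_simps)

text \<open>The sum of the Bethe wave function over all positions of \<open>N\<close> paths between \<open>N + 1\<close> bounds has,
  if collisions are ignored, one boundary term for each choice of lower or upper bounds. Only those
  choices survive in which the lower bounds are taken for the small positions and the upper bounds
  for the large ones; they make up \<open>bethe_sum\<close>.\<close>

definition low :: "(nat \<Rightarrow> 'a::field) \<Rightarrow> nat list \<Rightarrow> nat set \<Rightarrow> 'a" where
  "low z as I = (\<Prod>i\<in>I. - mob (z i)) * bethe z as I"

fun bethe_sum :: "(nat \<Rightarrow> 'a::field) \<Rightarrow> nat list \<Rightarrow> nat set \<Rightarrow> 'a" where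
  "bethe_sum z [] = (\<lambda>I. 0)"
| "bethe_sum z (a # as) = (\<lambda>I. low z as I + peel z (\<lambda>x. x ^ Suc a * mob x) (bethe_sum z as) I)"

definition admissible :: "(nat \<Rightarrow> 'a::field) \<Rightarrow> nat set \<Rightarrow> bool" where
  "admissible z I \<longleftrightarrow> finite I \<and> inj_on z I \<and> (\<forall>i\<in>I. z i \<noteq> 1)"

lemma admissible_mono: "admissible z I \<Longrightarrow> J \<subseteq> I \<Longrightarrow> admissible z J"
  by (auto simp: admissible_def intro: finite_subset inj_on_subset)

lemma low_Cons:
  assumes "finite I"
  shows "low z (a # as) I = peel z (\<lambda>x. - (x ^ a * mob x)) (low z as) I"
proof -
  have "(\<Prod>i\<in>I. - mob (z i)) = - mob (z k) * (\<Prod>i\<in>I - {k}. - mob (z i))" if "k \<in> I" for k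
    by (rule prod.remove[OF assms that])
  then show ?thesis
    unfolding low_def bethe.simps peel_def sum_distrib_left
    by (intro sum.cong refl) (simp add: mult_ac)
qed

text \<open>Counterpart of \<open>interl_sum_Suc\<close>. By \<open>mob_eq\<close> the upper
  boundary terms for consecutive bounds differ exactly by the contribution of the two new
  positions.\<close>

lemma bethe_sum_Suc_diff:
  assumes "admissible z I"
  shows "bethe_sum z (Suc a # as) I - bethe_sum z (a # as) I = peel z (\<lambda>x. x ^ Suc a + x ^ Suc (Suc a)) (bethe_sum z as) I"
proof -
  have "x ^ Suc (Suc a) * mob x - x ^ Suc a * mob x = x ^ Suc a + x ^ Suc (Suc a)" if "x \<noteq> 1" for x :: 'a
  proof -
    have "x ^ Suc (Suc a) * mob x = x ^ Suc a * (x * mob x)" by simp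
    then show ?thesis unfolding mob_eq[OF that] by (simp add: algebra_simps)
  qed
  then have "peel z (\<lambda>x. x ^ Suc (Suc a) * mob x - x ^ Suc a * mob x) (bethe_sum z as) I =
      peel z (\<lambda>x. x ^ Suc a + x ^ Suc (Suc a)) (bethe_sum z as) I"
    using assms by (intro peel_cong) (auto simp: admissible_def)
  then show ?thesis by (simp add: peel_diff_fun[symmetric])
qed

text \<open>The lower and the upper boundary term of the first path combine to a geometric sum
  between equal bounds, which has only the two terms with halves \<open>c\<close> and
  \<open>Suc c\<close>.\<close>

lemma bethe_sum_eq:
  assumes "admissible z I"
  shows "bethe_sum z (c # c # as) I = peel z (\<lambda>x. x ^ c + x ^ Suc c) (low z as) I
    + peel2 z (\<lambda>x y. x ^ Suc c * mob x * (y ^ Suc c * mob y)) (bethe_sum z as) I"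
proof -
  have "x ^ Suc c * mob x - x ^ c * mob x = x ^ c + x ^ Suc c" if "x \<noteq> 1" for x :: 'a
  proof -
    have "x ^ Suc c * mob x = x ^ c * (x * mob x)" by simp
    then show ?thesis unfolding mob_eq[OF that] by (simp add: algebra_simps)
  qed
  then have eq: "peel z (\<lambda>x. - (x ^ c * mob x) + x ^ Suc c * mob x) (low z as) I =
      peel z (\<lambda>x. x ^ c + x ^ Suc c) (low z as) I"
    using assms by (intro peel_cong) (auto simp: admissible_def)
  have "bethe_sum z (c # c # as) I = peel z (\<lambda>x. - (x ^ c * mob x)) (low z as) I +
      (peel z (\<lambda>x. x ^ Suc c * mob x) (low z as) I +
       peel2 z (\<lambda>x y. x ^ Suc c * mob x * (y ^ Suc c * mob y)) (bethe_sum z as) I)"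
    using assms by (simp add: low_Cons admissible_def peel_add peel_peel del: power_Suc)
  then show ?thesis unfolding add.assoc[symmetric] peel_add_fun eq .
qed

text \<open>The prefactor \<open>x ^ c * y ^ c\<close> is symmetric and does not disturb the
  cancellation, so weights that differ by a collision term may replace each other under
  \<open>peel2\<close>.\<close>

lemma peel2_two_body:
  fixes z :: "nat \<Rightarrow> 'a::field_char_0"
  assumes "admissible z I"
    and "\<And>x y. x \<noteq> 1 \<Longrightarrow> y \<noteq> 1 \<Longrightarrow> x \<noteq> y \<Longrightarrow> g x y - h x y =
      x ^ c * y ^ c * ((1 + x * y) * (1 + x * y - x + y) / ((x - 1) * (y - 1)))"
  shows "peel2 z g \<phi> I = peel2 z h \<phi> I"
proof -
  have "peel2 z (\<lambda>x y. g x y - h x y) \<phi> I = 0"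
  proof (rule peel2_antisym)
    fix k l assume kl: "k \<in> I" "l \<in> I" "k \<noteq> l"
    define x y where "x = z k" and "y = z l"
    have xy: "x \<noteq> 1" "y \<noteq> 1" "x \<noteq> y" using assms(1) kl by (auto simp: x_def y_def admissible_def inj_on_def)
    let ?E = "\<lambda>x y. (1 + x * y) * (1 + x * y - x + y) / ((x - 1) * (y - 1))"
    have "x ^ c * y ^ c * ?E x y * scat y x = x ^ c * y ^ c * (?E x y * scat y x)" by (simp add: mult.assoc)
    also have "\<dots> = - (y ^ c * x ^ c * ?E y x * scat x y)"
      unfolding two_body_antisym[of x y] by (simp add: mult_ac)
    finally show "(g (z k) (z l) - h (z k) (z l)) * scat (z l) (z k) =
        - ((g (z l) (z k) - h (z l) (z k)) * scat (z k) (z l))"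
      using xy assms(2)[of x y] assms(2)[of y x] by (simp add: x_def y_def)
  qed (use assms(1) in \<open>simp add: admissible_def\<close>)
  then show ?thesis by (simp add: peel2_diff_fun[symmetric])
qed

lemma peel3_three_body:
  fixes z :: "nat \<Rightarrow> 'a::field_char_0"
  assumes "admissible z I"
  shows "peel3 z (\<lambda>x y w. x ^ Suc c * mob x * (y ^ Suc c * mob y) * (w ^ Suc c * mob w)) \<phi> I =
    peel3 z (\<lambda>x y w. x ^ Suc c * y ^ c * (w ^ c * mob w)) \<phi> I"
proof -
  define P where "P x y w = (x * y * w) ^ c * (1 + 2 * w - (x + y) + x * y + w^2 + (x + y) * w^2 + x * y * w^2) *
    (1 + x * y - x + y) / ((x - 1) * (y - 1) * (w - 1))" for x y w :: 'a
  define Q where "Q x y w = (x * y * w) ^ c * (x - 1 - (y + w) - y * w - x * y * w + x^2 * (y + w)) * (1 + y * w - y + w)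
    / ((x - 1) * (y - 1) * (w - 1))" for x y w :: 'a
  have split: "K * ((p * t + q * s) / D) = K * p * t / D + K * q * s / D" for K p q t s D :: 'a
    by (simp add: distrib_left add_divide_distrib mult.assoc)
  have scat: "(1 + x * y - x + y) * scat y x = - ((1 + y * x - y + x) * scat x y)" for x y :: 'a
  proof -
    have "scat y x = - ((1 + y * x - y + x) / (y - x))"
      unfolding scat_def by (metis minus_diff_eq minus_divide_right)
    then show ?thesis unfolding scat_def by (simp add: mult_ac)
  qed
  have P: "P x y w * scat y x = - (P y x w * scat x y)" for x y w
  proof -
    have "P x y w * scat y x = (x * y * w) ^ c * (1 + 2 * w - (x + y) + x * y + w^2 + (x + y) * w^2 + x * y * w^2) /
        ((x - 1) * (y - 1) * (w - 1)) * ((1 + x * y - x + y) * scat y x)"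
      by (simp add: P_def)
    also have "\<dots> = - (P y x w * scat x y)" unfolding scat[of x y] P_def by (simp add: ac_simps)
    finally show ?thesis .
  qed
  have Q: "Q x y w * scat w y = - (Q x w y * scat y w)" for x y w
  proof -
    have "Q x y w * scat w y = (x * y * w) ^ c * (x - 1 - (y + w) - y * w - x * y * w + x^2 * (y + w)) /
        ((x - 1) * (y - 1) * (w - 1)) * ((1 + y * w - y + w) * scat w y)"
      by (simp add: Q_def)
    also have "\<dots> = - (Q x w y * scat y w)" unfolding scat[of y w] Q_def by (simp add: ac_simps)
    finally show ?thesis .
  qed
  have "x ^ Suc c * mob x * (y ^ Suc c * mob y) * (w ^ Suc c * mob w) - x ^ Suc c * y ^ c * (w ^ c * mob w) = P x y w + Q x y w"
    if "x \<noteq> 1" "y \<noteq> 1" "w \<noteq> 1" for x y w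
  proof -
    have "x ^ Suc c * mob x * (y ^ Suc c * mob y) * (w ^ Suc c * mob w) - x ^ Suc c * y ^ c * (w ^ c * mob w) =
        (x * y * w) ^ c * (x * mob x * (y * mob y) * (w * mob w) - x * mob w)"
      by (simp only: power_mult_distrib power_Suc right_diff_distrib ac_simps)
    also have "\<dots> = P x y w + Q x y w"
      unfolding three_body[OF that, folded mob_def] P_def Q_def by (rule split)
    finally show ?thesis .
  qed
  then have "peel3 z (\<lambda>x y w. x ^ Suc c * mob x * (y ^ Suc c * mob y) * (w ^ Suc c * mob w) -
      x ^ Suc c * y ^ c * (w ^ c * mob w)) \<phi> I = peel3 z (\<lambda>x y w. P x y w + Q x y w) \<phi> I"
    using assms by (intro peel3_cong) (simp add: admissible_def)
  also have "\<dots> = peel3 z P \<phi> I + peel3 z Q \<phi> I" by (simp add: peel3_add_fun)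
  also have "peel3 z P \<phi> I = 0"
    by (rule peel3_antisym_12[OF _ P]) (use assms in \<open>simp add: admissible_def\<close>)
  also have "peel3 z Q \<phi> I = 0"
    by (rule peel3_antisym_23[OF _ Q]) (use assms in \<open>simp add: admissible_def\<close>)
  finally show ?thesis by (simp add: peel3_diff_fun[symmetric])
qed

text \<open>Counterpart of \<open>interl_sum_eq_eq\<close>, term by term; what is dropped is the
  collision term of the first two-body identity.\<close>

lemma bethe_sum_eq_eq:
  fixes z :: "nat \<Rightarrow> 'a::field_char_0"
  assumes "admissible z I"
  shows "bethe_sum z (Suc c # Suc c # as) I =
    peel z (\<lambda>x. x ^ Suc c + x ^ Suc (Suc c)) (bethe_sum z (c # as)) I +
    peel2 z (\<lambda>x y. x ^ Suc (Suc c) * y ^ Suc c) (bethe_sum z as) I"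
proof -
  have "peel2 z (\<lambda>x y. x ^ Suc (Suc c) * mob x * (y ^ Suc (Suc c) * mob y)) (bethe_sum z as) I =
      peel2 z (\<lambda>x y. (x ^ Suc c + x ^ Suc (Suc c)) * (y ^ Suc c * mob y) + x ^ Suc (Suc c) * y ^ Suc c) (bethe_sum z as) I"
  proof (rule peel2_two_body[OF assms, of _ _ "Suc c"])
    fix x y :: 'a assume xy: "x \<noteq> 1" "y \<noteq> 1" "x \<noteq> y"
    have "x ^ Suc (Suc c) * mob x * (y ^ Suc (Suc c) * mob y) -
        ((x ^ Suc c + x ^ Suc (Suc c)) * (y ^ Suc c * mob y) + x ^ Suc (Suc c) * y ^ Suc c) =
        x ^ Suc c * y ^ Suc c * (x * mob x * (y * mob y) - (1 + x) * mob y - x)"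
      unfolding power_Suc2[of _ "Suc c"] by (simp only: ring_distribs ac_simps mult_1_left mult_1_right diff_diff_eq)
    then show "x ^ Suc (Suc c) * mob x * (y ^ Suc (Suc c) * mob y) -
        ((x ^ Suc c + x ^ Suc (Suc c)) * (y ^ Suc c * mob y) + x ^ Suc (Suc c) * y ^ Suc c) =
        x ^ Suc c * y ^ Suc c * ((1 + x * y) * (1 + x * y - x + y) / ((x - 1) * (y - 1)))"
      unfolding two_body(1)[OF xy, folded mob_def] .
  qed
  then show ?thesis
    unfolding bethe_sum_eq[OF assms] unfolding bethe_sum.simps(2)[of z c as]
    by (simp add: peel_add peel_peel peel2_add_fun[symmetric] add.assoc del: power_Suc)
qed

text \<open>Counterpart of \<open>interl_sum_triple\<close> and \<open>interl_sum_eq_eq_eq\<close>.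
  The terms ending in \<open>low z as\<close> are reduced by the second two-body identity, the one
  ending in \<open>bethe_sum z as\<close> by the three-body identity; both put the first two paths
  at the forced halves \<open>Suc c\<close> and \<open>c\<close>.\<close>

lemma bethe_sum_eq_eq_eq:
  fixes z :: "nat \<Rightarrow> 'a::field_char_0"
  assumes "admissible z I"
  shows "bethe_sum z (c # c # c # as) I = peel2 z (\<lambda>x y. x ^ Suc c * y ^ c) (low z as) I
     + peel3 z (\<lambda>x y w. x ^ Suc c * y ^ c * (w ^ c * mob w)) (bethe_sum z as) I"
proof -
  have fin: "finite I" using assms by (simp add: admissible_def)
  have low: "low z (c # as) (I - {k}) = peel z (\<lambda>x. - (x ^ c * mob x)) (low z as) (I - {k})" for k
    using fin by (simp add: low_Cons)
  have 1: "low z (c # c # as) I = peel2 z (\<lambda>x y. x ^ c * mob x * (y ^ c * mob y)) (low z as) I"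
  proof -
    have "low z (c # c # as) I = peel z (\<lambda>x. - (x ^ c * mob x)) (peel z (\<lambda>x. - (x ^ c * mob x)) (low z as)) I"
      unfolding low_Cons[OF fin, of z c "c # as"] by (rule peel_cong) (simp_all add: low)
    then show ?thesis by (simp add: peel_peel)
  qed
  have 2: "peel z (\<lambda>x. x ^ Suc c * mob x) (low z (c # as)) I =
      peel2 z (\<lambda>x y. - (x ^ Suc c * mob x * (y ^ c * mob y))) (low z as) I"
  proof -
    have "peel z (\<lambda>x. x ^ Suc c * mob x) (low z (c # as)) I =
        peel z (\<lambda>x. x ^ Suc c * mob x) (peel z (\<lambda>x. - (x ^ c * mob x)) (low z as)) I"
      by (rule peel_cong) (simp_all add: low)
    then show ?thesis by (simp add: peel_peel del: power_Suc)
  qed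
  have "peel2 z (\<lambda>x y. x ^ c * mob x * (y ^ c * mob y) + - (x ^ Suc c * mob x * (y ^ c * mob y)) +
      x ^ Suc c * mob x * (y ^ Suc c * mob y)) (low z as) I = peel2 z (\<lambda>x y. x ^ Suc c * y ^ c) (low z as) I"
  proof (rule peel2_two_body[OF assms, of _ _ c])
    fix x y :: 'a assume xy: "x \<noteq> 1" "y \<noteq> 1" "x \<noteq> y"
    have "x ^ c * mob x * (y ^ c * mob y) + - (x ^ Suc c * mob x * (y ^ c * mob y)) +
        x ^ Suc c * mob x * (y ^ Suc c * mob y) - x ^ Suc c * y ^ c =
        x ^ c * y ^ c * (mob x * mob y * (1 - x + x * y) - x)"
      unfolding power_Suc2
      by (simp only: ring_distribs ac_simps mult_1_left mult_1_right mult_minus_left mult_minus_right diff_conv_add_uminus)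
    then show "x ^ c * mob x * (y ^ c * mob y) + - (x ^ Suc c * mob x * (y ^ c * mob y)) +
        x ^ Suc c * mob x * (y ^ Suc c * mob y) - x ^ Suc c * y ^ c =
        x ^ c * y ^ c * ((1 + x * y) * (1 + x * y - x + y) / ((x - 1) * (y - 1)))"
      unfolding two_body(2)[OF xy, folded mob_def] .
  qed
  then have "low z (c # c # as) I + peel z (\<lambda>x. x ^ Suc c * mob x) (low z (c # as)) I +
      peel2 z (\<lambda>x y. x ^ Suc c * mob x * (y ^ Suc c * mob y)) (low z as) I =
      peel2 z (\<lambda>x y. x ^ Suc c * y ^ c) (low z as) I"
    unfolding 1 2 peel2_add_fun .
  moreover have "peel z (\<lambda>x. x ^ Suc c * mob x) (bethe_sum z (c # c # as)) I =
      peel z (\<lambda>x. x ^ Suc c * mob x) (low z (c # as)) I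
      + peel2 z (\<lambda>x y. x ^ Suc c * mob x * (y ^ Suc c * mob y)) (low z as) I
      + peel3 z (\<lambda>x y w. x ^ Suc c * mob x * (y ^ Suc c * mob y) * (w ^ Suc c * mob w)) (bethe_sum z as) I"
    by (simp add: peel_add peel_peel peel2_add peel_peel2 mult.assoc del: power_Suc)
  ultimately show ?thesis
    unfolding peel3_three_body[OF assms] bethe_sum.simps(2)[of z c "c # c # as"] by (simp add: add_ac del: power_Suc)
qed

section \<open>The Bethe wave function summed over interlacing positions\<close>

fun tight :: "nat list \<Rightarrow> bool" where
  "tight (a # b # c # as) \<longleftrightarrow> b \<le> a \<and> c < a \<and> tight (b # c # as)"
| "tight [a, b] \<longleftrightarrow> b \<le> a"
| "tight _ \<longleftrightarrow> True"

text \<open>\<open>tight\<close> lists are weakly decreasing with no entry repeated more than twice. The induction also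
  meets lists whose first three entries coincide.\<close>

fun good :: "nat list \<Rightarrow> bool" where
  "good (a # b # c # d # as) \<longleftrightarrow> b \<le> a \<and> d < a \<and> tight (b # c # d # as)"
| "good (a # as) \<longleftrightarrow> tight as \<and> (as \<noteq> [] \<longrightarrow> hd as \<le> a)"
| "good [] \<longleftrightarrow> True"

lemma tight_imp_good: "tight as \<Longrightarrow> good as"
  by (cases as rule: good.cases) (auto elim: tight.elims)

lemma good_imp_tight_tl: "good (a # as) \<Longrightarrow> tight as"
  by (cases "a # as" rule: good.cases) auto

lemma interl_sum_peel:
  "interl_sum as (\<lambda>t. peel z g (F t) I) = peel z g (\<lambda>J. interl_sum as (\<lambda>t. F t J)) I"
  by (simp add: peel_def interl_sum_sum interl_sum_mult_left)

lemma interl_sum_peel2: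
  "interl_sum as (\<lambda>t. peel2 z g (F t) I) = peel2 z g (\<lambda>J. interl_sum as (\<lambda>t. F t J)) I"
  by (simp add: peel2_def interl_sum_sum interl_sum_mult_left interl_sum_peel)

text \<open>Both sides obey the same recursions: the first bound is lowered to the second, and for
  equal bounds one or two paths are removed. The latter step replaces \<open>c\<close> by its
  predecessor, which may meet two equal entries behind it; this is why the induction needs
  \<open>good\<close> instead of \<open>tight\<close>.\<close>

theorem interl_sum_bethe:
  fixes z :: "nat \<Rightarrow> 'a::field_char_0"
  assumes "good as" "length as = Suc (card I)" "admissible z I"
  shows "interl_sum as (\<lambda>t. bethe z t I) = bethe_sum z as I"
  using assms
proof (induction "length as" arbitrary: as I rule: less_induct)
  case less
  have fin: "finite I" using less.prems by (simp add: admissible_def)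
  show ?case
  proof (cases as)
    case Nil
    then show ?thesis using less.prems by simp
  next
    case as: (Cons a as')
    show ?thesis
    proof (cases as')
      case Nil
      then have "I = {}" using less.prems fin as by simp
      then show ?thesis by (simp add: as Nil interl_sum_single low_def peel_def)
    next
      case as': (Cons c r)
      have tight: "tight (c # r)" using less.prems(1) good_imp_tight_tl unfolding as as' by blast
      have IH1: "interl_sum bs (\<lambda>t. bethe z t (I - {k})) = bethe_sum z bs (I - {k})"
        if "good bs" "length bs = Suc (length r)" "k \<in> I" for bs k
        by (rule less.hyps) (use that less.prems fin in \<open>auto simp: as as' intro: admissible_mono\<close>)
      have IH2: "interl_sum bs (\<lambda>t. bethe z t (I - {k} - {l})) = bethe_sum z bs (I - {k} - {l})"
        if "good bs" "length bs = length r" "k \<in> I" "l \<in> I" "k \<noteq> l" for bs k l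
      proof (rule less.hyps)
        have "Suc (card (I - {k})) = card I" by (rule card_Suc_Diff1[OF fin that(3)])
        moreover have "Suc (card (I - {k} - {l})) = card (I - {k})"
          by (rule card_Suc_Diff1) (use fin that in auto)
        ultimately show "length bs = Suc (card (I - {k} - {l}))"
          using that(2) less.prems(2) by (simp add: as as')
      qed (use that less.prems in \<open>auto simp: as as' intro: admissible_mono\<close>)
      have pre: "interl_sum bs (\<lambda>t. bethe z (b # t) I + bethe z (b' # t) I) =
          peel z (\<lambda>x. x ^ b + x ^ b') (bethe_sum z bs) I"
        if "good bs" "length bs = Suc (length r)" for b b' bs
        unfolding bethe.simps peel_add_fun interl_sum_peel
        by (rule peel_cong) (use IH1[OF that] in simp_all)
      have pre2: "interl_sum bs (\<lambda>t. bethe z (b # b' # t) I) = peel2 z (\<lambda>x y. x ^ b * y ^ b') (bethe_sum z bs) I"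
        if "good bs" "length bs = length r" for b b' bs
        unfolding bethe.simps peel_peel interl_sum_peel2
        by (rule peel2_cong) (use IH2[OF that] in simp_all)
      \<comment> \<open>Start of the induction on the first bound. The three recursions for equal
        bounds are distinguished by whether the next entry \<open>e\<close> equals \<open>c\<close>;
        by tightness the entry after that is smaller.\<close>
      have base: "interl_sum (c # c # r) (\<lambda>t. bethe z t I) = bethe_sum z (c # c # r) I"
      proof (cases r)
        case Nil
        then have "card I = 1" using less.prems(2) by (simp add: as as')
        then obtain k where "I = {k}" by (rule card_1_singletonE)
        then show ?thesis
          unfolding Nil bethe_sum_eq[OF less.prems(3)]
          by (simp add: interl_sum_pair peel_def peel2_def low_def algebra_simps)
      next
        case r: (Cons e r')
        have "e \<le> c" using tight by (cases r') (auto simp: r)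
        show ?thesis
        proof (cases "e = c")
          case False
          with \<open>e \<le> c\<close> obtain c' where c: "c = Suc c'" "e \<le> c'" by (cases c) auto
          have tr: "tight (e # r')" using tight by (cases r') (auto simp: r)
          have g: "good (c' # e # r')"
            using tight c by (cases "c' # e # r'" rule: good.cases) (auto simp: r)
          have "interl_sum (c # c # r) (\<lambda>t. bethe z t I) =
              interl_sum (c' # e # r') (\<lambda>t. bethe z (c # t) I + bethe z (Suc c # t) I) +
              interl_sum (e # r') (\<lambda>t. bethe z (Suc c # c # t) I)"
            unfolding r c by (rule interl_sum_eq_eq[OF c(2)])
          also have "\<dots> = bethe_sum z (c # c # r) I"
          proof -
            have l: "length (c' # e # r') = Suc (length r)" "length (e # r') = length r" by (simp_all add: r)
            show ?thesis
              unfolding pre[OF g l(1)] pre2[OF tight_imp_good[OF tr] l(2)]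
              unfolding c(1) r bethe_sum_eq_eq[OF less.prems(3)] ..
          qed
          finally show ?thesis .
        next
          case True
          have two: "peel2 z (\<lambda>x y. x ^ Suc c * y ^ c) (low z []) I = bethe z [Suc c, c] I"
            if "r' = []"
          proof -
            have "I - {k} - {l} = {}" if "k \<in> I" "l \<in> I" "k \<noteq> l" for k l
            proof -
              have "card (I - {k} - {l}) = 0"
                using less.prems(2) that fin \<open>r' = []\<close> by (simp add: as as' r card_Diff_singleton_if)
              then show ?thesis using fin by simp
            qed
            then show ?thesis
              unfolding bethe.simps peel_peel
            proof (intro peel2_cong refl)
              fix k l assume "k \<in> I" "l \<in> I" "k \<noteq> l"
              then have "I - {k} - {l} = {}" by fact
              then show "low z [] (I - {k} - {l}) = 1" by (simp only: low_def) simp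
            qed
          qed
          show ?thesis
          proof (cases r')
            case Nil
            have "peel3 z (\<lambda>x y w. x ^ Suc c * y ^ c * (w ^ c * mob w)) (\<lambda>I. 0) I = 0"
              by (simp add: peel3_def peel2_def peel_def)
            then show ?thesis
              unfolding r Nil True interl_sum_triple bethe_sum_eq_eq_eq[OF less.prems(3)] two[OF Nil] bethe_sum.simps(1)
              by simp
          next
            case r': (Cons d r'')
            have d: "d < c" "tight (c # d # r'')" using tight by (auto simp: r r' True)
            then obtain c' where c: "c = Suc c'" "d \<le> c'" by (cases c) auto
            have g: "good (c' # d # r'')"
              using d c by (cases "c' # d # r''" rule: good.cases) auto
            have "interl_sum (c # c # r) (\<lambda>t. bethe z t I) = interl_sum (c' # d # r'') (\<lambda>t. bethe z (Suc c # c # t) I)"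
              unfolding r r' True c by (rule interl_sum_eq_eq_eq[OF c(2)])
            also have "\<dots> = peel2 z (\<lambda>x y. x ^ Suc c * y ^ c) (bethe_sum z (c' # d # r'')) I"
              by (rule pre2[OF g]) (simp add: r r')
            also have "\<dots> = bethe_sum z (c # c # r) I"
              unfolding r r' True bethe_sum_eq_eq_eq[OF less.prems(3)]
              by (simp add: c peel2_add peel2_peel mult.assoc del: power_Suc)
            finally show ?thesis .
          qed
        qed
      qed
      have "c \<le> a" using less.prems(1) by (cases "a # c # r" rule: good.cases) (auto simp: as as')
      then have "interl_sum (a # c # r) (\<lambda>t. bethe z t I) = bethe_sum z (a # c # r) I"
      proof (induction a rule: dec_induct)
        case (step n)
        have "interl_sum (Suc n # c # r) (\<lambda>t. bethe z t I) = bethe_sum z (n # c # r) I +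
            peel z (\<lambda>x. x ^ Suc n + x ^ Suc (Suc n)) (bethe_sum z (c # r)) I"
          unfolding interl_sum_Suc[OF step.hyps(1)] step.IH by (simp only: pre[OF tight_imp_good[OF tight]] list.size add_0_right add_Suc_right)
        also have "\<dots> = bethe_sum z (Suc n # c # r) I"
          unfolding bethe_sum_Suc_diff[OF less.prems(3), symmetric] by simp
        finally show ?case .
      qed (rule base)
      then show ?thesis by (simp add: as as')
    qed
  qed
qed

text \<open>A variable peeled after the variable with value 1 contributes
  \<open>scat u 1 = 2 / (1 - u)\<close>, one peeled before it
  \<open>scat 1 u = 2 * u / (u - 1)\<close>. The factor \<open>u + 1\<close> turns these into twice
  the lower factor \<open>- mob u\<close> and twice the upper factor
  \<open>u * mob u\<close>.\<close>

lemma prod_scat_one: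
  assumes "admissible z I"
  shows "(\<Prod>i\<in>I. z i + 1) * (\<Prod>i\<in>I. scat (z i) 1) = 2 ^ card I * (\<Prod>i\<in>I. - mob (z i))"
proof -
  have "(z i + 1) * scat (z i) 1 = 2 * - mob (z i)" if "i \<in> I" for i
  proof -
    have "z i \<noteq> 1" using assms that by (simp add: admissible_def)
    then show ?thesis by (simp add: scat_def mob_def divide_simps) (simp add: algebra_simps)
  qed
  then have "(\<Prod>i\<in>I. (z i + 1) * scat (z i) 1) = (\<Prod>i\<in>I. 2 * - mob (z i))" by (rule prod.cong[OF refl])
  then show ?thesis by (simp only: prod.distrib prod_constant)
qed

text \<open>One more variable with value 1 produces exactly the boundary terms of \<open>bethe_sum\<close>, so summation over
  the interlacing positions amounts to adding a variable at the homogeneous point.\<close>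

lemma bethe_insert_one:
  assumes "admissible z I" "z j = 1" "j \<notin> I" "length as = Suc (card I)"
  shows "(\<Prod>i\<in>I. z i + 1) * bethe z as (insert j I) = 2 ^ card I * bethe_sum z as I"
  using assms
proof (induction as arbitrary: I)
  case (Cons a as)
  have fin: "finite I" using Cons.prems by (simp add: admissible_def)
  have wt_j: "scat_weight z (insert j I) j = (\<Prod>i\<in>I. scat (z i) 1)"
    using Cons.prems by (simp add: scat_weight_def)
  have summand: "(\<Prod>i\<in>I. z i + 1) * (z k ^ a * scat_weight z (insert j I) k * bethe z as (insert j I - {k})) =
      2 ^ card I * (z k ^ Suc a * mob (z k) * scat_weight z I k * bethe_sum z as (I - {k}))" if k: "k \<in> I" for k
  proof -
    have k': "z k \<noteq> 1" "k \<noteq> j" using Cons.prems k by (auto simp: admissible_def)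
    have ins: "insert j I - {k} = insert j (I - {k})" using k' by auto
    have scat_weight: "scat_weight z (insert j I) k = scat 1 (z k) * scat_weight z I k"
      using Cons.prems fin by (simp add: scat_weight_def ins)
    have pr: "(\<Prod>i\<in>I. z i + 1) = (z k + 1) * (\<Prod>i\<in>I - {k}. z i + 1)"
      by (rule prod.remove[OF fin k])
    have dilate: "(z k + 1) * scat 1 (z k) = 2 * (z k * mob (z k))"
      using k' by (simp add: scat_def mob_def)
    have card: "Suc (card (I - {k})) = card I" by (rule card_Suc_Diff1[OF fin k])
    have IH: "(\<Prod>i\<in>I - {k}. z i + 1) * bethe z as (insert j (I - {k})) = 2 ^ card (I - {k}) * bethe_sum z as (I - {k})"
    proof (rule Cons.IH)
      show "admissible z (I - {k})" by (rule admissible_mono[OF Cons.prems(1)]) auto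
      show "length as = Suc (card (I - {k}))" using Cons.prems card by simp
    qed (use Cons.prems in auto)
    have "(\<Prod>i\<in>I. z i + 1) * (z k ^ a * scat_weight z (insert j I) k * bethe z as (insert j I - {k})) =
        z k ^ a * ((z k + 1) * scat 1 (z k)) * scat_weight z I k *
        ((\<Prod>i\<in>I - {k}. z i + 1) * bethe z as (insert j (I - {k})))"
      unfolding ins scat_weight pr by (simp only: mult_ac)
    also have "\<dots> = 2 ^ Suc (card (I - {k})) * (z k ^ Suc a * mob (z k) * scat_weight z I k * bethe_sum z as (I - {k}))"
      unfolding IH dilate by (simp add: mult_ac)
    finally show ?thesis unfolding card .
  qed
  have "(\<Prod>i\<in>I. z i + 1) * bethe z (a # as) (insert j I) =
      (\<Prod>i\<in>I. z i + 1) * (scat_weight z (insert j I) j * bethe z as I) +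
      (\<Sum>k\<in>I. (\<Prod>i\<in>I. z i + 1) * (z k ^ a * scat_weight z (insert j I) k * bethe z as (insert j I - {k})))"
    using fin Cons.prems by (simp add: peel_def distrib_left sum_distrib_left)
  also have "(\<Prod>i\<in>I. z i + 1) * (scat_weight z (insert j I) j * bethe z as I) = 2 ^ card I * low z as I"
    unfolding wt_j low_def mult.assoc[symmetric] prod_scat_one[OF Cons.prems(1)] ..
  also have "(\<Sum>k\<in>I. (\<Prod>i\<in>I. z i + 1) * (z k ^ a * scat_weight z (insert j I) k * bethe z as (insert j I - {k}))) =
      2 ^ card I * peel z (\<lambda>x. x ^ Suc a * mob x) (bethe_sum z as) I"
    unfolding peel_def sum_distrib_left by (rule sum.cong[OF refl summand])
  finally show ?case by (simp add: distrib_left del: power_Suc)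
qed simp

corollary interl_sum_bethe_insert:
  fixes z :: "nat \<Rightarrow> 'a::field_char_0"
  assumes "good as" "length as = Suc (card I)" "admissible z I" "z j = 1" "j \<notin> I"
  shows "2 ^ card I * interl_sum as (\<lambda>t. bethe z t I) = (\<Prod>i\<in>I. z i + 1) * bethe z as (insert j I)"
  using assms by (simp add: interl_sum_bethe bethe_insert_one)

section \<open>The Bethe sum as a ratio of determinants\<close>

text \<open>The quotient of \<open>det (h\<^sub>j (x\<^sub>k))\<close> by the Vandermonde determinant in \<open>X\<close>, expanded along columns.\<close>

fun dd :: "(nat \<Rightarrow> 'a::field) \<Rightarrow> (nat \<Rightarrow> 'a) list \<Rightarrow> nat set \<Rightarrow> 'a" where
  "dd X [] I = 1"
| "dd X (h # hs) I = (\<Sum>k\<in>I. h k / (\<Prod>i\<in>I - {k}. X k - X i) * dd X hs (I - {k}))"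

lemma dd_sum:
  assumes "finite L"
  shows "dd X ((\<lambda>k. \<Sum>l\<in>L. p l * h l k) # hs) I = (\<Sum>l\<in>L. p l * dd X (h l # hs) I)"
  by (simp add: sum_divide_distrib sum_distrib_right sum_distrib_left mult.assoc sum.swap[of _ L])

lemma dd_cong:
  assumes "\<And>k. k \<in> I \<Longrightarrow> h k = h' k"
  shows "dd X (h # hs) I = dd X (h' # hs) I"
  unfolding dd.simps by (rule sum.cong[OF refl]) (simp only: assms)

text \<open>Alternation of the determinant: after two expansion steps the denominator is symmetric
  in the chosen points except for the factor \<open>X k - X l\<close>.\<close>

lemma dd_swap:
  assumes "finite I"
  shows "dd X (g # h # hs) I + dd X (h # g # hs) I = (0::'a::field_char_0)"
proof -
  define D where "D k = (\<Prod>i\<in>I - {k}. X k - X i)" for k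
  have D: "D k * (\<Prod>i\<in>I - {k} - {l}. X l - X i) = (X k - X l) * (\<Prod>i\<in>I - {k, l}. (X k - X i) * (X l - X i))"
    if "k \<in> I" "l \<in> I" "k \<noteq> l" for k l
  proof -
    have "D k = (X k - X l) * (\<Prod>i\<in>I - {k} - {l}. X k - X i)"
      unfolding D_def by (rule prod.remove) (use assms that in auto)
    moreover have "I - {k} - {l} = I - {k, l}" by auto
    ultimately show ?thesis by (simp add: prod.distrib)
  qed
  define F where "F g h k l = g k * h l * dd X hs (I - {k, l}) / ((X k - X l) * (\<Prod>i\<in>I - {k, l}. (X k - X i) * (X l - X i)))"
    for g h :: "nat \<Rightarrow> 'a" and k l
  have dd: "dd X (g # h # hs) I = (\<Sum>k\<in>I. \<Sum>l\<in>I - {k}. F g h k l)" for g h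
    unfolding dd.simps(2)[of X g] dd.simps(2)[of X h] sum_distrib_left
  proof (intro sum.cong refl)
    fix k l assume kl: "k \<in> I" "l \<in> I - {k}"
    have "I - {k} - {l} = I - {k, l}" by auto
    then have "g k / D k * (h l / (\<Prod>i\<in>I - {k} - {l}. X l - X i) * dd X hs (I - {k} - {l})) =
        g k * h l * dd X hs (I - {k, l}) / (D k * (\<Prod>i\<in>I - {k} - {l}. X l - X i))" by simp
    also have "\<dots> = F g h k l" using kl by (subst D) (auto simp: F_def)
    finally show "g k / (\<Prod>i\<in>I - {k}. X k - X i) * (h l / (\<Prod>i\<in>I - {k} - {l}. X l - X i) * dd X hs (I - {k} - {l})) = F g h k l"
      by (simp add: D_def)
  qed
  have "F g h k l = - F h g l k" for k l
  proof -
    have "(X k - X l) * (\<Prod>i\<in>I - {k, l}. (X k - X i) * (X l - X i)) =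
        - ((X l - X k) * (\<Prod>i\<in>I - {l, k}. (X l - X i) * (X k - X i)))"
      by (simp add: insert_commute[of l] mult.commute[of "X l - X _"] algebra_simps)
    then show ?thesis by (simp add: F_def insert_commute[of l] mult.commute[of "h l"])
  qed
  then have "(\<Sum>k\<in>I. \<Sum>l\<in>I - {k}. F g h k l + F h g k l) = 0"
    by (intro sum_antisym_pairs assms) (simp add: add.commute)
  then show ?thesis unfolding dd by (simp add: sum.distrib)
qed

text \<open>Swaps move \<open>h\<close> up to its copy; there the expression equals its own
  negative, hence is 0 in characteristic 0.\<close>

lemma dd_mem:
  fixes X :: "nat \<Rightarrow> 'a::field_char_0"
  assumes "finite I" "h \<in> set hs"
  shows "dd X (h # hs) I = 0"
  using assms
proof (induction hs arbitrary: I)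
  case (Cons g hs)
  show ?case
  proof (cases "g = h")
    case True
    then show ?thesis using dd_swap[OF Cons.prems(1), of X h h hs] by (simp add: mult_2[symmetric] del: dd.simps)
  next
    case False
    then have "dd X (h # hs) (I - {k}) = 0" for k using Cons by auto
    then have "dd X (g # h # hs) I = 0" by simp
    then show ?thesis using dd_swap[OF Cons.prems(1), of X g h hs] by simp
  qed
qed simp

section \<open>Collapse of the Bethe sum to a determinant\<close>

definition hsym :: "nat \<Rightarrow> 'a::comm_ring_1 \<Rightarrow> 'a \<Rightarrow> 'a" where
  "hsym l a b = (\<Sum>i\<le>l. a ^ i * b ^ (l - i))"

lemma hsym_0: "hsym 0 a b = 1" by (simp add: hsym_def)

lemma hsym_Suc: "hsym (Suc l) a b = a ^ Suc l + b * hsym l a b"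
proof -
  have "(\<Sum>i\<le>l. a ^ i * b ^ (Suc l - i)) = b * hsym l a b"
    unfolding hsym_def sum_distrib_left by (rule sum.cong) (auto simp: Suc_diff_le)
  then show ?thesis by (simp add: hsym_def[of "Suc l"])
qed

text \<open>Summation by parts with \<open>a ^ Suc l = hsym (Suc l) a b - b * hsym l a b\<close>. It
  is used with \<open>c (Suc m) = 0\<close>, where it expands a polynomial value in the
  \<open>hsym l a b\<close>.\<close>

lemma sum_hsym:
  "(\<Sum>l\<le>m. (c l - b * c (Suc l)) * hsym l a b) = (\<Sum>l\<le>m. c l * a ^ l) - b * c (Suc m) * hsym m a b"
  by (induction m) (simp_all add: hsym_0 hsym_Suc algebra_simps)

definition fr :: "'a::field \<Rightarrow> 'a" where "fr x = x * (1 + x) / (1 - x)"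

text \<open>Since \<open>hsym\<close> is symmetric, \<open>lam l\<close> is even in
  \<open>x\<close>; this is what permits a limit in the variables \<open>x^2\<close>.\<close>

definition lam :: "nat \<Rightarrow> 'a::field \<Rightarrow> 'a" where
  "lam l x = hsym l (fr x) (fr (- x)) / (1 - x^2)"

definition cayley :: "'a::field \<Rightarrow> 'a" where "cayley x = (1 + x) / (1 - x)"

text \<open>The right-hand side is \<open>scat x y\<close>: the Cayley transform leaves the
  scattering factor invariant and moves the homogeneous point from 1 to 0.\<close>

lemma scat_cayley:
  fixes x y :: "'a::field_char_0"
  assumes "x \<noteq> 1" "y \<noteq> 1" "x \<noteq> y"
  shows "scat (cayley x) (cayley y) = (1 + x * y - x + y) / (y - x)"
proof -
  have nz: "1 - x \<noteq> 0" "1 - y \<noteq> 0" "y - x \<noteq> 0" using assms by auto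
  have "cayley y - cayley x = 2 * (y - x) / ((1 - x) * (1 - y))"
    using nz by (simp add: cayley_def divide_simps) (simp add: algebra_simps)
  moreover have "1 + cayley x * cayley y - cayley x + cayley y = 2 * (1 + x * y - x + y) / ((1 - x) * (1 - y))"
    using nz by (simp add: cayley_def divide_simps) (simp add: algebra_simps)
  moreover have "2 * A / D / (2 * B / D) = A / B" if "D \<noteq> 0" for A B D :: 'a
    using that by simp
  ultimately show ?thesis using nz by (simp only: scat_def mult_eq_0_iff de_Morgan_disj simp_thms)
qed

text \<open>The second factor of the numerator is linear in \<open>fr y\<close> with the root \<open>fr (- x)\<close>. This makes the
  Bethe sum collapse to a determinant.\<close>

lemma scat_cayley_sq:
  fixes x y :: "'a::field_char_0"
  assumes "x \<noteq> 1" "y \<noteq> 1" "x^2 \<noteq> y^2"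
  shows "scat (cayley x) (cayley y) = (1 - y) * ((1 + x) * fr y + x * (1 - x)) / (y^2 - x^2)"
proof -
  have nz: "1 - x \<noteq> 0" "1 - y \<noteq> 0" "y - x \<noteq> 0" "y + x \<noteq> 0"
    using assms by (auto simp: add_eq_0_iff2)
  have "scat (cayley x) (cayley y) = (1 + x * y - x + y) / (y - x)" by (rule scat_cayley) (use assms in auto)
  also have "\<dots> = (1 + x * y - x + y) * (y + x) / ((y - x) * (y + x))" using nz by simp
  also have "(y - x) * (y + x) = y^2 - x^2" by (simp add: power2_eq_square algebra_simps)
  also have "(1 + x * y - x + y) * (y + x) = (1 - y) * ((1 + x) * fr y + x * (1 - x))"
    using nz by (simp add: fr_def divide_simps) (simp add: algebra_simps)
  finally show ?thesis .
qed

lemma coeff_prod_linear: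
  fixes a b :: "nat \<Rightarrow> 'a::comm_ring_1"
  assumes "finite I"
  shows "coeff (\<Prod>i\<in>I. [:a i, b i:]) (card I) = (\<Prod>i\<in>I. b i)"
    and "\<And>n. n > card I \<Longrightarrow> coeff (\<Prod>i\<in>I. [:a i, b i:]) n = 0"
proof -
  have "coeff (\<Prod>i\<in>I. [:a i, b i:]) (card I) = (\<Prod>i\<in>I. b i) \<and> (\<forall>n>card I. coeff (\<Prod>i\<in>I. [:a i, b i:]) n = 0)"
    using assms by (induction I rule: finite_induct) (auto simp: coeff_pCons split: nat.splits)
  then show "coeff (\<Prod>i\<in>I. [:a i, b i:]) (card I) = (\<Prod>i\<in>I. b i)"
    and "\<And>n. n > card I \<Longrightarrow> coeff (\<Prod>i\<in>I. [:a i, b i:]) n = 0" by auto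
qed

text \<open>The product on the left lacks the factor at \<open>k\<close>. Multiplication by this
  factor, which has the root \<open>fr (- x k)\<close>, yields a polynomial over all of
  \<open>I\<close> and acts on the coefficients exactly as in \<open>sum_hsym\<close>. So the
  coefficients of the expansion in \<open>lam\<close> do not depend on \<open>k\<close>.\<close>

lemma prod_linear_lam:
  fixes x :: "nat \<Rightarrow> 'a::field_char_0"
  assumes "finite I" "k \<in> I" "card I = Suc m" "x k \<noteq> 1" "x k \<noteq> - 1"
  shows "(\<Prod>i\<in>I - {k}. (1 + x i) * fr (x k) + x i * (1 - x i)) / (1 - x k) =
    (\<Sum>l\<le>m. coeff (\<Prod>i\<in>I. [:x i * (1 - x i), 1 + x i:]) (Suc l) * lam l (x k))"
proof -
  define P where "P = (\<Prod>i\<in>I - {k}. [:x i * (1 - x i), 1 + x i:])"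
  define f g where "f = fr (x k)" and "g = fr (- x k)"
  have nz: "1 - x k \<noteq> 0" "1 + x k \<noteq> 0" using assms by (auto simp: add_eq_0_iff)
  have xk: "x k * (1 - x k) = - ((1 + x k) * g)" using nz by (simp add: g_def fr_def)
  have "(\<Prod>i\<in>I. [:x i * (1 - x i), 1 + x i:]) = [:x k * (1 - x k), 1 + x k:] * P"
    unfolding P_def by (rule prod.remove[OF assms(1,2)])
  then have "coeff (\<Prod>i\<in>I. [:x i * (1 - x i), 1 + x i:]) (Suc l) =
      (1 + x k) * coeff P l + x k * (1 - x k) * coeff P (Suc l)" for l
    by (simp only: mult_pCons_left coeff_add coeff_smult coeff_pCons_Suc mult_zero_left add_0_right smult_0_left pCons_0_0 coeff_0 add_0_left add.commute)
  then have co: "coeff (\<Prod>i\<in>I. [:x i * (1 - x i), 1 + x i:]) (Suc l) = (1 + x k) * (coeff P l - g * coeff P (Suc l))" for l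
    unfolding xk by (simp add: algebra_simps)
  have deg: "degree P \<le> m"
    unfolding P_def by (intro degree_le allI impI coeff_prod_linear(2)) (use assms in simp_all)
  have "(\<Prod>i\<in>I - {k}. (1 + x i) * f + x i * (1 - x i)) = poly P f"
    unfolding P_def poly_prod by (simp add: algebra_simps)
  also have "\<dots> = (\<Sum>l\<le>m. coeff P l * f ^ l)"
    unfolding poly_altdef using deg by (intro sum.mono_neutral_left) (auto simp: coeff_eq_0)
  also have "\<dots> = (\<Sum>l\<le>m. (coeff P l - g * coeff P (Suc l)) * hsym l f g)"
    using deg by (simp add: sum_hsym coeff_eq_0)
  finally have "(\<Prod>i\<in>I - {k}. (1 + x i) * f + x i * (1 - x i)) / (1 - x k) =
      (\<Sum>l\<le>m. (coeff P l - g * coeff P (Suc l)) * hsym l f g / (1 - x k))"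
    by (simp add: sum_divide_distrib)
  also have "\<dots> = (\<Sum>l\<le>m. (1 + x k) * (coeff P l - g * coeff P (Suc l)) * lam l (x k))"
  proof (rule sum.cong[OF refl])
    fix l
    have "1 - (x k)^2 = (1 - x k) * (1 + x k)" by (simp add: power2_eq_square algebra_simps)
    then show "(coeff P l - g * coeff P (Suc l)) * hsym l f g / (1 - x k) =
        (1 + x k) * (coeff P l - g * coeff P (Suc l)) * lam l (x k)"
      using nz by (simp add: lam_def f_def g_def)
  qed
  finally show ?thesis by (simp add: co f_def)
qed

text \<open>The exponents \<open>n - 1, ..., 0\<close> matter: in peeling exponent \<open>m\<close>
  from \<open>m + 1\<close> variables, \<open>cayley (x k) ^ m\<close> cancels all but one of the
  factors \<open>1 - x k\<close> from the scattering weight. The rest is a combination of the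
  \<open>lam l\<close> with coefficients common to all \<open>k\<close>, to which linearity of
  \<open>dd\<close> applies.\<close>

theorem bethe_eq_dd:
  fixes x :: "nat \<Rightarrow> 'a::field_char_0"
  assumes "finite I" "card I = n" "inj_on (\<lambda>i. (x i)^2) I" "\<And>i. i \<in> I \<Longrightarrow> x i \<noteq> 1 \<and> x i \<noteq> - 1"
  shows "bethe (\<lambda>i. cayley (x i)) (rev [0..<n]) I =
    (\<Prod>i\<in>I. (1 - x i) * (1 + x i) ^ n) * dd (\<lambda>i. (x i)^2) (map (\<lambda>l i. lam l (x i)) (rev [0..<n])) I"
  using assms
proof (induction n arbitrary: I)
  case (Suc m)
  let ?hs = "map (\<lambda>l i. lam l (x i)) (rev [0..<m])"
  let ?p = "coeff (\<Prod>i\<in>I. [:x i * (1 - x i), 1 + x i:])"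
  let ?C = "\<Prod>i\<in>I. (1 - x i) * (1 + x i) ^ m"
  define v where "v k = (\<Prod>i\<in>I - {k}. (1 + x i) * fr (x k) + x i * (1 - x i)) / (1 - x k)" for k
  have v: "v k = (\<Sum>l\<in>{..m}. ?p (Suc l) * lam l (x k))" if "k \<in> I" for k
    unfolding v_def by (rule prod_linear_lam) (use Suc.prems that in auto)
  have summand: "cayley (x k) ^ m * scat_weight (\<lambda>i. cayley (x i)) I k * bethe (\<lambda>i. cayley (x i)) (rev [0..<m]) (I - {k}) =
      ?C * (v k / (\<Prod>i\<in>I - {k}. (x k)^2 - (x i)^2) * dd (\<lambda>i. (x i)^2) ?hs (I - {k}))" if k: "k \<in> I" for k
  proof -
    have nz: "1 - x k \<noteq> 0" "1 + x k \<noteq> 0" using Suc.prems(4)[OF k] by (auto simp: add_eq_0_iff)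
    have card: "card (I - {k}) = m" using Suc.prems k by simp
    have "scat_weight (\<lambda>i. cayley (x i)) I k =
        (\<Prod>i\<in>I - {k}. (1 - x k) * ((1 + x i) * fr (x k) + x i * (1 - x i)) / ((x k)^2 - (x i)^2))"
      unfolding scat_weight_def
      by (intro prod.cong refl scat_cayley_sq) (use Suc.prems k in \<open>auto simp: inj_on_def\<close>)
    also have "\<dots> = (1 - x k) ^ Suc m * v k / (\<Prod>i\<in>I - {k}. (x k)^2 - (x i)^2)"
      using nz by (simp add: prod_dividef prod.distrib card v_def)
    finally have scat_weight: "scat_weight (\<lambda>i. cayley (x i)) I k = (1 - x k) ^ Suc m * v k / (\<Prod>i\<in>I - {k}. (x k)^2 - (x i)^2)" .
    have IH: "bethe (\<lambda>i. cayley (x i)) (rev [0..<m]) (I - {k}) =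
        (\<Prod>i\<in>I - {k}. (1 - x i) * (1 + x i) ^ m) * dd (\<lambda>i. (x i)^2) ?hs (I - {k})"
      by (rule Suc.IH) (use Suc.prems k in \<open>auto intro: inj_on_subset\<close>)
    have C: "?C = ((1 - x k) * (1 + x k) ^ m) * (\<Prod>i\<in>I - {k}. (1 - x i) * (1 + x i) ^ m)"
      by (rule prod.remove) (use Suc.prems k in auto)
    have "cayley (x k) ^ m * (1 - x k) ^ Suc m = (1 - x k) * (1 + x k) ^ m"
      using nz by (simp add: cayley_def power_divide)
    then show ?thesis unfolding scat_weight IH C by (simp add: mult_ac del: power_Suc)
  qed
  have "bethe (\<lambda>i. cayley (x i)) (rev [0..<Suc m]) I = ?C * dd (\<lambda>i. (x i)^2) (v # ?hs) I"
    unfolding upt_Suc_append[OF le0] rev_append rev.simps append_Nil append_Cons bethe.simps peel_def dd.simps(2) sum_distrib_left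
    by (rule sum.cong[OF refl]) (simp only: summand)
  also have "dd (\<lambda>i. (x i)^2) (v # ?hs) I = dd (\<lambda>i. (x i)^2) ((\<lambda>k. \<Sum>l\<in>{..m}. ?p (Suc l) * lam l (x k)) # ?hs) I"
    by (rule dd_cong) (rule v)
  also have "\<dots> = (\<Sum>l\<in>{..m}. ?p (Suc l) * dd (\<lambda>i. (x i)^2) ((\<lambda>k. lam l (x k)) # ?hs) I)"
    by (rule dd_sum) simp
  \<comment> \<open>For \<open>l < m\<close> the function \<open>lam l\<close> occurs again in
    \<open>?hs\<close>, so that only the leading coefficient of the polynomial survives.\<close>
  also have "\<dots> = (\<Sum>l\<in>{m}. ?p (Suc l) * dd (\<lambda>i. (x i)^2) ((\<lambda>k. lam l (x k)) # ?hs) I)"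
  proof (rule sum.mono_neutral_right)
    show "\<forall>l\<in>{..m} - {m}. ?p (Suc l) * dd (\<lambda>i. (x i)^2) ((\<lambda>k. lam l (x k)) # ?hs) I = 0"
      using Suc.prems(1) by (auto intro!: disjI2 dd_mem simp del: dd.simps)
  qed auto
  also have "\<dots> = (\<Prod>i\<in>I. 1 + x i) * dd (\<lambda>i. (x i)^2) ((\<lambda>k. lam m (x k)) # ?hs) I"
    using coeff_prod_linear(1)[OF Suc.prems(1), of "\<lambda>i. x i * (1 - x i)" "\<lambda>i. 1 + x i"] Suc.prems(2)
    by (simp del: dd.simps)
  finally show ?case
    by (simp add: prod.distrib mult_ac power_Suc2 del: dd.simps power_Suc)
qed simp

section \<open>Vandermonde determinants\<close>

fun vand :: "(nat \<Rightarrow> 'a::comm_ring_1) \<Rightarrow> nat list \<Rightarrow> 'a" where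
  "vand X [] = 1"
| "vand X (i # js) = (\<Prod>j\<in>set js. X j - X i) * vand X js"

text \<open>The sign counts the entries behind position \<open>a\<close>, whose differences with
  \<open>js ! a\<close> are oriented the other way in \<open>vand\<close>.\<close>

lemma vand_remove:
  assumes "distinct js" "a < length js"
  shows "vand X js = (- 1) ^ (length js - Suc a) * (\<Prod>i\<in>set js - {js ! a}. X (js ! a) - X i) *
    vand X (take a js @ drop (Suc a) js)"
  using assms
proof (induction js arbitrary: a)
  case (Cons i js)
  show ?case
  proof (cases a)
    case 0
    have "(\<Prod>j\<in>set js. X j - X i) = (\<Prod>j\<in>set js. - 1 * (X i - X j))" by (rule prod.cong) auto
    also have "\<dots> = (- 1) ^ length js * (\<Prod>j\<in>set js. X i - X j)"
      using Cons.prems by (simp only: prod.distrib prod_constant distinct_card distinct.simps)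
    finally show ?thesis using Cons.prems 0 by simp
  next
    case (Suc b)
    define k where "k = js ! b"
    have b: "b < length js" "distinct js" "i \<notin> set js" using Cons.prems Suc by auto
    have k: "k \<in> set js" using b by (simp add: k_def)
    have set: "set (take b js @ drop (Suc b) js) = set js - {k}"
    proof -
      have d: "distinct (take b js @ k # drop (Suc b) js)" and s: "take b js @ k # drop (Suc b) js = js"
        using b id_take_nth_drop[of b js] by (simp_all add: k_def)
      have "set (take b js @ k # drop (Suc b) js) = insert k (set (take b js @ drop (Suc b) js))" by simp
      moreover have "k \<notin> set (take b js @ drop (Suc b) js)" using d by simp
      ultimately show ?thesis unfolding s by auto
    qed
    have 1: "(\<Prod>j\<in>set js. X j - X i) = (X k - X i) * (\<Prod>j\<in>set js - {k}. X j - X i)"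
      by (rule prod.remove) (use k in auto)
    have "set (i # js) - {k} = insert i (set js - {k})" using b k by auto
    then have 2: "(\<Prod>j\<in>set (i # js) - {k}. X k - X j) = (X k - X i) * (\<Prod>j\<in>set js - {k}. X k - X j)"
      using b by simp
    have tk: "take a (i # js) @ drop (Suc a) (i # js) = i # (take b js @ drop (Suc b) js)"
      "length (i # js) - Suc a = length js - Suc b" "(i # js) ! a = k"
      using Suc by (simp_all add: k_def)
    have "vand X (i # js) = (X k - X i) * (\<Prod>j\<in>set js - {k}. X j - X i) *
        ((- 1) ^ (length js - Suc b) * (\<Prod>j\<in>set js - {k}. X k - X j) * vand X (take b js @ drop (Suc b) js))"
      unfolding vand.simps 1 Cons.IH[OF b(2,1), folded k_def] ..
    then show ?thesis
      unfolding tk 2 vand.simps set by (simp only: mult_ac)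
  qed
qed simp

text \<open>Laplace expansion along the last column, where \<open>rev\<close> puts the head of
  \<open>hs\<close>. The cofactor signs are those of \<open>vand_remove\<close>.\<close>

lemma det_eq_dd_vand:
  fixes X :: "nat \<Rightarrow> 'a::field"
  assumes "distinct js" "length hs = length js" "inj_on X (set js)"
  shows "det (mat (length js) (length js) (\<lambda>(a, b). (rev hs ! b) (js ! a))) = dd X hs (set js) * vand X js"
  using assms
proof (induction hs arbitrary: js)
  case Nil
  then show ?case by (simp add: det_dim_zero)
next
  case (Cons h hs)
  define m where "m = length hs"
  have len: "length js = Suc m" using Cons.prems by (simp add: m_def)
  let ?A = "mat (Suc m) (Suc m) (\<lambda>(a, b). (rev (h # hs) ! b) (js ! a))"
  let ?js = "\<lambda>a. take a js @ drop (Suc a) js"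
  have rem: "distinct (?js a)" "set (?js a) = set js - {js ! a}" "length (?js a) = m" if "a < Suc m" for a
  proof -
    have d: "distinct (take a js @ js ! a # drop (Suc a) js)" and s: "take a js @ js ! a # drop (Suc a) js = js"
      using Cons.prems(1) id_take_nth_drop[of a js] that len by simp_all
    have "set (take a js @ js ! a # drop (Suc a) js) = insert (js ! a) (set (?js a))" by simp
    moreover have "js ! a \<notin> set (?js a)" using d by simp
    ultimately show "set (?js a) = set js - {js ! a}" unfolding s by auto
    show "distinct (?js a)" using d by simp
    show "length (?js a) = m" using that len by simp
  qed
  have cof: "cofactor ?A a m = (- 1) ^ (m - a) * (dd X hs (set js - {js ! a}) * vand X (?js a))" if a: "a < Suc m" for a
  proof -
    have "mat_delete ?A a m = mat m m (\<lambda>(i, b). (rev hs ! b) (?js a ! i))"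
      unfolding mat_delete_def
      by (rule eq_matI) (use a len in \<open>auto simp: nth_append m_def min_def\<close>)
    moreover have "det (mat m m (\<lambda>(i, b). (rev hs ! b) (?js a ! i))) = dd X hs (set js - {js ! a}) * vand X (?js a)"
    proof -
      have "inj_on X (set (?js a))" using Cons.prems(3) rem(2)[OF a] by (auto intro: inj_on_subset)
      then show ?thesis
        using Cons.IH[OF rem(1)[OF a]] rem[OF a] by (simp add: m_def)
    qed
    moreover have "(- 1 :: 'a) ^ (a + m) = (- 1) ^ (m - a)"
    proof -
      have "a + m = 2 * a + (m - a)" using a by simp
      then show ?thesis by (simp only: power_add power_mult) simp
    qed
    ultimately show ?thesis by (simp add: cofactor_def)
  qed
  have "det ?A = (\<Sum>a<Suc m. ?A $$ (a, m) * cofactor ?A a m)"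
    by (rule laplace_expansion_column) auto
  also have "\<dots> = (\<Sum>a<Suc m. h (js ! a) / (\<Prod>i\<in>set js - {js ! a}. X (js ! a) - X i) * dd X hs (set js - {js ! a}) * vand X js)"
  proof (rule sum.cong[OF refl])
    fix a assume "a \<in> {..<Suc m}"
    then have a: "a < Suc m" by simp
    have nz: "(\<Prod>i\<in>set js - {js ! a}. X (js ! a) - X i) \<noteq> 0"
      using Cons.prems(3) a len by (auto simp: inj_on_def)
    have v: "vand X js = (- 1) ^ (m - a) * (\<Prod>i\<in>set js - {js ! a}. X (js ! a) - X i) * vand X (?js a)"
      using vand_remove[OF Cons.prems(1), of a X] a len by simp
    have h: "?A $$ (a, m) = h (js ! a)" using a by (simp add: nth_append m_def)
    show "?A $$ (a, m) * cofactor ?A a m = h (js ! a) / (\<Prod>i\<in>set js - {js ! a}. X (js ! a) - X i) * dd X hs (set js - {js ! a}) * vand X js"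
      unfolding h cof[OF a] v using nz by (simp add: mult_ac)
  qed
  also have "\<dots> = dd X (h # hs) (set js) * vand X js"
  proof -
    have "bij_betw ((!) js) {..<Suc m} (set js)"
      by (rule bij_betw_nth) (use Cons.prems len in auto)
    then show ?thesis
      unfolding dd.simps sum_distrib_right by (rule sum.reindex_bij_betw)
  qed
  finally show ?case unfolding len .
qed

text \<open>Passing from powers to the monic polynomials \<open>p b\<close> is a unitriangular
  column operation and makes the matrix lower triangular. The argument avoids division, as the
  result is also applied in the ring \<open>mls\<close>.\<close>

lemma det_vandermonde:
  fixes x :: "nat \<Rightarrow> 'a::comm_ring_1"
  shows "det (mat n n (\<lambda>(a, b). x a ^ b)) = (\<Prod>b<n. \<Prod>c<b. x b - x c)"
proof -
  define p where "p b = (\<Prod>c<b. [:- x c, 1:])" for b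
  have p: "coeff (p b) b = 1" "\<And>m. m > b \<Longrightarrow> coeff (p b) m = 0" for b
    using coeff_prod_linear(1)[of "{..<b}" "\<lambda>c. - x c" "\<lambda>_. 1"]
      coeff_prod_linear(2)[of "{..<b}" _ "\<lambda>c. - x c" "\<lambda>_. 1"] by (simp_all add: p_def)
  let ?V = "mat n n (\<lambda>(a, b). x a ^ b)" and ?P = "mat n n (\<lambda>(a, b). poly (p b) (x a))"
  let ?C = "mat n n (\<lambda>(a, b). coeff (p b) a)"
  have "?P = ?V * ?C"
  proof (rule eq_matI)
    fix a b assume "a < dim_row (?V * ?C)" "b < dim_col (?V * ?C)"
    then have ab: "a < n" "b < n" by auto
    have "degree (p b) < n" using degree_le[of b "p b"] p(2)[of b] ab by auto
    then have "poly (p b) (x a) = (\<Sum>i\<in>{0..<n}. coeff (p b) i * x a ^ i)"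
      unfolding poly_altdef by (intro sum.mono_neutral_left) (auto intro: le_degree)
    then show "?P $$ (a, b) = (?V * ?C) $$ (a, b)"
      using ab by (simp add: scalar_prod_def mult.commute)
  qed auto
  then have "det ?P = det ?V * det ?C" by (simp add: det_mult[of _ n])
  moreover have "det ?C = 1"
  proof -
    have "upper_triangular ?C" by (auto simp: upper_triangular_def p)
    then have "det ?C = prod_list (diag_mat ?C)" by (rule det_upper_triangular[of _ n]) simp
    then show ?thesis by (simp add: prod_list_diag_prod p)
  qed
  moreover have "det ?P = (\<Prod>b<n. \<Prod>c<b. x b - x c)"
  proof -
    have poly: "poly (p b) (x a) = (\<Prod>c<b. x a - x c)" for a b by (simp add: p_def poly_prod)
    have "det ?P = prod_list (diag_mat ?P)"
      by (rule det_lower_triangular[of n]) (auto simp: poly intro!: prod_zero bexI)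
    then show ?thesis by (simp add: prod_list_diag_prod poly atLeast0LessThan)
  qed
  ultimately show ?thesis by simp
qed

lemma vand_eq_prod: "vand X js = (\<Prod>b<length js. \<Prod>c<b. X (js ! b) - X (js ! c))"
  if "distinct js"
  using that
proof (induction js)
  case (Cons i js)
  have "(\<Prod>b<length js. X (js ! b) - X i) = (\<Prod>j\<in>set js. X j - X i)"
    using Cons.prems by (intro prod.reindex_bij_betw bij_betw_nth) auto
  then show ?case
    using Cons by (simp add: prod.lessThan_Suc_shift prod.distrib del: prod.lessThan_Suc)
qed simp

section \<open>The homogeneous limit\<close>

lemma sum_ge_sum_lessThan:
  fixes S :: "nat set"
  assumes "finite S" "card S = n"
  shows "\<Sum>{..<n} \<le> \<Sum>S" and "\<Sum>S = \<Sum>{..<n} \<Longrightarrow> S = {..<n}"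
proof -
  have "\<Sum>{..<n} \<le> \<Sum>S \<and> (\<Sum>S = \<Sum>{..<n} \<longrightarrow> S = {..<n})"
    using assms
  proof (induction n arbitrary: S)
    case (Suc m)
    define M where "M = Max S"
    have M: "M \<in> S" using Suc.prems by (auto simp: M_def intro!: Max_in)
    have "S \<subseteq> {..M}" using Suc.prems by (auto simp: M_def)
    then have "card S \<le> card {..M}" by (intro card_mono) auto
    then have "m \<le> M" using Suc.prems by simp
    moreover have "\<Sum>S = M + \<Sum>(S - {M})" by (rule sum.remove) (use Suc.prems M in auto)
    moreover have "\<Sum>{..<m} \<le> \<Sum>(S - {M}) \<and> (\<Sum>(S - {M}) = \<Sum>{..<m} \<longrightarrow> S - {M} = {..<m})"
      by (rule Suc.IH) (use Suc.prems M in auto)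
    moreover have "S = {..<Suc m}" if "S - {M} = {..<m}" "M = m"
      using M that by (metis insert_Diff lessThan_Suc)
    moreover have "\<Sum>{..<Suc m} = m + \<Sum>{..<m}" by (simp add: lessThan_Suc)
    ultimately show ?case by linarith
  qed simp
  then show "\<Sum>{..<n} \<le> \<Sum>S" and "\<Sum>S = \<Sum>{..<n} \<Longrightarrow> S = {..<n}" by auto
qed

lemma fps_prod_nth_natpermute:
  fixes F :: "nat \<Rightarrow> 'a::comm_ring_1 fps"
  shows "(\<Prod>b<n. F b) $ m = (\<Sum>v\<in>natpermute m n. \<Prod>b<n. F b $ (v ! b))"
proof (cases n)
  case 0
  then show ?thesis by (simp add: natpermute_0)
next
  case (Suc n')
  have "{..<n} = {0..n'}" using Suc by auto
  then show ?thesis using fps_prod_nth[of F n' m] Suc by simp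
qed

definition dilate :: "'a::comm_ring_1 \<Rightarrow> 'a fps \<Rightarrow> 'a fps" where
  "dilate p C = C oo (fps_const p * fps_X)"

lemma dilate_nth [simp]: "dilate p C $ n = p ^ n * C $ n"
  by (simp add: dilate_def)

lemma det_mat_permute_cols:
  assumes "p permutes {0..<n}"
  shows "det (mat n n (\<lambda>(a, b). f a (p b))) = of_int (sign p) * det (mat n n (\<lambda>(a, b). f a b))"
proof -
  let ?B = "mat n n (\<lambda>(a, b). f b a)"
  have p: "p b < n" if "b < n" for b using permutes_in_image[OF assms, of b] that by simp
  have "det (mat n n (\<lambda>(a, b). f a (p b))) = det (mat n n (\<lambda>(a, b). f a (p b)))\<^sup>T"
    by (subst det_transpose) auto
  also have "(mat n n (\<lambda>(a, b). f a (p b)))\<^sup>T = mat n n (\<lambda>(i, j). ?B $$ (p i, j))"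
    by (rule eq_matI) (auto simp: p)
  also have "det \<dots> = of_int (sign p) * det ?B"
    by (rule det_permute_rows) (use assms in auto)
  also have "det ?B = det ?B\<^sup>T" by (subst det_transpose) auto
  also have "?B\<^sup>T = mat n n (\<lambda>(a, b). f a b)" by (rule eq_matI) auto
  finally show ?thesis .
qed

lemma det_mat_cols:
  "det (mat n n (\<lambda>(a, b). f a b)) = (\<Sum>p | p permutes {0..<n}. of_int (sign p) * (\<Prod>b<n. f (p b) b))"
proof -
  have "det (mat n n (\<lambda>(a, b). f a b)) =
      (\<Sum>p | p permutes {0..<n}. of_int (sign p) * (\<Prod>b<n. mat n n (\<lambda>(a, b). f a b) $$ (p b, b)))"
    by (rule det_col) simp
  also have "\<dots> = (\<Sum>p | p permutes {0..<n}. of_int (sign p) * (\<Prod>b<n. f (p b) b))"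
  proof (intro sum.cong refl arg_cong[of _ _ "(*) _"] prod.cong)
    fix p b assume "p \<in> {p. p permutes {0..<n}}" "b \<in> {..<n}"
    then have "p b < n" using permutes_in_image[of p "{0..<n}" b] by simp
    then show "mat n n (\<lambda>(a, b). f a b) $$ (p b, b) = f (p b) b" using \<open>b \<in> {..<n}\<close> by simp
  qed
  finally show ?thesis .
qed

text \<open>Multilinearity in the columns: \<open>v ! b\<close> is the degree taken from column
  \<open>b\<close>, and the points enter only through a determinant of their powers.\<close>

lemma det_dilate_nth:
  fixes C :: "nat \<Rightarrow> 'a::comm_ring_1 fps"
  shows "det (mat n n (\<lambda>(a, b). dilate (q a) (C b))) $ m =
    (\<Sum>v\<in>natpermute m n. (\<Prod>b<n. C b $ (v ! b)) * det (mat n n (\<lambda>(a, b). q a ^ (v ! b))))"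
proof -
  have "det (mat n n (\<lambda>(a, b). dilate (q a) (C b))) $ m =
      (\<Sum>p | p permutes {0..<n}. of_int (sign p) * (\<Prod>b<n. dilate (q (p b)) (C b)) $ m)"
    unfolding det_mat_cols by (simp add: fps_sum_nth fps_of_int[symmetric])
  also have "\<dots> = (\<Sum>p | p permutes {0..<n}. \<Sum>v\<in>natpermute m n.
      (\<Prod>b<n. C b $ (v ! b)) * (of_int (sign p) * (\<Prod>b<n. q (p b) ^ (v ! b))))"
    unfolding fps_prod_nth_natpermute sum_distrib_left dilate_nth prod.distrib by (simp only: mult_ac)
  also have "\<dots> = (\<Sum>v\<in>natpermute m n. (\<Prod>b<n. C b $ (v ! b)) * det (mat n n (\<lambda>(a, b). q a ^ (v ! b))))"
    unfolding det_mat_cols by (subst sum.swap) (simp only: sum_distrib_left)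
  finally show ?thesis .
qed

lemma det_repeated_exponent:
  assumes "length v = n" "\<not> distinct v"
  shows "det (mat n n (\<lambda>(a, b). (q a :: 'a::comm_ring_1) ^ (v ! b))) = 0"
proof -
  obtain i j where ij: "i < n" "j < n" "i \<noteq> j" "v ! i = v ! j"
    using assms by (auto simp: distinct_conv_nth)
  show ?thesis
    by (rule det_identical_columns[of _ n i j]) (use ij in \<open>auto intro!: eq_vecI\<close>)
qed

text \<open>By antisymmetry in the points, only distinct exponents contribute, so the lowest possible order is
  attained exactly by the permutations of \<open>0, \<dots>, n - 1\<close>.\<close>

lemma det_dilate_low:
  fixes C :: "nat \<Rightarrow> 'a::comm_ring_1 fps" and n :: nat
  defines "D q \<equiv> det (mat n n (\<lambda>(a, b). dilate (q a) (C b)))"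
  shows "m < \<Sum>{..<n} \<Longrightarrow> D q $ m = 0"
    and "D q $ (\<Sum>{..<n}) = det (mat n n (\<lambda>(a, b). C b $ a)) * det (mat n n (\<lambda>(a, b). q a ^ b))"
proof -
  have sum_list: "sum_list v = \<Sum>(set v)" if "distinct v" for v :: "nat list"
    using that by (simp add: sum_list_distinct_conv_sum_set[of _ "\<lambda>x. x", simplified])
  show "D q $ m = 0" if m: "m < \<Sum>{..<n}"
  proof -
    have "\<not> distinct v" "length v = n" if "v \<in> natpermute m n" for v
      using that m sum_ge_sum_lessThan(1)[of "set v" n] sum_list[of v]
      by (auto simp: natpermute_def distinct_card)
    then show ?thesis unfolding D_def det_dilate_nth
      by (intro sum.neutral ballI) (simp add: det_repeated_exponent)
  qed
  let ?N = "\<Sum>{..<n}"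
  let ?T = "\<lambda>v. (\<Prod>b<n. C b $ (v ! b)) * det (mat n n (\<lambda>(a, b). q a ^ (v ! b)))"
  let ?V = "(\<lambda>p. map p [0..<n]) ` {p. p permutes {0..<n}}"
  have perm: "map p [0..<n] \<in> natpermute ?N n" if "p permutes {0..<n}" for p
  proof -
    have "set (map p [0..<n]) = {0..<n}" using permutes_image[OF that] by simp
    moreover have "distinct (map p [0..<n])" using permutes_inj_on[OF that] by (simp add: distinct_map)
    ultimately have "sum_list (map p [0..<n]) = \<Sum>{0..<n}" by (metis sum_list)
    then show ?thesis by (simp add: natpermute_def atLeast0LessThan)
  qed
  have other: "?T v = 0" if "v \<in> natpermute ?N n - ?V" for v
  proof -
    have v: "length v = n" "sum_list v = ?N" using that by (auto simp: natpermute_def)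
    have "\<not> distinct v"
    proof
      assume d: "distinct v"
      then have "set v = {..<n}"
        using sum_ge_sum_lessThan(2)[of "set v" n] v sum_list[OF d] by (simp add: distinct_card)
      define p where "p b = (if b < n then v ! b else b)" for b
      have "bij_betw ((!) v) {..<n} (set v)" using d v by (intro bij_betw_nth) auto
      then have "bij_betw p {0..<n} {0..<n}"
        unfolding \<open>set v = {..<n}\<close> atLeast0LessThan by (subst bij_betw_cong[of _ p "(!) v"]) (auto simp: p_def)
      then have "p permutes {0..<n}" by (rule bij_imp_permutes) (simp add: p_def)
      moreover have "v = map p [0..<n]" by (rule nth_equalityI) (auto simp: v p_def)
      ultimately show False using that by auto
    qed
    then show ?thesis using v by (simp add: det_repeated_exponent)
  qed
  have "D q $ ?N = (\<Sum>v\<in>natpermute ?N n. ?T v)" unfolding D_def by (rule det_dilate_nth)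
  also have "\<dots> = (\<Sum>v\<in>?V. ?T v)"
    by (rule sum.mono_neutral_right) (use perm other in \<open>auto simp: natpermute_finite\<close>)
  also have "\<dots> = (\<Sum>p | p permutes {0..<n}. ?T (map p [0..<n]))"
  proof (rule sum.reindex_cong[OF _ refl refl])
    show "inj_on (\<lambda>p. map p [0..<n]) {p. p permutes {0..<n}}"
    proof (rule inj_onI)
      fix p p' assume p: "p \<in> {p. p permutes {0..<n}}" "p' \<in> {p. p permutes {0..<n}}" "map p [0..<n] = map p' [0..<n]"
      show "p = p'"
      proof
        fix x
        show "p x = p' x"
          using p permutes_not_in[of p "{0..<n}" x] permutes_not_in[of p' "{0..<n}" x] by (cases "x < n") auto
      qed
    qed
  qed
  also have "\<dots> = (\<Sum>p | p permutes {0..<n}. of_int (sign p) * (\<Prod>b<n. C b $ (p b)) * det (mat n n (\<lambda>(a, b). q a ^ b)))"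
  proof (rule sum.cong[OF refl])
    fix p assume "p \<in> {p. p permutes {0..<n}}"
    then have p: "p permutes {0..<n}" by simp
    have "mat n n (\<lambda>(a, b). q a ^ (map p [0..<n] ! b)) = mat n n (\<lambda>(a, b). q a ^ (p b))"
      by (rule eq_matI) auto
    then show "?T (map p [0..<n]) = of_int (sign p) * (\<Prod>b<n. C b $ (p b)) * det (mat n n (\<lambda>(a, b). q a ^ b))"
      using det_mat_permute_cols[OF p, of "\<lambda>a b. q a ^ b"] by (simp add: mult_ac)
  qed
  also have "\<dots> = det (mat n n (\<lambda>(a, b). C b $ a)) * det (mat n n (\<lambda>(a, b). q a ^ b))"
    unfolding det_mat_cols[of n "\<lambda>a b. C b $ a"] sum_distrib_right ..
  finally show "D q $ ?N = det (mat n n (\<lambda>(a, b). C b $ a)) * det (mat n n (\<lambda>(a, b). q a ^ b))" .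
qed

text \<open>The variables are specialised to \<open>p\<^sub>i \<epsilon>\<^sup>d\<close> in the field of Laurent series in \<open>\<epsilon>\<close>, and the
  homogeneous limit is the constant coefficient. The case \<open>d = 2\<close> serves even power series,
  considered as series in the square of the variable.\<close>

definition subst_power :: "nat \<Rightarrow> 'a::field fps \<Rightarrow> 'a fls" where
  "subst_power d C = fps_to_fls (C oo fps_X ^ d)"

definition eval_at :: "nat \<Rightarrow> 'a::field \<Rightarrow> 'a fps \<Rightarrow> 'a fls" where
  "eval_at d p C = subst_power d (dilate p C)"

lemma subst_power_simps:
  fixes f g :: "'a::field fps"
  assumes "d > 0"
  shows "subst_power d 0 = 0" "subst_power d 1 = 1" "subst_power d (f + g) = subst_power d f + subst_power d g"
    "subst_power d (f - g) = subst_power d f - subst_power d g" "subst_power d (f * g) = subst_power d f * subst_power d g"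
    "subst_power d (f ^ n) = subst_power d f ^ n" "subst_power d f = 0 \<longleftrightarrow> f = 0"
proof -
  have X: "fps_nth (fps_X ^ d) 0 = (0 :: 'a)" using assms by simp
  show "subst_power d 0 = 0" "subst_power d 1 = 1" by (simp_all add: subst_power_def)
  show "subst_power d (f + g) = subst_power d f + subst_power d g"
    by (simp add: subst_power_def fps_compose_add_distrib)
  show "subst_power d (f - g) = subst_power d f - subst_power d g"
    by (simp add: subst_power_def fps_compose_sub_distrib)
  show "subst_power d (f * g) = subst_power d f * subst_power d g"
    unfolding subst_power_def fps_compose_mult_distrib[OF X] by (rule fls_times_fps_to_fls)
  show "subst_power d (f ^ n) = subst_power d f ^ n"
    by (simp add: subst_power_def fps_compose_power[OF X, symmetric] fps_to_fls_power)
  show "subst_power d f = 0 \<longleftrightarrow> f = 0"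
    using assms by (simp add: subst_power_def fps_compose_eq_0_iff)
qed

lemma subst_power_prod: "d > 0 \<Longrightarrow> subst_power d (prod f S) = (\<Prod>i\<in>S. subst_power d (f i))"
  by (induction S rule: infinite_finite_induct) (simp_all add: subst_power_simps)

lemma dilate_simps:
  fixes f g :: "'a::field fps"
  shows "dilate p 0 = 0" "dilate p 1 = 1" "dilate p (f + g) = dilate p f + dilate p g"
    "dilate p (f - g) = dilate p f - dilate p g" "dilate p (f * g) = dilate p f * dilate p g"
    "dilate p (f ^ n) = dilate p f ^ n" "dilate p fps_X = fps_const p * fps_X" "dilate p (fps_const c) = fps_const c"
  unfolding dilate_def
  by (simp_all add: fps_compose_add_distrib fps_compose_sub_distrib fps_compose_mult_distrib fps_compose_power)

lemma eval_at_simps: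
  assumes "d > 0"
  shows "eval_at d p 0 = 0" "eval_at d p 1 = 1" "eval_at d p (f + g) = eval_at d p f + eval_at d p g"
    "eval_at d p (f - g) = eval_at d p f - eval_at d p g" "eval_at d p (f * g) = eval_at d p f * eval_at d p g"
    "eval_at d p (f ^ n) = eval_at d p f ^ n"
  using assms by (simp_all add: eval_at_def dilate_simps subst_power_simps)

text \<open>The formal limit; absence of a pole is part of the statement.\<close>

definition regular_at_0 :: "'a::field fls \<Rightarrow> 'a \<Rightarrow> bool" where
  "regular_at_0 v c \<longleftrightarrow> (\<exists>u. v = fps_to_fls u \<and> fps_nth u 0 = c)"

lemma regular_at_0_unique: "regular_at_0 v c \<Longrightarrow> regular_at_0 v c' \<Longrightarrow> c = c'"
  by (auto simp: regular_at_0_def)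

lemma regular_at_0_intros:
  shows "regular_at_0 1 1" "regular_at_0 v c \<Longrightarrow> regular_at_0 w c' \<Longrightarrow> regular_at_0 (v + w) (c + c')"
    "regular_at_0 v c \<Longrightarrow> regular_at_0 w c' \<Longrightarrow> regular_at_0 (v * w) (c * c')"
  unfolding regular_at_0_def
  by (metis fps_one_to_fls fps_one_nth) (metis fps_to_fls_plus fps_add_nth, metis fls_times_fps_to_fls fps_mult_nth_0)

lemma regular_at_0_sum:
  assumes "\<And>i. i \<in> S \<Longrightarrow> regular_at_0 (f i) (c i)"
  shows "regular_at_0 (sum f S) (sum c S)"
  using assms
proof (induction S rule: infinite_finite_induct)
  case (insert i S)
  then show ?case by (simp add: regular_at_0_intros)
qed (auto simp: regular_at_0_def intro: exI[of _ 0])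

lemma regular_at_0_prod:
  assumes "\<And>i. i \<in> S \<Longrightarrow> regular_at_0 (f i) (c i)"
  shows "regular_at_0 (prod f S) (prod c S)"
  using assms
proof (induction S rule: infinite_finite_induct)
  case (insert i S)
  then show ?case by (simp add: regular_at_0_intros)
qed (auto simp: regular_at_0_intros)

lemma regular_at_0_power: "regular_at_0 v c \<Longrightarrow> regular_at_0 (v ^ n) (c ^ n)"
  by (induction n) (simp_all add: regular_at_0_intros)

lemma regular_at_0_numeral: "regular_at_0 (numeral k) (numeral k)"
  unfolding regular_at_0_def by (intro exI[of _ "numeral k"]) (simp add: fps_numeral_nth_0)

lemma regular_at_0_eval_at: "d > 0 \<Longrightarrow> regular_at_0 (eval_at d p C) (fps_nth C 0)"
  unfolding regular_at_0_def eval_at_def subst_power_def by (intro exI[of _ "dilate p C oo fps_X ^ d"]) simp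

lemma comm_ring_hom_subst_power: "d > 0 \<Longrightarrow> comm_ring_hom (subst_power d)"
  by unfold_locales (simp_all add: subst_power_simps)

lemma fps_const_prod: "(\<Prod>i\<in>S. fps_const (f i)) = fps_const (\<Prod>i\<in>S. f i :: 'a::comm_ring_1)"
  by (induction S rule: infinite_finite_induct) simp_all

lemma vand_eval_at_X:
  assumes "d > 0" "distinct js"
  shows "vand (\<lambda>i. eval_at d (q i) fps_X) js = subst_power d (fps_const (vand q js) * fps_X ^ (\<Sum>{..<length js}))"
  using assms(2)
proof (induction js)
  case Nil
  then show ?case using assms by (simp add: subst_power_simps)
next
  case (Cons i js)
  have eval_at: "eval_at d (q j) fps_X - eval_at d (q i) fps_X = subst_power d (fps_const (q j - q i) * fps_X)" for j
    using assms(1) by (simp add: eval_at_def dilate_simps subst_power_simps(4)[symmetric] algebra_simps flip: fps_const_sub)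
  have "(\<Prod>j\<in>set js. eval_at d (q j) fps_X - eval_at d (q i) fps_X) = subst_power d (\<Prod>j\<in>set js. fps_const (q j - q i) * fps_X)"
    using assms(1) by (simp add: subst_power_prod eval_at)
  also have "(\<Prod>j\<in>set js. fps_const (q j - q i) * fps_X) = fps_const (\<Prod>j\<in>set js. q j - q i) * fps_X ^ length js"
    using Cons.prems by (simp add: prod.distrib distinct_card fps_const_prod)
  finally show ?case
    using Cons assms(1) by (simp add: subst_power_simps(5)[symmetric] lessThan_Suc power_add mult_ac flip: fps_const_mult)
qed

text \<open>By \<open>det_dilate_low\<close> the numerator starts in degree \<open>N\<close> with
  the coefficient determinant times \<open>V\<close>, and the denominator is exactly
  \<open>V\<close> times the \<open>N\<close>-th power of the parameter. The factor \<open>V\<close>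
  cancels, and with it all dependence on the points.\<close>

lemma dd_regular_at_0:
  fixes q :: "nat \<Rightarrow> 'a::field_char_0"
  assumes "d > 0" "finite I" "inj_on q I" "card I = length Cs"
  shows "regular_at_0 (dd (\<lambda>i. eval_at d (q i) fps_X) (map (\<lambda>C i. eval_at d (q i) C) Cs) I)
    (det (mat (length Cs) (length Cs) (\<lambda>(a, b). fps_nth (rev Cs ! b) a)))"
proof -
  define js where "js = sorted_list_of_set I"
  define n where "n = length Cs"
  define N where "N = \<Sum>{..<n}"
  define V where "V = vand q js"
  have js: "distinct js" "set js = I" "length js = n"
    using assms by (auto simp: js_def n_def)
  have V: "det (mat n n (\<lambda>(a, b). q (js ! a) ^ b)) = V"
    using js by (simp add: det_vandermonde V_def vand_eq_prod)
  have V0: "V \<noteq> 0"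
  proof -
    have "vand q ks \<noteq> 0" if "distinct ks" "inj_on q (set ks)" for ks
      using that by (induction ks) (force simp: image_iff)+
    then show ?thesis using js assms(3) by (simp add: V_def)
  qed
  let ?X = "\<lambda>i. eval_at d (q i) fps_X" and ?hs = "map (\<lambda>C i. eval_at d (q i) C) Cs"
  let ?A = "mat n n (\<lambda>(a, b). dilate (q (js ! a)) (rev Cs ! b))"
  define u where "u = fps_shift N (det ?A)"
  have "det ?A = fps_X ^ N * u"
    by (rule fps_ext) (simp add: u_def fps_X_power_mult_nth N_def det_dilate_low(1))
  have u0: "fps_nth u 0 = det (mat n n (\<lambda>(a, b). fps_nth (rev Cs ! b) a)) * V"
    using det_dilate_low(2)[where q = "\<lambda>a. q (js ! a)" and n = n and C = "(!) (rev Cs)"] V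
    by (simp add: u_def N_def)
  have injX: "inj_on ?X (set js)"
  proof (rule inj_onI)
    fix i j assume ij: "i \<in> set js" "j \<in> set js" "?X i = ?X j"
    then have "subst_power d (fps_const (q i) * fps_X - fps_const (q j) * fps_X) = 0"
      using assms(1) by (simp add: eval_at_def dilate_simps subst_power_simps)
    then have "fps_nth (fps_const (q i) * fps_X - fps_const (q j) * fps_X) 1 = 0"
      unfolding subst_power_simps(7)[OF assms(1)] by (simp only: fps_zero_nth)
    then show "i = j" using ij assms(3) js by (simp add: inj_on_def)
  qed
  have "dd ?X ?hs I * vand ?X js = det (mat n n (\<lambda>(a, b). (rev ?hs ! b) (js ! a)))"
    using det_eq_dd_vand[OF js(1) _ injX, of ?hs] js by (simp add: n_def)
  also have "mat n n (\<lambda>(a, b). (rev ?hs ! b) (js ! a)) = map_mat (subst_power d) ?A"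
    by (rule eq_matI) (auto simp: rev_map eval_at_def n_def)
  also have "det \<dots> = subst_power d (det ?A)" by (rule comm_ring_hom.hom_det[OF comm_ring_hom_subst_power[OF assms(1)]])
  also have "\<dots> = subst_power d (fps_X ^ N) * subst_power d u"
    unfolding \<open>det ?A = fps_X ^ N * u\<close> using assms(1) by (rule subst_power_simps)
  finally have "dd ?X ?hs I * subst_power d (fps_const V) * subst_power d (fps_X ^ N) = subst_power d u * subst_power d (fps_X ^ N)"
    using vand_eval_at_X[OF assms(1) js(1), of q] assms(1) js(3) by (simp add: subst_power_simps V_def N_def mult_ac)
  then have "dd ?X ?hs I * subst_power d (fps_const V) = subst_power d u"
    using assms(1) by (simp add: subst_power_simps)
  then have "dd ?X ?hs I * (subst_power d (fps_const V) * subst_power d (fps_const (inverse V))) = subst_power d u * subst_power d (fps_const (inverse V))"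
    by (simp add: mult.assoc)
  moreover have "subst_power d (fps_const V) * subst_power d (fps_const (inverse V)) = 1"
    using V0 assms(1) by (simp add: subst_power_simps(5)[symmetric] subst_power_simps(2))
  ultimately have "dd ?X ?hs I = subst_power d (u * fps_const (inverse V))"
    using assms(1) by (simp add: subst_power_simps)
  moreover have "fps_nth (u * fps_const (inverse V)) 0 = det (mat n n (\<lambda>(a, b). fps_nth (rev Cs ! b) a))"
    using V0 u0 by simp
  ultimately show ?thesis
    unfolding regular_at_0_def subst_power_def n_def[symmetric] by (metis fps_compose_nth_0)
qed

text \<open>With as many functions as points, each term of the expansion uses every point exactly
  once, so each entry can absorb one factor.\<close>

lemma prod_mult_dd:
  assumes "finite I" "card I = length hs"
  shows "(\<Prod>i\<in>I. g i) * dd X hs I = dd X (map (\<lambda>h i. g i * h i) hs) I"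
  using assms
proof (induction hs arbitrary: I)
  case (Cons h hs)
  show ?case
    unfolding dd.simps list.map sum_distrib_left
  proof (rule sum.cong[OF refl])
    fix k assume k: "k \<in> I"
    have "(\<Prod>i\<in>I. g i) = g k * (\<Prod>i\<in>I - {k}. g i)" by (rule prod.remove[OF Cons.prems(1) k])
    moreover have "(\<Prod>i\<in>I - {k}. g i) * dd X hs (I - {k}) = dd X (map (\<lambda>h i. g i * h i) hs) (I - {k})"
      by (rule Cons.IH) (use Cons.prems k in auto)
    ultimately show "(\<Prod>i\<in>I. g i) * (h k / (\<Prod>i\<in>I - {k}. X k - X i) * dd X hs (I - {k})) =
        g k * h k / (\<Prod>i\<in>I - {k}. X k - X i) * dd X (map (\<lambda>h i. g i * h i) hs) (I - {k})"
      by (simp add: mult_ac)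
  qed
qed simp

text \<open>Each entry of the list is multiplied by one of the summands of \<open>(1 - X) + s (1 + X)\<close>; the number
  counts the factors \<open>s\<close>.\<close>

fun choices :: "'a::field fps list \<Rightarrow> (nat \<times> 'a fps list) list" where
  "choices [] = [(0, [])]"
| "choices (C # Cs) =
     map (\<lambda>(e, G). (e, ((1 - fps_X) * C) # G)) (choices Cs) @
     map (\<lambda>(e, G). (Suc e, ((1 + fps_X) * C) # G)) (choices Cs)"

lemma length_choices: "(e, G) \<in> set (choices Cs) \<Longrightarrow> length G = length Cs"
  by (induction Cs arbitrary: e G) auto

lemma sum_sum_list: "(\<Sum>k\<in>K. \<Sum>x\<leftarrow>xs. f k x) = (\<Sum>x\<leftarrow>xs. \<Sum>k\<in>K. f k x :: 'a::comm_monoid_add)"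
  by (induction xs) (simp_all add: sum.distrib)

text \<open>If \<open>s\<close> is the peeled variable, \<open>(1 - X) + s * (1 + X)\<close> is the
  scattering numerator. Expanding it reduces the coupling to powers of \<open>s\<close>, which the
  entry of the peeled variable absorbs.\<close>

lemma dd_choices:
  assumes "d > 0"
  shows "dd X (map (\<lambda>C i. (eval_at d (q i) (1 - fps_X) + s * eval_at d (q i) (1 + fps_X)) * eval_at d (q i) C) Cs) I =
    (\<Sum>(e, G)\<leftarrow>choices Cs. s ^ e * dd X (map (\<lambda>C i. eval_at d (q i) C) G) I)"
proof (induction Cs arbitrary: I)
  case (Cons C Cs)
  let ?E = "\<lambda>G. map (\<lambda>C i. eval_at d (q i) C) G" and ?D = "\<lambda>k. \<Prod>i\<in>I - {k}. X k - X i"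
  have "dd X (map (\<lambda>C i. (eval_at d (q i) (1 - fps_X) + s * eval_at d (q i) (1 + fps_X)) * eval_at d (q i) C) (C # Cs)) I =
     (\<Sum>k\<in>I. (eval_at d (q k) ((1 - fps_X) * C) + s * eval_at d (q k) ((1 + fps_X) * C)) / ?D k *
        (\<Sum>(e, G)\<leftarrow>choices Cs. s ^ e * dd X (?E G) (I - {k})))"
  proof -
    have "(eval_at d (q k) (1 - fps_X) + s * eval_at d (q k) (1 + fps_X)) * eval_at d (q k) C =
        eval_at d (q k) ((1 - fps_X) * C) + s * eval_at d (q k) ((1 + fps_X) * C)" for k
      unfolding eval_at_simps(5)[OF assms] by (simp only: distrib_right mult.assoc)
    then show ?thesis by (simp only: list.map dd.simps Cons.IH)
  qed
  also have "\<dots> = (\<Sum>k\<in>I. \<Sum>(e, G)\<leftarrow>choices Cs. s ^ e * (eval_at d (q k) ((1 - fps_X) * C) / ?D k * dd X (?E G) (I - {k})))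
      + (\<Sum>k\<in>I. \<Sum>(e, G)\<leftarrow>choices Cs. s ^ Suc e * (eval_at d (q k) ((1 + fps_X) * C) / ?D k * dd X (?E G) (I - {k})))"
    by (simp add: sum.distrib[symmetric] sum_list_const_mult[symmetric] sum_list_addf[symmetric] case_prod_unfold
        add_divide_distrib algebra_simps)
  also have "\<dots> = (\<Sum>(e, G)\<leftarrow>choices (C # Cs). s ^ e * dd X (?E G) I)"
    by (simp add: sum_sum_list case_prod_unfold sum_distrib_left o_def)
  finally show ?case .
qed simp

section \<open>Limits of Bethe sums\<close>

lemma cayley_inj:
  fixes x y :: "'a::field_char_0"
  assumes "x \<noteq> 1" "y \<noteq> 1"
  shows "cayley x = cayley y \<longleftrightarrow> x = y"
proof
  assume "cayley x = cayley y"
  then have "(1 + x) * (1 - y) = (1 + y) * (1 - x)" using assms by (simp add: cayley_def frac_eq_eq)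
  then have "2 * (x - y) = 0" by (simp add: algebra_simps)
  then show "x = y" by simp
qed simp

lemma cayley_eq_1: "x \<noteq> 1 \<Longrightarrow> cayley x = 1 \<longleftrightarrow> x = (0 :: 'a::field_char_0)"
  using cayley_inj[of x 0] by (simp add: cayley_def)

lemma eval_at_X: "eval_at d p fps_X = fps_to_fls (fps_const p * fps_X oo fps_X ^ d)"
  by (simp add: eval_at_def dilate_simps subst_power_def)

lemma eval_at_X_neq:
  assumes "d > 0" "c \<noteq> 0"
  shows "eval_at d p fps_X \<noteq> fps_to_fls (fps_const c)"
proof
  assume "eval_at d p fps_X = fps_to_fls (fps_const c)"
  then have "fps_const p * fps_X oo fps_X ^ d = fps_const c" by (simp only: eval_at_X fps_to_fls_eq_iff)
  then have "fps_nth (fps_const p * fps_X oo fps_X ^ d) 0 = fps_nth (fps_const c) 0" by simp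
  then show False using assms by simp
qed

lemma eval_at_X_neq_1: "d > 0 \<Longrightarrow> eval_at d p fps_X \<noteq> 1" and eval_at_X_neq_minus_1: "d > 0 \<Longrightarrow> eval_at d p fps_X \<noteq> - 1"
  using eval_at_X_neq[of d 1 p] eval_at_X_neq[of d "- 1" p] by (simp_all flip: fps_const_neg)

lemma eval_at_X_inj:
  assumes "d > 0"
  shows "eval_at d p fps_X = eval_at d p' fps_X \<longleftrightarrow> p = p'"
proof
  assume "eval_at d p fps_X = eval_at d p' fps_X"
  then have "fps_const p * fps_X oo fps_X ^ d = fps_const p' * fps_X oo fps_X ^ d" by (simp add: eval_at_X)
  then have "fps_nth (fps_const p * fps_X oo fps_X ^ d) d = fps_nth (fps_const p' * fps_X oo fps_X ^ d) d" by simp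
  then show "p = p'" using assms by (simp add: fps_nth_compose_X_power)
qed simp

definition Cayley :: "'a::field fps" where "Cayley = (1 + fps_X) * inverse (1 - fps_X)"

lemma Cayley_nth_0: "fps_nth Cayley 0 = 1" by (simp add: Cayley_def)

lemma eval_at_inverse:
  assumes "d > 0" "fps_nth f 0 = 1"
  shows "eval_at d p (inverse f) = inverse (eval_at d p f)"
proof -
  have "f * inverse f = 1" using assms by (simp add: inverse_mult_eq_1')
  then have "eval_at d p f * eval_at d p (inverse f) = 1" using assms(1) by (metis eval_at_simps(2,5))
  then show ?thesis by (metis inverse_unique)
qed

lemma eval_at_Cayley: "d > 0 \<Longrightarrow> eval_at d p Cayley = cayley (eval_at d p fps_X)"
  by (simp add: Cayley_def cayley_def eval_at_simps eval_at_inverse divide_inverse)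

text \<open>The series in this expansion do not depend on the points \<open>q\<close>, hence neither does the limit. This
  permits one point to be put to 0, as the recursion for the Bethe sums requires.\<close>

lemma bethe_span:
  fixes as :: "nat list"
  obtains ts :: "'a::field_char_0 fps list list"
  where "\<And>Cs. Cs \<in> set ts \<Longrightarrow> length Cs = length as"
    and "\<And>(q :: nat \<Rightarrow> 'a) I. \<lbrakk>finite I; inj_on q I; card I = length as\<rbrakk> \<Longrightarrow>
      bethe (\<lambda>i. cayley (eval_at 1 (q i) fps_X)) as I =
      (\<Sum>Cs\<leftarrow>ts. dd (\<lambda>i. eval_at 1 (q i) fps_X) (map (\<lambda>C i. eval_at 1 (q i) C) Cs) I)"
proof (induction as arbitrary: thesis)
  case Nil
  show ?case by (rule Nil[of "[[]]"]) auto
next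
  case (Cons a as)
  obtain ts :: "'a fps list list" where ts: "\<And>Cs. Cs \<in> set ts \<Longrightarrow> length Cs = length as"
    "\<And>(q :: nat \<Rightarrow> 'a) I. \<lbrakk>finite I; inj_on q I; card I = length as\<rbrakk> \<Longrightarrow>
      bethe (\<lambda>i. cayley (eval_at 1 (q i) fps_X)) as I =
      (\<Sum>Cs\<leftarrow>ts. dd (\<lambda>i. eval_at 1 (q i) fps_X) (map (\<lambda>C i. eval_at 1 (q i) C) Cs) I)"
    using Cons.IH by blast
  let ?ts = "concat (map (\<lambda>Cs. map (\<lambda>(e, G). (Cayley ^ a * fps_X ^ e) # G) (choices Cs)) ts)"
  show ?case
  proof (rule Cons.prems[of ?ts])
    fix Cs assume "Cs \<in> set ?ts"
    then show "length Cs = length (a # as)" using ts(1) length_choices by fastforce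
  next
    fix q :: "nat \<Rightarrow> 'a" and I :: "nat set"
    assume I: "finite I" "inj_on q I" "card I = length (a # as)"
    let ?x = "\<lambda>i. eval_at 1 (q i) fps_X" and ?E = "\<lambda>Cs. map (\<lambda>C i. eval_at 1 (q i) C) Cs"
    let ?D = "\<lambda>k. \<Prod>i\<in>I - {k}. ?x k - ?x i"
    have summand: "cayley (?x k) ^ a * scat_weight (\<lambda>i. cayley (?x i)) I k * bethe (\<lambda>i. cayley (?x i)) as (I - {k}) =
        (\<Sum>Cs\<leftarrow>ts. \<Sum>(e, G)\<leftarrow>choices Cs. eval_at 1 (q k) (Cayley ^ a * fps_X ^ e) / ?D k * dd ?x (?E G) (I - {k}))"
      if k: "k \<in> I" for k
    proof -
      have card: "card (I - {k}) = length as" using I k by simp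
      have scat_weight: "scat_weight (\<lambda>i. cayley (?x i)) I k =
          (\<Prod>i\<in>I - {k}. eval_at 1 (q i) (1 - fps_X) + ?x k * eval_at 1 (q i) (1 + fps_X)) / ?D k"
        unfolding scat_weight_def prod_dividef[symmetric]
      proof (rule prod.cong[OF refl])
        fix i assume i: "i \<in> I - {k}"
        then have "?x i \<noteq> ?x k" using I(2) k by (auto simp: eval_at_X_inj inj_on_def)
        then show "scat (cayley (?x i)) (cayley (?x k)) = (eval_at 1 (q i) (1 - fps_X) + ?x k * eval_at 1 (q i) (1 + fps_X)) / (?x k - ?x i)"
          by (subst scat_cayley) (simp_all add: eval_at_X_neq_1 eval_at_simps algebra_simps)
      qed
      have "(\<Prod>i\<in>I - {k}. eval_at 1 (q i) (1 - fps_X) + ?x k * eval_at 1 (q i) (1 + fps_X)) * bethe (\<lambda>i. cayley (?x i)) as (I - {k}) =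
          (\<Sum>Cs\<leftarrow>ts. (\<Prod>i\<in>I - {k}. eval_at 1 (q i) (1 - fps_X) + ?x k * eval_at 1 (q i) (1 + fps_X)) * dd ?x (?E Cs) (I - {k}))"
        using ts(2)[of "I - {k}" q] I card by (simp add: inj_on_diff sum_list_const_mult)
      also have "\<dots> = (\<Sum>Cs\<leftarrow>ts. \<Sum>(e, G)\<leftarrow>choices Cs. ?x k ^ e * dd ?x (?E G) (I - {k}))"
      proof (rule arg_cong[of _ _ sum_list], rule map_cong[OF refl])
        fix Cs assume "Cs \<in> set ts"
        then have "card (I - {k}) = length (?E Cs)" using ts(1) card by simp
        then show "(\<Prod>i\<in>I - {k}. eval_at 1 (q i) (1 - fps_X) + ?x k * eval_at 1 (q i) (1 + fps_X)) * dd ?x (?E Cs) (I - {k}) =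
            (\<Sum>(e, G)\<leftarrow>choices Cs. ?x k ^ e * dd ?x (?E G) (I - {k}))"
          using I(1) dd_choices[of 1 ?x q "?x k" Cs "I - {k}"]
          by (subst prod_mult_dd) (simp_all add: o_def del: One_nat_def)
      qed
      finally have "cayley (?x k) ^ a * scat_weight (\<lambda>i. cayley (?x i)) I k * bethe (\<lambda>i. cayley (?x i)) as (I - {k}) =
          cayley (?x k) ^ a / ?D k * (\<Sum>Cs\<leftarrow>ts. \<Sum>(e, G)\<leftarrow>choices Cs. ?x k ^ e * dd ?x (?E G) (I - {k}))"
        unfolding scat_weight by simp
      then show ?thesis
        by (simp add: sum_list_const_mult[symmetric] case_prod_unfold eval_at_simps eval_at_Cayley mult_ac)
    qed
    have "bethe (\<lambda>i. cayley (?x i)) (a # as) I =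
        (\<Sum>k\<in>I. \<Sum>Cs\<leftarrow>ts. \<Sum>(e, G)\<leftarrow>choices Cs. eval_at 1 (q k) (Cayley ^ a * fps_X ^ e) / ?D k * dd ?x (?E G) (I - {k}))"
      unfolding bethe.simps peel_def by (rule sum.cong[OF refl summand])
    also have "\<dots> = (\<Sum>Cs\<leftarrow>ts. \<Sum>(e, G)\<leftarrow>choices Cs. dd ?x (?E ((Cayley ^ a * fps_X ^ e) # G)) I)"
      by (simp add: sum_sum_list case_prod_unfold)
    also have "\<dots> = (\<Sum>Cs\<leftarrow>?ts. dd ?x (?E Cs) I)"
      by (induction ts) (simp_all add: case_prod_unfold o_def)
    finally show "bethe (\<lambda>i. cayley (?x i)) (a # as) I = (\<Sum>Cs\<leftarrow>?ts. dd ?x (?E Cs) I)" .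
  qed
qed

lemma bethe_regular_at_0:
  fixes as :: "nat list"
  obtains c :: "'a::field_char_0"
  where "\<And>(q :: nat \<Rightarrow> 'a) I. \<lbrakk>finite I; inj_on q I; card I = length as\<rbrakk> \<Longrightarrow>
      regular_at_0 (bethe (\<lambda>i. cayley (eval_at 1 (q i) fps_X)) as I) c"
proof -
  obtain ts :: "'a fps list list" where ts: "\<And>Cs. Cs \<in> set ts \<Longrightarrow> length Cs = length as"
    "\<And>(q :: nat \<Rightarrow> 'a) I. \<lbrakk>finite I; inj_on q I; card I = length as\<rbrakk> \<Longrightarrow>
      bethe (\<lambda>i. cayley (eval_at 1 (q i) fps_X)) as I =
      (\<Sum>Cs\<leftarrow>ts. dd (\<lambda>i. eval_at 1 (q i) fps_X) (map (\<lambda>C i. eval_at 1 (q i) C) Cs) I)"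
    using bethe_span by blast
  have regular_at_0: "regular_at_0 (\<Sum>Cs\<leftarrow>ts. dd (\<lambda>i. eval_at 1 (q i) fps_X) (map (\<lambda>C i. eval_at 1 (q i) C) Cs) I)
      (\<Sum>Cs\<leftarrow>ts. det (mat (length Cs) (length Cs) (\<lambda>(a, b). fps_nth (rev Cs ! b) a)))"
    if "finite I" "inj_on q I" "card I = length as" for q :: "nat \<Rightarrow> 'a" and I
    using ts(1)
  proof (induction ts)
    case Nil
    show ?case by (auto simp: regular_at_0_def intro: exI[of _ 0])
  next
    case (Cons Cs ts)
    have "regular_at_0 (dd (\<lambda>i. eval_at 1 (q i) fps_X) (map (\<lambda>C i. eval_at 1 (q i) C) Cs) I)
        (det (mat (length Cs) (length Cs) (\<lambda>(a, b). fps_nth (rev Cs ! b) a)))"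
      by (rule dd_regular_at_0) (use that Cons.prems in auto)
    moreover have "regular_at_0 (\<Sum>Cs\<leftarrow>ts. dd (\<lambda>i. eval_at 1 (q i) fps_X) (map (\<lambda>C i. eval_at 1 (q i) C) Cs) I)
        (\<Sum>Cs\<leftarrow>ts. det (mat (length Cs) (length Cs) (\<lambda>(a, b). fps_nth (rev Cs ! b) a)))"
      by (rule Cons.IH) (use Cons.prems in auto)
    ultimately show ?case unfolding list.map sum_list.Cons by (rule regular_at_0_intros(2))
  qed
  show ?thesis by (rule that) (use ts(2) regular_at_0 in simp)
qed

lemma tight_map_div2: "sorted_wrt (>) bs \<Longrightarrow> tight (map (\<lambda>b. b div 2) bs)"
  by (induction bs rule: tight.induct) (auto intro: div_le_mono)

lemma eval_at_1_0: "eval_at 1 0 fps_X = (0 :: 'a::field fls)"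
  by (simp add: eval_at_def dilate_simps subst_power_simps)

text \<open>The limit \<open>c\<close> is the same for all points, so it may be computed with one
  variable exactly at the homogeneous point. There \<open>interl_sum_bethe_insert\<close> relates it
  to sums with one variable less; the factors \<open>?z i + 1\<close> tend to 2 and cancel the power
  of 2.\<close>

theorem bethe_regular_at_0_num_chains:
  fixes q :: "nat \<Rightarrow> 'a::field_char_0"
  assumes "tight as" "length as = n" "finite I" "inj_on q I" "card I = n"
  shows "regular_at_0 (bethe (\<lambda>i. cayley (eval_at 1 (q i) fps_X)) as I) (of_nat (num_chains n as))"
  using assms
proof (induction n arbitrary: as q I)
  case 0
  then show ?case by (simp add: regular_at_0_intros)
next
  case (Suc m)
  obtain c :: 'a where c: "\<And>(q :: nat \<Rightarrow> 'a) I. \<lbrakk>finite I; inj_on q I; card I = length as\<rbrakk> \<Longrightarrow>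
      regular_at_0 (bethe (\<lambda>i. cayley (eval_at 1 (q i) fps_X)) as I) c"
    using bethe_regular_at_0 by blast
  \<comment> \<open>The points \<open>0, ..., m\<close> are distinct; index 0 gives the momentum 1
    and serves as the inserted variable.\<close>
  let ?z = "\<lambda>i. cayley (eval_at 1 (of_nat i :: 'a) fps_X)"
  let ?I = "{1..<Suc m}"
  have I0: "insert 0 ?I = {0..<Suc m}" by auto
  have X0: "eval_at 1 (of_nat i) fps_X = (0 :: 'a fls) \<longleftrightarrow> i = 0" for i
    using eval_at_X_inj[of 1 "of_nat i :: 'a" 0] unfolding eval_at_1_0 by (simp del: One_nat_def)
  have admissible: "admissible ?z ?I"
    unfolding admissible_def inj_on_def
    using X0 by (auto simp: cayley_inj cayley_eq_1 eval_at_X_neq_1 eval_at_X_inj)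
  have P3: "2 ^ m * interl_sum as (\<lambda>t. bethe ?z t ?I) = (\<Prod>i\<in>?I. ?z i + 1) * bethe ?z as (insert 0 ?I)"
    using interl_sum_bethe_insert[OF tight_imp_good[OF Suc.prems(1)] _ admissible, of 0] Suc.prems(2)
    by (simp add: cayley_def eval_at_1_0[unfolded One_nat_def])
  have "regular_at_0 ((\<Prod>i\<in>?I. ?z i + 1) * bethe ?z as (insert 0 ?I)) ((\<Prod>i\<in>?I. 1 + 1) * c)"
  proof (intro regular_at_0_intros regular_at_0_prod)
    fix i
    show "regular_at_0 (?z i) 1"
      using regular_at_0_eval_at[of 1 "of_nat i" "Cayley :: 'a fps"] eval_at_Cayley[of 1 "of_nat i :: 'a"] by (simp add: Cayley_nth_0)
    show "regular_at_0 (bethe ?z as (insert 0 ?I)) c"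
      unfolding I0 by (rule c) (use Suc.prems(2) in \<open>auto simp: inj_on_def\<close>)
  qed
  moreover have "regular_at_0 (2 ^ m * interl_sum as (\<lambda>t. bethe ?z t ?I))
      (2 ^ m * (\<Sum>bs\<in>interl as. of_nat (num_chains m (map (\<lambda>b. b div 2) bs))))"
    unfolding interl_sum_def
  proof (intro regular_at_0_intros(3) regular_at_0_power regular_at_0_numeral regular_at_0_sum Suc.IH)
    fix bs assume "bs \<in> interl as"
    then show "tight (map (\<lambda>b. b div 2) bs)" "length (map (\<lambda>b. b div 2) bs) = m"
      using Suc.prems(2) by (auto simp: interl_def intro: tight_map_div2)
  qed (auto simp: inj_on_def)
  ultimately have "2 ^ m * c = 2 ^ m * (\<Sum>bs\<in>interl as. of_nat (num_chains m (map (\<lambda>b. b div 2) bs)))"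
    unfolding P3 by (auto dest: regular_at_0_unique)
  then have "c = of_nat (num_chains (Suc m) as)"
    by (simp add: interl_sum_def)
  then show ?case using c[of I q] Suc.prems by simp
qed

section \<open>Even and odd parts of the determinant entries\<close>

definition Fr :: "'a::field fps" where "Fr = fps_X * (1 + fps_X) * inverse (1 - fps_X)"
definition Gr :: "'a::field fps" where "Gr = - (fps_X * (1 - fps_X) * inverse (1 + fps_X))"
definition Lam :: "nat \<Rightarrow> 'a::field fps" where "Lam l = hsym l Fr Gr * inverse (1 - fps_X ^ 2)"

lemma hsym_commute: "hsym l a b = hsym l b a"
  unfolding hsym_def
  by (rule sum.reindex_bij_witness[of _ "\<lambda>i. l - i" "\<lambda>i. l - i"]) (auto simp: mult.commute)

lemma dilate_inverse:
  fixes f :: "'a::field fps"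
  assumes "fps_nth f 0 = 1"
  shows "dilate p (inverse f) = inverse (dilate p f)"
  unfolding dilate_def by (rule fps_inverse_compose) (use assms in auto)

lemma dilate_sum: "dilate p (sum f S) = (\<Sum>i\<in>S. dilate p (f i :: 'a::field fps))"
  by (induction S rule: infinite_finite_induct) (simp_all add: dilate_simps)

lemma eval_at_sum: "d > 0 \<Longrightarrow> eval_at d p (sum f S) = (\<Sum>i\<in>S. eval_at d p (f i))"
  by (induction S rule: infinite_finite_induct) (simp_all add: eval_at_simps)

lemma eval_at_hsym: "d > 0 \<Longrightarrow> eval_at d p (hsym l f g) = hsym l (eval_at d p f) (eval_at d p g)"
  by (simp add: hsym_def eval_at_sum eval_at_simps)

lemma dilate_hsym: "dilate p (hsym l f g) = hsym l (dilate p f) (dilate p (g :: 'a::field fps))"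
  by (simp add: hsym_def dilate_sum dilate_simps)

lemma dilate_minus_one_X: "dilate (- 1) fps_X = - (fps_X :: 'a::field fps)"
  by (simp add: dilate_simps flip: fps_const_neg)

lemma dilate_uminus: "dilate p (- f) = - dilate p (f :: 'a::field fps)"
  using dilate_simps(4)[of p 0 f] by (simp add: dilate_simps)

lemma dilate_Fr: "dilate (- 1) Fr = Gr" and dilate_Gr: "dilate (- 1) Gr = Fr"
  unfolding Fr_def Gr_def dilate_uminus by (simp_all add: dilate_simps(1-6) dilate_inverse dilate_minus_one_X)

text \<open>Reflection of the variable exchanges \<open>Fr\<close> and \<open>Gr\<close>, and
  \<open>hsym\<close> is symmetric.\<close>

lemma Lam_odd:
  assumes "odd n"
  shows "fps_nth (Lam l :: 'a::field_char_0 fps) n = 0"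
proof -
  have "dilate (- 1) (Lam l) = (Lam l :: 'a fps)"
    unfolding Lam_def
    by (simp add: dilate_simps(1-6) dilate_hsym dilate_Fr dilate_Gr dilate_inverse dilate_minus_one_X hsym_commute[of l Gr])
  then have "fps_nth (dilate (- 1) (Lam l)) n = fps_nth (Lam l :: 'a fps) n" by simp
  then show ?thesis using assms by simp
qed

lemma eval_at_Lam:
  assumes "d > 0"
  shows "eval_at d p (Lam l) = lam l (eval_at d p fps_X)"
proof -
  have "eval_at d p Fr = fr (eval_at d p fps_X)"
    using assms by (simp add: Fr_def fr_def eval_at_simps eval_at_inverse divide_inverse)
  moreover have "eval_at d p Gr = fr (- eval_at d p fps_X)"
  proof -
    have "eval_at d p Gr = - (eval_at d p (fps_X * (1 - fps_X) * inverse (1 + fps_X)))"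
      using eval_at_simps(4)[OF assms, of p 0] eval_at_simps(1)[OF assms] unfolding Gr_def by simp
    then show ?thesis
      using assms by (simp add: fr_def eval_at_simps eval_at_inverse divide_inverse)
  qed
  ultimately show ?thesis
    using assms by (simp add: Lam_def lam_def eval_at_simps eval_at_hsym eval_at_inverse divide_inverse)
qed

definition half :: "'a::zero fps \<Rightarrow> 'a fps" where
  "half f = Abs_fps (\<lambda>k. fps_nth f (2 * k))"

lemma eval_at_half:
  assumes "\<And>n. odd n \<Longrightarrow> fps_nth f n = 0"
  shows "eval_at 1 p f = eval_at 2 (p ^ 2) (half f)"
proof -
  have "dilate p f oo fps_X ^ 1 = dilate (p ^ 2) (half f) oo fps_X ^ 2"
    by (rule fps_ext) (auto simp: fps_nth_compose_X_power half_def assms power_mult[symmetric] simp del: power_one_right)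
  then show ?thesis by (simp add: eval_at_def subst_power_def)
qed

lemma tight_rev_upt: "tight (rev [0..<n])"
proof -
  have "sorted_wrt (>) as \<Longrightarrow> tight as" for as
    by (induction as rule: tight.induct) auto
  then show ?thesis by (simp add: sorted_wrt_rev)
qed

theorem num_chains_eq_det_Lam:
  "(of_nat (num_chains n (rev [0..<n])) :: 'a::field_char_0) =
    det (mat n n (\<lambda>(a, b). fps_nth (Lam b) (2 * a)))"
proof -
  \<comment> \<open>Nonnegative integers as points keep the squares distinct, as the second
    evaluation in the variables \<open>x^2\<close> requires.\<close>
  let ?x = "\<lambda>i. eval_at 1 (of_nat i :: 'a) fps_X" and ?q = "\<lambda>i. (of_nat i :: 'a) ^ 2" and ?I = "{0..<n}"
  have sq: "(?x i)^2 = eval_at 2 (?q i) fps_X" for i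
  proof -
    have "(?x i)^2 = eval_at 1 (of_nat i) (fps_X ^ 2)" by (simp add: eval_at_simps)
    also have "\<dots> = eval_at 2 (?q i) (half (fps_X ^ 2))" by (rule eval_at_half) auto
    also have "half (fps_X ^ 2) = (fps_X :: 'a fps)" by (rule fps_ext) (auto simp: half_def)
    finally show ?thesis .
  qed
  have inj: "inj_on ?q ?I" by (auto simp: inj_on_def power2_eq_iff_nonneg simp flip: of_nat_power)
  have R1: "regular_at_0 (bethe (\<lambda>i. cayley (?x i)) (rev [0..<n]) ?I) (of_nat (num_chains n (rev [0..<n])))"
    by (rule bethe_regular_at_0_num_chains) (auto simp: tight_rev_upt inj_on_def)
  have B: "bethe (\<lambda>i. cayley (?x i)) (rev [0..<n]) ?I =
      (\<Prod>i\<in>?I. (1 - ?x i) * (1 + ?x i) ^ n) *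
      dd (\<lambda>i. (?x i)^2) (map (\<lambda>l i. lam l (?x i)) (rev [0..<n])) ?I"
  proof (rule bethe_eq_dd)
    show "inj_on (\<lambda>i. (?x i)^2) ?I" unfolding sq using inj by (simp add: inj_on_def eval_at_X_inj)
  qed (simp_all add: eval_at_X_neq_1 eval_at_X_neq_minus_1)
  have M: "map (\<lambda>l i. lam l (?x i)) (rev [0..<n]) =
      map (\<lambda>C i. eval_at 2 (?q i) C) (map (\<lambda>l. half (Lam l)) (rev [0..<n]))"
    by (simp add: eval_at_half[symmetric] Lam_odd eval_at_Lam)
  have R2: "regular_at_0 ((\<Prod>i\<in>?I. (1 - ?x i) * (1 + ?x i) ^ n) *
      dd (\<lambda>i. eval_at 2 (?q i) fps_X) (map (\<lambda>C i. eval_at 2 (?q i) C) (map (\<lambda>l. half (Lam l)) (rev [0..<n]))) ?I)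
      ((\<Prod>i\<in>?I. 1 * 1 ^ n) * det (mat n n (\<lambda>(a, b). fps_nth (Lam b) (2 * a))))"
  proof (intro regular_at_0_intros regular_at_0_prod regular_at_0_power)
    fix i
    show "regular_at_0 (1 - ?x i) 1"
      using regular_at_0_eval_at[of 1 "of_nat i" "1 - fps_X :: 'a fps"] by (simp add: eval_at_simps)
    show "regular_at_0 (1 + ?x i) 1"
      using regular_at_0_eval_at[of 1 "of_nat i" "1 + fps_X :: 'a fps"] by (simp add: eval_at_simps)
    have "mat n n (\<lambda>(a, b). fps_nth (rev (map (\<lambda>l. half (Lam l)) (rev [0..<n])) ! b) a) =
        mat n n (\<lambda>(a, b). fps_nth (Lam b :: 'a fps) (2 * a))"
      by (rule eq_matI) (auto simp: rev_map half_def)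
    then show "regular_at_0 (dd (\<lambda>i. eval_at 2 (?q i) fps_X) (map (\<lambda>C i. eval_at 2 (?q i) C) (map (\<lambda>l. half (Lam l)) (rev [0..<n]))) ?I)
      (det (mat n n (\<lambda>(a, b). fps_nth (Lam b :: 'a fps) (2 * a))))"
      using dd_regular_at_0[of 2 ?I ?q "map (\<lambda>l. half (Lam l)) (rev [0..<n])"] inj by simp
  qed
  from regular_at_0_unique[OF R1[unfolded B sq M] R2] show ?thesis by simp
qed

definition Od :: "nat \<Rightarrow> 'a::field fps" where
  "Od l = Fr ^ l * inverse (1 - fps_X)"

text \<open>With \<open>h\<close> standing for \<open>hsym\<close> in \<open>Fr\<close> and
  \<open>Gr\<close>, one has \<open>Fr ^ l = h l - Gr * h (l - 1)\<close> and
  \<open>Gr ^ l = h l - Fr * h (l - 1)\<close> for \<open>l > 0\<close>. Inserted into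
  \<open>Od l\<close> minus its reflection, this leaves \<open>2 * fps_X\<close> times
  \<open>Lam l + Lam (l - 1)\<close>. Odd coefficients of \<open>Od\<close> thus arise from even
  ones of \<open>Lam\<close> by a unitriangular column operation.\<close>

lemma Od_nth:
  "fps_nth (Od l :: 'a::field_char_0 fps) (2 * a + 1) =
    fps_nth (Lam l) (2 * a) + (case l of 0 \<Rightarrow> 0 | Suc k \<Rightarrow> fps_nth (Lam k) (2 * a))"
proof -
  define i j :: "'a fps" where "i = inverse (1 - fps_X)" and "j = inverse (1 + fps_X)"
  have i: "(1 - fps_X) * i = 1" and j: "(1 + fps_X) * j = 1"
    by (simp_all add: i_def j_def inverse_mult_eq_1')
  have ij: "inverse (1 - fps_X ^ 2) = i * j"
  proof -
    have "1 - fps_X ^ 2 = (1 - fps_X) * (1 + fps_X :: 'a fps)" by (simp add: power2_eq_square algebra_simps)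
    then show ?thesis unfolding i_def j_def by (simp only: fps_inverse_mult)
  qed
  have 1: "i - j = 2 * fps_X * (i * j)"
  proof -
    have "i - j = ((1 + fps_X) * j) * i - ((1 - fps_X) * i) * j" by (simp add: i j)
    then show ?thesis by (simp add: algebra_simps)
  qed
  have 2: "Fr * j - Gr * i = 2 * fps_X * (i * j)"
  proof -
    have FG: "Fr = fps_X * (1 + fps_X) * i" "Gr = - (fps_X * (1 - fps_X) * j)"
      by (simp_all add: Fr_def Gr_def i_def j_def)
    show ?thesis unfolding FG by (simp add: algebra_simps)
  qed
  have dilate_Od: "dilate (- 1) (Od l) = Gr ^ l * j"
    by (simp add: Od_def dilate_simps(1-6) dilate_Fr dilate_inverse dilate_minus_one_X j_def)
  have "Od l - dilate (- 1) (Od l) = (2 * fps_X * (Lam l + (case l of 0 \<Rightarrow> 0 | Suc k \<Rightarrow> Lam k)) :: 'a fps)"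
  proof (cases l)
    case 0
    then show ?thesis using 1 unfolding dilate_Od ij[symmetric] by (simp add: Od_def Lam_def hsym_0 i_def)
  next
    case (Suc k)
    have F: "Fr ^ l = (hsym l Fr Gr - Gr * hsym k Fr Gr :: 'a fps)" by (simp add: Suc hsym_Suc)
    have G: "Gr ^ l = (hsym l Fr Gr - Fr * hsym k Fr Gr :: 'a fps)"
      using hsym_Suc[of k Gr "Fr :: 'a fps"] by (simp add: Suc hsym_commute[of _ Gr Fr])
    have "Od l - dilate (- 1) (Od l) = hsym l Fr Gr * (i - j) + hsym k Fr Gr * (Fr * j - Gr * i)"
      unfolding dilate_Od unfolding Od_def F G i_def[symmetric] by (simp add: algebra_simps)
    also have "\<dots> = 2 * fps_X * (Lam l + Lam k)"
      unfolding 1 2 Lam_def ij by (simp add: algebra_simps)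
    finally show ?thesis using Suc by simp
  qed
  moreover define R :: "'a fps" where "R = Lam l + (case l of 0 \<Rightarrow> 0 | Suc k \<Rightarrow> Lam k)"
  ultimately have "Od l - dilate (- 1) (Od l) = fps_X * (fps_const 2 * R)"
    by (simp add: numeral_fps_const mult_ac)
  then have "fps_nth (Od l - dilate (- 1) (Od l)) (Suc (2 * a)) = fps_nth (fps_X * (fps_const 2 * R)) (Suc (2 * a))"
    by (rule arg_cong)
  then have "2 * fps_nth (Od l) (Suc (2 * a)) = 2 * fps_nth R (2 * a)" by simp
  then have "fps_nth (Od l) (Suc (2 * a)) = fps_nth R (2 * a)" by simp
  then show ?thesis by (cases l) (simp_all add: R_def)
qed

theorem num_chains_eq_det:
  "(of_nat (num_chains n (rev [0..<n])) :: 'a::field_char_0) =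
    det (mat n n (\<lambda>(a, b). fps_nth (Od b) (2 * a + 1)))"
proof -
  let ?L = "mat n n (\<lambda>(a, b). fps_nth (Lam b :: 'a fps) (2 * a))"
  define U :: "'a mat" where "U = mat n n (\<lambda>(a, b). if a = b then 1 else if Suc a = b then 1 else 0)"
  have "mat n n (\<lambda>(a, b). fps_nth (Od b) (2 * a + 1)) = ?L * U"
  proof (rule eq_matI)
    fix a b assume ab: "a < dim_row (?L * U)" "b < dim_col (?L * U)"
    then have ab: "a < n" "b < n" by (auto simp: U_def)
    have "(?L * U) $$ (a, b) = (\<Sum>i\<in>{0..<n}. fps_nth (Lam i) (2 * a) * (if i = b then 1 else if Suc i = b then 1 else 0))"
      using ab by (simp add: U_def scalar_prod_def)
    also have "\<dots> = (\<Sum>i\<in>{0..<n}. (if i = b then fps_nth (Lam i) (2 * a) else 0) + (if Suc i = b then fps_nth (Lam i) (2 * a) else 0))"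
      by (rule sum.cong) auto
    also have "\<dots> = fps_nth (Lam b) (2 * a) + (case b of 0 \<Rightarrow> 0 | Suc k \<Rightarrow> fps_nth (Lam k) (2 * a))"
      using ab by (cases b) (auto simp: sum.distrib)
    finally show "mat n n (\<lambda>(a, b). fps_nth (Od b) (2 * a + 1)) $$ (a, b) = (?L * U) $$ (a, b)"
      using ab by (simp only: index_mat case_prod_conv Od_nth)
  qed (auto simp: U_def)
  moreover have "det (?L * U) = det ?L * det U"
    by (rule det_mult[of _ n]) (auto simp: U_def)
  moreover have "det U = 1"
  proof -
    have "upper_triangular U" by (auto simp: upper_triangular_def U_def)
    then have "det U = prod_list (diag_mat U)"
      by (rule det_upper_triangular[of _ n]) (simp add: U_def)
    also have "\<dots> = 1" by (simp add: prod_list_diag_prod U_def)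
    finally show ?thesis .
  qed
  ultimately show ?thesis by (simp only: num_chains_eq_det_Lam mult_1_right)
qed

section \<open>The constant term\<close>

lift_definition mls_embed :: "nat \<Rightarrow> 'a::comm_ring_1 fps \<Rightarrow> 'a mls" is
  "\<lambda>i f k. if Poly_Mapping.keys k \<subseteq> {i} \<and> Poly_Mapping.lookup k i \<ge> 0
     then fps_nth f (nat (Poly_Mapping.lookup k i)) else 0"
proof -
  fix i :: nat and f :: "'a fps"
  have "bdd_by 0 (\<lambda>k. if Poly_Mapping.keys k \<subseteq> {i} \<and> Poly_Mapping.lookup k i \<ge> 0
     then fps_nth f (nat (Poly_Mapping.lookup k i)) else 0)"
    unfolding bdd_by_def
  proof (intro allI impI)
    fix k :: "nat \<Rightarrow>\<^sub>0 int" and j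
    assume "(if Poly_Mapping.keys k \<subseteq> {i} \<and> Poly_Mapping.lookup k i \<ge> 0
     then fps_nth f (nat (Poly_Mapping.lookup k i)) else 0) \<noteq> 0"
    then have "Poly_Mapping.keys k \<subseteq> {i}" "Poly_Mapping.lookup k i \<ge> 0" by (auto split: if_splits)
    then have "Poly_Mapping.lookup k j = 0" if "j \<noteq> i"
      using that by (meson in_keys_iff singletonD subsetD)
    then show "Poly_Mapping.lookup 0 j \<le> Poly_Mapping.lookup k j"
      using \<open>Poly_Mapping.lookup k i \<ge> 0\<close> by (cases "j = i") auto
  qed
  then show "\<exists>m. bdd_by m (\<lambda>k. if Poly_Mapping.keys k \<subseteq> {i} \<and> Poly_Mapping.lookup k i \<ge> 0
     then fps_nth f (nat (Poly_Mapping.lookup k i)) else 0)" by blast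
qed

lemma keys_subset_singletonD:
  assumes "Poly_Mapping.keys k \<subseteq> {i}"
  shows "k = Poly_Mapping.single i (Poly_Mapping.lookup k i)"
proof (rule poly_mapping_eqI)
  fix j
  show "Poly_Mapping.lookup k j = Poly_Mapping.lookup (Poly_Mapping.single i (Poly_Mapping.lookup k i)) j"
    using assms by (cases "j = i") (auto simp: lookup_single when_def in_keys_iff subset_iff)
qed

lemma coeff_mls_embed_single: "mls_coeff (mls_embed i f) (Poly_Mapping.single i (int m)) = fps_nth f m"
  by (simp add: mls_embed.rep_eq)

lemma coeff_mls_embed_nonzeroD:
  assumes "mls_coeff (mls_embed i f) k \<noteq> 0"
  obtains m where "k = Poly_Mapping.single i (int m)"
proof -
  from assms have "Poly_Mapping.keys k \<subseteq> {i}" "Poly_Mapping.lookup k i \<ge> 0"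
    by (auto simp: mls_embed.rep_eq split: if_splits)
  then have "k = Poly_Mapping.single i (int (nat (Poly_Mapping.lookup k i)))"
    using keys_subset_singletonD by simp
  then show ?thesis by (rule that)
qed

lemma coeff_mls_embed_eqI:
  fixes F :: "'a::comm_ring_1 mls"
  assumes "\<And>m. mls_coeff F (Poly_Mapping.single i (int m)) = fps_nth f m"
    and "\<And>k. mls_coeff F k \<noteq> 0 \<Longrightarrow> \<exists>m. k = Poly_Mapping.single i (int m)"
  shows "F = mls_embed i f"
proof (rule mls_eqI)
  fix k
  show "mls_coeff F k = mls_coeff (mls_embed i f) k"
  proof (cases "\<exists>m. k = Poly_Mapping.single i (int m)")
    case True
    then show ?thesis using assms(1) by (auto simp: coeff_mls_embed_single)
  next
    case False
    then show ?thesis using assms(2)[of k] coeff_mls_embed_nonzeroD[of i f k] by metis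
  qed
qed

lemma single_int_add: "Poly_Mapping.single i (int m) + Poly_Mapping.single i (int m') = Poly_Mapping.single i (int (m + m'))"
  by (simp add: single_add)

lemma mls_embed_add: "mls_embed i f + mls_embed i g = mls_embed i (f + g)"
proof (rule coeff_mls_embed_eqI)
  fix k assume "mls_coeff (mls_embed i f + mls_embed i g) k \<noteq> 0"
  then have "mls_coeff (mls_embed i f) k \<noteq> 0 \<or> mls_coeff (mls_embed i g) k \<noteq> 0" by (auto simp: plus_mls.rep_eq)
  then show "\<exists>m. k = Poly_Mapping.single i (int m)" by (auto elim: coeff_mls_embed_nonzeroD)
qed (simp add: plus_mls.rep_eq coeff_mls_embed_single)

lemma mls_embed_uminus: "- mls_embed i f = mls_embed i (- f)"
proof (rule coeff_mls_embed_eqI)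
  fix k assume "mls_coeff (- mls_embed i f) k \<noteq> 0"
  then have "mls_coeff (mls_embed i f) k \<noteq> 0" by (auto simp: uminus_mls.rep_eq)
  then show "\<exists>m. k = Poly_Mapping.single i (int m)" by (auto elim: coeff_mls_embed_nonzeroD)
qed (simp add: uminus_mls.rep_eq coeff_mls_embed_single)

lemma mls_embed_diff: "mls_embed i f - mls_embed i g = mls_embed i (f - g)"
  using mls_embed_add[of i f "- g"] by (simp add: mls_embed_uminus[symmetric])

lemma mls_embed_mult: "mls_embed i f * mls_embed i g = mls_embed i (f * g)"
proof (rule coeff_mls_embed_eqI)
  fix k assume "mls_coeff (mls_embed i f * mls_embed i g) k \<noteq> 0"
  then obtain a where "mls_coeff (mls_embed i f) a \<noteq> 0" "mls_coeff (mls_embed i g) (k - a) \<noteq> 0"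
    unfolding times_mls.rep_eq conv_def by (elim sum.not_neutral_contains_not_neutral) auto
  then obtain m m' where "a = Poly_Mapping.single i (int m)" "k - a = Poly_Mapping.single i (int m')"
    by (auto elim!: coeff_mls_embed_nonzeroD)
  then have "k = Poly_Mapping.single i (int (m' + m))"
    by (metis diff_add_cancel single_int_add)
  then show "\<exists>m. k = Poly_Mapping.single i (int m)" by blast
next
  fix m
  let ?s = "\<lambda>j. Poly_Mapping.single i (int j)"
  have inj: "inj_on ?s A" for A by (auto simp: inj_on_def poly_mapping_eq_iff fun_eq_iff lookup_single when_def)
  have diff: "?s m - ?s j = ?s (m - j)" if "j \<le> m" for j
    using single_int_add[of i "m - j" j] that by (metis add_diff_cancel_right' le_add_diff_inverse2)
  have "mls_coeff (mls_embed i f * mls_embed i g) (?s m) = (\<Sum>a\<in>?s ` {0..m}. mls_coeff (mls_embed i f) a * mls_coeff (mls_embed i g) (?s m - a))"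
    unfolding times_mls.rep_eq
  proof (rule conv_eq_sum)
    fix a assume "mls_coeff (mls_embed i f) a \<noteq> 0" "mls_coeff (mls_embed i g) (?s m - a) \<noteq> 0"
    then obtain j j' where j: "a = ?s j" "?s m - a = ?s j'" by (auto elim!: coeff_mls_embed_nonzeroD)
    then have "?s m = ?s (j' + j)" by (metis diff_add_cancel single_int_add)
    then have "m = j' + j" by (rule injD[OF inj])
    then show "a \<in> ?s ` {0..m}" using j by auto
  qed simp
  also have "\<dots> = (\<Sum>j=0..m. fps_nth f j * fps_nth g (m - j))"
    unfolding sum.reindex[OF inj] o_def
  proof (rule sum.cong[OF refl])
    fix j assume "j \<in> {0..m}"
    then have "j \<le> m" by simp
    then show "mls_coeff (mls_embed i f) (?s j) * mls_coeff (mls_embed i g) (?s m - ?s j) = fps_nth f j * fps_nth g (m - j)"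
      by (simp only: diff coeff_mls_embed_single)
  qed
  finally show "mls_coeff (mls_embed i f * mls_embed i g) (?s m) = fps_nth (f * g) m" by (simp add: fps_mult_nth)
qed

lemma mls_embed_1: "1 = mls_embed i 1"
proof (rule coeff_mls_embed_eqI)
  fix k :: "nat \<Rightarrow>\<^sub>0 int" assume "mls_coeff (1 :: 'a mls) k \<noteq> 0"
  then have "k = Poly_Mapping.single i (int 0)" by (simp add: one_mls.rep_eq split: if_splits)
  then show "\<exists>m. k = Poly_Mapping.single i (int m)" by blast
next
  fix m
  have "Poly_Mapping.single i (int m) = 0 \<longleftrightarrow> m = 0"
    by (auto simp: poly_mapping_eq_iff fun_eq_iff lookup_single when_def)
  then show "mls_coeff (1 :: 'a mls) (Poly_Mapping.single i (int m)) = fps_nth 1 m"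
    by (simp add: one_mls.rep_eq)
qed

lemma mls_embed_X: "mls_X i = mls_embed i fps_X"
proof (rule coeff_mls_embed_eqI)
  fix k :: "nat \<Rightarrow>\<^sub>0 int" assume "mls_coeff (mls_X i :: 'a mls) k \<noteq> 0"
  then have "k = Poly_Mapping.single i (int 1)" by (simp add: mls_X.rep_eq split: if_splits)
  then show "\<exists>m. k = Poly_Mapping.single i (int m)" by blast
next
  fix m
  have "Poly_Mapping.single i (int m) = Poly_Mapping.single i 1 \<longleftrightarrow> m = 1"
    by (auto simp: poly_mapping_eq_iff fun_eq_iff lookup_single when_def)
  then show "mls_coeff (mls_X i :: 'a mls) (Poly_Mapping.single i (int m)) = fps_nth fps_X m"
    by (simp add: mls_X.rep_eq)
qed

lemma mls_embed_power: "mls_embed i f ^ n = mls_embed i (f ^ n)"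
  by (induction n) (simp_all add: mls_embed_mult mls_embed_1[symmetric])

section \<open>Separation of variables in constant terms\<close>

definition depends_on :: "nat set \<Rightarrow> 'a::comm_ring_1 mls \<Rightarrow> bool" where
  "depends_on S f \<longleftrightarrow> (\<forall>k. mls_coeff f k \<noteq> 0 \<longrightarrow> Poly_Mapping.keys k \<subseteq> S)"

lemma depends_on_mult:
  assumes "depends_on S f" "depends_on T g"
  shows "depends_on (S \<union> T) (f * g)"
  unfolding depends_on_def
proof (intro allI impI)
  fix k assume "mls_coeff (f * g) k \<noteq> 0"
  then obtain a where a: "mls_coeff f a \<noteq> 0" "mls_coeff g (k - a) \<noteq> 0"
    unfolding times_mls.rep_eq conv_def by (elim sum.not_neutral_contains_not_neutral) auto
  have "Poly_Mapping.keys (a + (k - a)) \<subseteq> Poly_Mapping.keys a \<union> Poly_Mapping.keys (k - a)"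
    by (rule keys_add)
  then show "Poly_Mapping.keys k \<subseteq> S \<union> T" using a assms by (auto simp: depends_on_def)
qed

text \<open>Exponent vectors that add up to 0 involve the same variables, hence none if the variable
  sets are disjoint.\<close>

lemma const_term_mult:
  assumes "depends_on S f" "depends_on T g" "S \<inter> T = {}"
  shows "const_term (f * g) = const_term f * const_term g"
proof -
  have "mls_coeff (f * g) 0 = (\<Sum>a\<in>{0}. mls_coeff f a * mls_coeff g (0 - a))"
    unfolding times_mls.rep_eq
  proof (rule conv_eq_sum)
    fix a assume "mls_coeff f a \<noteq> 0" "mls_coeff g (0 - a) \<noteq> 0"
    then have "Poly_Mapping.keys a \<subseteq> S" "Poly_Mapping.keys (0 - a) \<subseteq> T"
      using assms unfolding depends_on_def by blast+
    moreover have "Poly_Mapping.keys (0 - a) = Poly_Mapping.keys a"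
      by (auto simp: in_keys_iff lookup_minus)
    ultimately have "Poly_Mapping.keys a = {}" using assms(3) by blast
    then show "a \<in> {0}" by simp
  qed simp
  then show ?thesis by (simp add: const_term_def)
qed

lemma const_term_prod:
  assumes "finite S" "\<And>i. i \<in> S \<Longrightarrow> depends_on {i} (f i)"
  shows "const_term (prod f S) = (\<Prod>i\<in>S. const_term (f i)) \<and> depends_on S (prod f S)"
  using assms
proof (induction S rule: finite_induct)
  case empty
  show ?case by (simp add: const_term_def depends_on_def one_mls.rep_eq)
next
  case (insert i S)
  then have IH: "const_term (prod f S) = (\<Prod>i\<in>S. const_term (f i))" "depends_on S (prod f S)" by auto
  have i: "depends_on {i} (f i)" using insert.prems by simp
  show ?case
    using const_term_mult[OF i IH(2)] depends_on_mult[OF i IH(2)] insert.hyps IH(1) by simp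
qed

text \<open>Here \<open>g\<close> is \<open>f\<close> divided by the \<open>m\<close>-th power of
  the variable, described by multiplication so that no negative powers appear.\<close>

lemma const_term_X_inverse:
  fixes g :: "'a::comm_ring_1 mls"
  assumes "mls_X i ^ m * g = mls_embed i f"
  shows "const_term g = fps_nth f m" "depends_on {i} g"
proof -
  have X: "mls_coeff (mls_X i ^ m * g) k = mls_coeff g (k - Poly_Mapping.single i (int m))" for k
  proof (induction m arbitrary: k)
    case (Suc m)
    have "k - Poly_Mapping.single i 1 - Poly_Mapping.single i (int m) = k - Poly_Mapping.single i (int (Suc m))"
      by (simp only: diff_diff_eq single_add[symmetric] of_nat_Suc)
    then show ?case by (simp only: power_Suc mult.assoc mls_coeff_X_times Suc)
  qed simp
  show "const_term g = fps_nth f m"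
    using X[of "Poly_Mapping.single i (int m)"] by (simp add: assms coeff_mls_embed_single const_term_def)
  show "depends_on {i} g"
    unfolding depends_on_def
  proof (intro allI impI)
    fix k assume "mls_coeff g k \<noteq> 0"
    then have "mls_coeff (mls_embed i f) (k + Poly_Mapping.single i (int m)) \<noteq> 0"
      using X[of "k + Poly_Mapping.single i (int m)"] by (simp add: assms)
    then obtain m' where "k + Poly_Mapping.single i (int m) = Poly_Mapping.single i (int m')"
      by (rule coeff_mls_embed_nonzeroD)
    then have "k = Poly_Mapping.single i (int m') - Poly_Mapping.single i (int m)"
      by (metis add_diff_cancel_right')
    then have "k = Poly_Mapping.single i (int m' - int m)" by (simp add: single_diff)
    then show "Poly_Mapping.keys k \<subseteq> {i}" by simp
  qed
qed

lemma prod_pairs: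
  fixes g :: "nat \<Rightarrow> nat \<Rightarrow> 'a::comm_monoid_mult"
  shows "(\<Prod>(i, j) \<in> {(i, j). 1 \<le> i \<and> i < j \<and> j \<le> n}. g i j) = (\<Prod>b<n. \<Prod>c<b. g (Suc c) (Suc b))"
proof -
  have "(\<Prod>b<n. \<Prod>c<b. g (Suc c) (Suc b)) = (\<Prod>(b, c) \<in> (SIGMA b:{..<n}. {..<b}). g (Suc c) (Suc b))"
    by (subst prod.Sigma) auto
  also have "\<dots> = (\<Prod>(i, j) \<in> {(i, j). 1 \<le> i \<and> i < j \<and> j \<le> n}. g i j)"
    by (rule prod.reindex_bij_witness[of _ "\<lambda>(i, j). (j - 1, i - 1)" "\<lambda>(b, c). (Suc c, Suc b)"]) auto
  finally show ?thesis ..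
qed

text \<open>Each index lies in exactly \<open>n - 1\<close> pairs.\<close>

lemma prod_pairs_mult:
  fixes h :: "nat \<Rightarrow> 'a::comm_monoid_mult"
  shows "(\<Prod>b<n. \<Prod>c<b. h c * h b) = (\<Prod>a<n. h a ^ (n - 1))"
proof (induction n)
  case (Suc n)
  have eq: "(\<Prod>a<n. h a ^ (n - 1)) * (\<Prod>a<n. h a) = (\<Prod>a<n. h a ^ n)"
    unfolding prod.distrib[symmetric]
  proof (rule prod.cong[OF refl])
    fix a assume "a \<in> {..<n}"
    then show "h a ^ (n - 1) * h a = h a ^ n" by (cases n) (auto simp: mult.commute)
  qed
  have "(\<Prod>c<n. h c * h n) = (\<Prod>a<n. h a) * h n ^ n" by (simp add: prod.distrib)
  then show ?case
    by (simp only: prod.lessThan_Suc[of _ n] Suc.IH mult.assoc[symmetric] eq diff_Suc_1)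
qed simp

lemma prod_shift_Suc:
  fixes f :: "nat \<Rightarrow> 'a::comm_monoid_mult"
  shows "(\<Prod>i\<in>{1..n}. f (i - 1)) = (\<Prod>a<n. f a)"
  by (rule prod.reindex_cong[of Suc]) (simp_all add: image_Suc_lessThan)

lemma const_term_sum: "const_term (sum f S) = (\<Sum>i\<in>S. const_term (f i))"
  by (induction S rule: infinite_finite_induct) (simp_all add: const_term_def plus_mls.rep_eq zero_mls.rep_eq)

lemma const_term_sign: "const_term (of_int (sign p) * f) = of_int (sign p) * const_term f"
  by (simp add: sign_def const_term_def uminus_mls.rep_eq)

text \<open>The factors of the numerator are \<open>(x\<^sub>j - x\<^sub>i) (1 + x\<^sub>i + x\<^sub>j - x\<^sub>i x\<^sub>j) = (1 - x\<^sub>i) (1 - x\<^sub>j) (F\<^sub>j - F\<^sub>i)\<close>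
  with \<open>F = x (1 + x) / (1 - x)\<close>, so the numerator is essentially a Vandermonde determinant.\<close>

theorem const_term_eq_det:
  fixes n :: nat
  shows "const_term
      ((\<Prod>(i, j) \<in> {(i, j). 1 \<le> i \<and> i < j \<and> j \<le> n}.
          (mls_X j - mls_X i) * (1 + mls_X i + mls_X j - mls_X i * mls_X j))
       / (\<Prod>i = 1..n. mls_X i ^ (2 * i - 1) * (1 - mls_X i) ^ n)) =
    det (mat n n (\<lambda>(a, b). fps_nth (Od b :: 'a::field fps) (2 * a + 1)))"
proof -
  let ?X = "\<lambda>a. mls_X (Suc a) :: 'a mls"
  define u where "u a = mls_embed (Suc a) (inverse (1 - fps_X :: 'a fps))" for a
  define F where "F a = mls_embed (Suc a) (Fr :: 'a fps)" for a
  have one_X: "1 - ?X a = mls_embed (Suc a) (1 - fps_X)" for a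
    by (simp add: mls_embed_1[of "Suc a"] mls_embed_X mls_embed_diff)
  have u: "(1 - ?X a) * u a = 1" for a
    unfolding one_X u_def mls_embed_mult by (simp add: mls_embed_1[of "Suc a"] inverse_mult_eq_1')
  have F: "(1 - ?X a) * F a = ?X a * (1 + ?X a)" for a
  proof -
    have "(1 - fps_X) * Fr = fps_X * (1 + fps_X :: 'a fps)"
      using inverse_mult_eq_1'[of "1 - fps_X :: 'a fps"] by (simp add: Fr_def mult_ac)
    then show ?thesis
      unfolding one_X F_def mls_embed_mult by (simp add: mls_embed_1[of "Suc a"] mls_embed_X mls_embed_add mls_embed_mult)
  qed
  have "\<exists>g. ?X a * g = 1" for a using mls_X_unit[of "Suc a", where 'a = 'a] by (metis dvdE)
  then obtain Y where Y: "?X a * Y a = 1" for a by metis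
  have pair: "(?X b - ?X c) * (1 + ?X c + ?X b - ?X c * ?X b) = (1 - ?X c) * (1 - ?X b) * (F b - F c)" for b c
  proof -
    have "(1 - ?X c) * (1 - ?X b) * (F b - F c) =
        (1 - ?X c) * ((1 - ?X b) * F b) - (1 - ?X b) * ((1 - ?X c) * F c)" by (simp add: algebra_simps)
    then show ?thesis unfolding F by (simp add: algebra_simps)
  qed
  let ?N = "\<Prod>(i, j) \<in> {(i, j). 1 \<le> i \<and> i < j \<and> j \<le> n}.
          (mls_X j - mls_X i) * (1 + mls_X i + mls_X j - mls_X i * mls_X j) :: 'a mls"
  let ?D = "\<Prod>i = 1..n. mls_X i ^ (2 * i - 1) * (1 - mls_X i) ^ n :: 'a mls"
  have N: "?N = (\<Prod>a<n. (1 - ?X a) ^ (n - 1)) * (\<Prod>b<n. \<Prod>c<b. F b - F c)"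
    unfolding prod_pairs pair prod_pairs_mult[symmetric] by (simp add: prod.distrib)
  have D: "?D = (\<Prod>a<n. ?X a ^ (2 * a + 1) * (1 - ?X a) ^ n)"
    by (rule prod.reindex_cong[of Suc]) (auto simp: image_Suc_lessThan)
  have "?D * (\<Prod>a<n. Y a ^ (2 * a + 1) * u a ^ n) = 1"
    unfolding D prod.distrib[symmetric]
  proof (rule prod.neutral, rule ballI)
    fix a
    have "?X a ^ (2 * a + 1) * (1 - ?X a) ^ n * (Y a ^ (2 * a + 1) * u a ^ n) =
      (?X a * Y a) ^ (2 * a + 1) * ((1 - ?X a) * u a) ^ n"
      unfolding power_mult_distrib by (simp only: mult_ac)
    then show "?X a ^ (2 * a + 1) * (1 - ?X a) ^ n * (Y a ^ (2 * a + 1) * u a ^ n) = 1"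
      by (simp add: Y u)
  qed
  then have "inverse ?D = (\<Prod>a<n. Y a ^ (2 * a + 1) * u a ^ n)" by (rule mls_inverse_unique)
  then have "?N / ?D = (\<Prod>a<n. (1 - ?X a) ^ (n - 1)) * (\<Prod>b<n. \<Prod>c<b. F b - F c) * (\<Prod>a<n. Y a ^ (2 * a + 1) * u a ^ n)"
    by (simp only: divide_mls_def N)
  also have "\<dots> = (\<Prod>b<n. \<Prod>c<b. F b - F c) * (\<Prod>a<n. (1 - ?X a) ^ (n - 1) * (Y a ^ (2 * a + 1) * u a ^ n))"
    unfolding prod.distrib by (simp only: mult_ac)
  \<comment> \<open>The pairs supply \<open>n - 1\<close> factors \<open>1 - ?X a\<close> against
    \<open>n\<close> in the denominator; the remaining inverse is the one in
    \<open>Od\<close>.\<close>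
  also have "(\<Prod>a<n. (1 - ?X a) ^ (n - 1) * (Y a ^ (2 * a + 1) * u a ^ n)) = (\<Prod>a<n. Y a ^ (2 * a + 1) * u a)"
  proof (rule prod.cong[OF refl])
    fix a assume "a \<in> {..<n}"
    then have "u a ^ n = u a ^ (n - 1) * u a" by (cases n) (auto simp: mult.commute)
    then have "(1 - ?X a) ^ (n - 1) * (Y a ^ (2 * a + 1) * u a ^ n) =
        ((1 - ?X a) * u a) ^ (n - 1) * (Y a ^ (2 * a + 1) * u a)"
      unfolding power_mult_distrib by (simp only: mult_ac)
    then show "(1 - ?X a) ^ (n - 1) * (Y a ^ (2 * a + 1) * u a ^ n) = Y a ^ (2 * a + 1) * u a" by (simp add: u)
  qed
  also have "(\<Prod>b<n. \<Prod>c<b. F b - F c) = (\<Sum>p | p permutes {0..<n}. of_int (sign p) * (\<Prod>a<n. F a ^ p a))"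
  proof -
    have "(\<Prod>b<n. \<Prod>c<b. F b - F c) = det (mat n n (\<lambda>(a, b). F a ^ b))" by (rule det_vandermonde[symmetric])
    also have "\<dots> = det (mat n n (\<lambda>(a, b). F b ^ a))"
      by (subst det_transpose[symmetric, of _ n]) (auto intro!: arg_cong[of _ _ det] eq_matI)
    finally show ?thesis unfolding det_mat_cols[of n "\<lambda>a b. F b ^ a"] .
  qed
  finally have "?N / ?D = (\<Sum>p | p permutes {0..<n}. of_int (sign p) * (\<Prod>a<n. F a ^ p a * (Y a ^ (2 * a + 1) * u a)))"
    by (simp only: sum_distrib_right prod.distrib mult.assoc)
  then have "const_term (?N / ?D) =
      (\<Sum>p | p permutes {0..<n}. of_int (sign p) * const_term (\<Prod>a<n. F a ^ p a * (Y a ^ (2 * a + 1) * u a)))"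
    by (simp only: const_term_sum const_term_sign)
  also have "\<dots> = (\<Sum>p | p permutes {0..<n}. of_int (sign p) * (\<Prod>a<n. fps_nth (Od (p a) :: 'a fps) (2 * a + 1)))"
  proof (intro sum.cong refl arg_cong[of _ _ "(*) _"])
    fix p
    let ?g = "\<lambda>a. F a ^ p a * (Y a ^ (2 * a + 1) * u a)"
    \<comment> \<open>Clearing the pole leaves the power series \<open>Od (p a)\<close>, so the
      constant term of \<open>?g a\<close> is its coefficient in degree
      \<open>2 * a + 1\<close>.\<close>
    have g: "?X a ^ (2 * a + 1) * ?g a = mls_embed (Suc a) (Od (p a))" for a
    proof -
      have "?X a ^ (2 * a + 1) * ?g a = (?X a * Y a) ^ (2 * a + 1) * (F a ^ p a * u a)"
        unfolding power_mult_distrib by (simp only: mult_ac)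
      then show ?thesis by (simp add: Y F_def u_def mls_embed_power mls_embed_mult Od_def)
    qed
    have "const_term (\<Prod>i\<in>{1..n}. ?g (i - 1)) = (\<Prod>i\<in>{1..n}. const_term (?g (i - 1)))"
    proof (rule const_term_prod[THEN conjunct1])
      fix i assume "i \<in> {1..n}"
      then have "Suc (i - 1) = i" by simp
      then show "depends_on {i} (?g (i - 1))" using const_term_X_inverse(2)[OF g[of "i - 1"]] by metis
    qed simp
    then have "const_term (\<Prod>a<n. ?g a) = (\<Prod>a<n. const_term (?g a))"
      by (simp only: prod_shift_Suc[of ?g n] prod_shift_Suc[of "\<lambda>a. const_term (?g a)" n])
    moreover have "const_term (?g a) = fps_nth (Od (p a)) (2 * a + 1)" for a
      by (rule const_term_X_inverse(1)[OF g[of a]])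
    ultimately show "const_term (\<Prod>a<n. ?g a) = (\<Prod>a<n. fps_nth (Od (p a)) (2 * a + 1))"
      by (simp only:)
  qed
  also have "\<dots> = det (mat n n (\<lambda>(a, b). fps_nth (Od b :: 'a fps) (2 * a + 1)))"
  proof -
    have "det (mat n n (\<lambda>(a, b). fps_nth (Od b :: 'a fps) (2 * a + 1))) =
        det (mat n n (\<lambda>(a, b). fps_nth (Od a :: 'a fps) (2 * b + 1)))"
      by (subst det_transpose[symmetric, of _ n]) (auto intro!: arg_cong[of _ _ det] eq_matI)
    then show ?thesis unfolding det_mat_cols[of n "\<lambda>a b. fps_nth (Od a) (2 * b + 1)"] ..
  qed
  finally show ?thesis .
qed

text \<open>The orientation \<open>mls_X j - mls_X i\<close> for \<open>i < j\<close> fixes the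
  sign: it is that of the Vandermonde determinant, and for \<open>n = 2\<close> both sides are 4.
  Reversing all differences would multiply the right-hand side by
  \<open>(- 1) ^ (n * (n - 1) div 2)\<close>.\<close>

theorem theorem8p4:
  fixes n :: nat
  assumes "n \<ge> 1"
  shows "(of_nat (Z20V n) :: rat) =
    const_term
      ((\<Prod>(i, j) \<in> {(i, j). 1 \<le> i \<and> i < j \<and> j \<le> n}.
          (mls_X j - mls_X i) * (1 + mls_X i + mls_X j - mls_X i * mls_X j))
       / (\<Prod>i = 1..n. mls_X i ^ (2 * i - 1) * (1 - mls_X i) ^ n))"
  unfolding const_term_eq_det using assms num_chains_eq_det[of n, where 'a = rat]
  by (simp add: Z20V_eq_num_chains)

end
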